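(* Let $X\subset\mathbb{C}$ be a domain and let $H$ be a reproducing kernel Hilbert space of holomorphic functions on $X$ with reproducing kernels $\{k_x\}_{x\in X}$. Suppose $H$ is nondegenerate in the sense that for all $x,y\in X$ with $x\neq y$ there are $h,k\in H$ with $h(x)\neq 0$ and $k(x)\neq k(y)$. Let $\delta,\hat\delta,\check\delta,\delta_{BS}$ be the distances on $X$, and $\ell_\delta,\ell_{\hat\delta},\ell_{\check\delta},\ell_{BS}$ the length functionals, defined in the context; for a distance $\mathcal{D}$ let $\mathcal{D}^{*}$ be the inner distance induced by $\mathcal{D}$. Then: 1. For any smooth curve $\gamma$ in $X$, $\ell_{\delta}(\gamma)=\ell_{\hat\delta}(\gamma)=\ell_{\check\delta}(\gamma)=\frac12\ell_{BS}(\gamma)$. 2. $\delta^{*}=\hat\delta^{*}=\check\delta^{*}=\check\delta=\frac12\delta_{BS}$. 3. For all $x,y\in X$ with $x\neq y$, $\hat\delta(x,y)<\hat\delta^{*}(x,y)$. 4. For all $x,y\in X$ with $x\neq y$, $\delta(x,y)<\delta^{*}(x,y)$.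
   Context: A reproducing kernel Hilbert space $H$ on $X$ is a complex Hilbert space of functions on $X$ such that for each $x\in X$ there is $k_x\in H$ with $\langle f,k_x\rangle=f(x)$ for all $f\in H$. Put $\hat k_x=k_x/\|k_x\|$. Distances: $\delta(x,y)=\sqrt{1-|\langle\hat k_x,\hat k_y\rangle|^2}$ and $\hat\delta(x,y)=\sqrt2\,\sqrt{1-|\langle\hat k_x,\hat k_y\rangle|}$. The Riemannian metric associated with $H$ is $ds_H^2=\left(\frac{\partial^2}{\partial z\,\partial\bar z}\log k_z(z)\right)|dz|^2$. $\ell_{BS}(\gamma)$ is the length of a smooth curve $\gamma$ measured using $ds_H$, and $\delta_{BS}(x,y)=\inf\{\ell_{BS}(\gamma):\gamma\text{ a smooth curve connecting }x\text{ to }y\}$. Let $P(H)$ be the projective space of one-dimensional subspaces of $H$ with the Fubini-Study metric (the natural Kähler metric, extended to the generally infinite dimensional $P(H)$), normalized so that for nearby points the resulting distance $\check\delta$ agrees with $\delta$ and $\hat\delta$ up to third order errors (if the three distances are $O(\varepsilon)$, their differences are $O(\varepsilon^3)$). $\check\delta$ is the distance on $X$ obtained by restricting the Fubini-Study metric to the image of $X$ under the map $x\mapsto[k_x]\in P(H)$, where $[k_x]$ is the span of $k_x$, and pulling it back to $X$ by this map. For a distance function $\mathcal{D}$ on $X$ and a curve $\gamma:[a,b]\to X$, $\ell_{\mathcal{D}}(\gamma)=\sup\{\sum_{i=0}^{n-1}\mathcal{D}(\gamma(t_i),\gamma(t_{i+1})):a=t_0<t_1<\dots<t_n=b\}$,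 and $\mathcal{D}^{*}(x,y)=\inf\{\ell_{\mathcal{D}}(\gamma):\gamma\text{ a curve from }x\text{ to }y\}$.
   Formalization: ∂²/∂z∂z̄ is taken without the usual factors 1/2 (the full Laplacian), since with Wirtinger operators the factor ½ in 1 and 2 fails (Hardy space); items 3 and 4 assume dim H≠1, since they fail for H=span{z} on C∖{0}. *)

theory Defs
  imports "HOL-Analysis.Analysis"
begin

(* Functions on X are total functions that vanish off X, so that equality of elements of H
   is equality on X.  The inner product is linear in the first argument. *)
locale reproducing_kernel_hilbert_space =
  fixes X :: "'a set"
    and H :: "('a \<Rightarrow> complex) set"
    and ip :: "('a \<Rightarrow> complex) \<Rightarrow> ('a \<Rightarrow> complex) \<Rightarrow> complex"
    and k :: "'a \<Rightarrow> 'a \<Rightarrow> complex"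
  assumes vanish_off: "f \<in> H \<Longrightarrow> x \<notin> X \<Longrightarrow> f x = 0"
    and zero_mem: "(\<lambda>z. 0) \<in> H"
    and add_mem: "f \<in> H \<Longrightarrow> g \<in> H \<Longrightarrow> (\<lambda>z. f z + g z) \<in> H"
    and scale_mem: "f \<in> H \<Longrightarrow> (\<lambda>z. c * f z) \<in> H"
    and ip_add: "f \<in> H \<Longrightarrow> g \<in> H \<Longrightarrow> h \<in> H \<Longrightarrow> ip (\<lambda>z. f z + g z) h = ip f h + ip g h"
    and ip_scale: "f \<in> H \<Longrightarrow> g \<in> H \<Longrightarrow> ip (\<lambda>z. c * f z) g = c * ip f g"
    and ip_cnj: "f \<in> H \<Longrightarrow> g \<in> H \<Longrightarrow> ip g f = cnj (ip f g)"
    and ip_nonneg: "f \<in> H \<Longrightarrow> 0 \<le> Re (ip f f)"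
    and ip_definite: "f \<in> H \<Longrightarrow> ip f f = 0 \<Longrightarrow> f = (\<lambda>z. 0)"
    and complete: "\<And>F. (\<And>n::nat. F n \<in> H) \<Longrightarrow>
      (\<And>e. 0 < e \<Longrightarrow> \<exists>N. \<forall>m\<ge>N. \<forall>n\<ge>N.
         sqrt (Re (ip (\<lambda>z. F m z - F n z) (\<lambda>z. F m z - F n z))) < e) \<Longrightarrow>
      \<exists>f\<in>H. (\<lambda>n. sqrt (Re (ip (\<lambda>z. F n z - f z) (\<lambda>z. F n z - f z)))) \<longlonglongrightarrow> 0"
    and kernel_mem: "x \<in> X \<Longrightarrow> k x \<in> H"
    and reproducing: "f \<in> H \<Longrightarrow> x \<in> X \<Longrightarrow> ip f (k x) = f x"

definition hnorm :: "(('a \<Rightarrow> complex) \<Rightarrow> ('a \<Rightarrow> complex) \<Rightarrow> complex) \<Rightarrow> ('a \<Rightarrow> complex) \<Rightarrow> real"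
  where "hnorm ip f = sqrt (Re (ip f f))"

definition one_dimensional :: "('a \<Rightarrow> complex) set \<Rightarrow> bool"
  where "one_dimensional H \<longleftrightarrow> (\<exists>f. f \<noteq> (\<lambda>z. 0) \<and> H = {\<lambda>z. c * f z |c. True})"

definition normalized_kernel ::
  "(('a \<Rightarrow> complex) \<Rightarrow> ('a \<Rightarrow> complex) \<Rightarrow> complex) \<Rightarrow> ('a \<Rightarrow> 'a \<Rightarrow> complex) \<Rightarrow> 'a \<Rightarrow> 'a \<Rightarrow> complex"
  where "normalized_kernel ip k x = (\<lambda>z. k x z / complex_of_real (hnorm ip (k x)))"

definition delta ::
  "(('a \<Rightarrow> complex) \<Rightarrow> ('a \<Rightarrow> complex) \<Rightarrow> complex) \<Rightarrow> ('a \<Rightarrow> 'a \<Rightarrow> complex) \<Rightarrow> 'a \<Rightarrow> 'a \<Rightarrow> real"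
  where "delta ip k x y =
    sqrt (1 - (cmod (ip (normalized_kernel ip k x) (normalized_kernel ip k y)))\<^sup>2)"

definition delta_hat ::
  "(('a \<Rightarrow> complex) \<Rightarrow> ('a \<Rightarrow> complex) \<Rightarrow> complex) \<Rightarrow> ('a \<Rightarrow> 'a \<Rightarrow> complex) \<Rightarrow> 'a \<Rightarrow> 'a \<Rightarrow> real"
  where "delta_hat ip k x y =
    sqrt 2 * sqrt (1 - cmod (ip (normalized_kernel ip k x) (normalized_kernel ip k y)))"

definition curve_in :: "complex set \<Rightarrow> real \<Rightarrow> real \<Rightarrow> (real \<Rightarrow> complex) \<Rightarrow> bool"
  where "curve_in X a b \<gamma> \<longleftrightarrow> a < b \<and> continuous_on {a..b} \<gamma> \<and> \<gamma> ` {a..b} \<subseteq> X"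

(* Smooth means C-infinity on [a,b] (one-sided derivatives at the end points);
   D n is the n-th derivative.  The velocity may vanish. *)
definition smooth_curve_in :: "complex set \<Rightarrow> real \<Rightarrow> real \<Rightarrow> (real \<Rightarrow> complex) \<Rightarrow> bool"
  where "smooth_curve_in X a b \<gamma> \<longleftrightarrow> a < b \<and> \<gamma> ` {a..b} \<subseteq> X \<and>
    (\<exists>D :: nat \<Rightarrow> real \<Rightarrow> complex. D 0 = \<gamma> \<and>
       (\<forall>n. \<forall>t\<in>{a..b}. (D n has_vector_derivative D (Suc n) t) (at t within {a..b})))"

definition curve_length :: "('a \<Rightarrow> 'a \<Rightarrow> real) \<Rightarrow> real \<Rightarrow> real \<Rightarrow> (real \<Rightarrow> 'a) \<Rightarrow> ereal"
  where "curve_length d a b \<gamma> =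
    Sup {ereal (\<Sum>i<n. d (\<gamma> (t i)) (\<gamma> (t (Suc i)))) |(n::nat) t.
           t 0 = a \<and> t n = b \<and> (\<forall>i<n. t i < t (Suc i))}"

definition inner_distance ::
  "complex set \<Rightarrow> (complex \<Rightarrow> complex \<Rightarrow> real) \<Rightarrow> complex \<Rightarrow> complex \<Rightarrow> ereal"
  where "inner_distance X d x y =
    Inf {curve_length d a b \<gamma> |a b \<gamma>. curve_in X a b \<gamma> \<and> \<gamma> a = x \<and> \<gamma> b = y}"

(* F z v is the length of the tangent vector v at the point z. *)
definition riemannian_length ::
  "(complex \<Rightarrow> complex \<Rightarrow> real) \<Rightarrow> real \<Rightarrow> real \<Rightarrow> (real \<Rightarrow> complex) \<Rightarrow> real"
  where "riemannian_length F a b \<gamma> =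
    integral {a..b} (\<lambda>t. F (\<gamma> t) (vector_derivative \<gamma> (at t within {a..b})))"

definition riemannian_distance ::
  "complex set \<Rightarrow> (complex \<Rightarrow> complex \<Rightarrow> real) \<Rightarrow> complex \<Rightarrow> complex \<Rightarrow> real"
  where "riemannian_distance X F x y =
    Inf {riemannian_length F a b \<gamma> |a b \<gamma>. smooth_curve_in X a b \<gamma> \<and> \<gamma> a = x \<and> \<gamma> b = y}"

definition partial_x :: "(complex \<Rightarrow> complex) \<Rightarrow> complex \<Rightarrow> complex"
  where "partial_x u z = vector_derivative (\<lambda>t. u (z + of_real t)) (at 0)"

definition partial_y :: "(complex \<Rightarrow> complex) \<Rightarrow> complex \<Rightarrow> complex"
  where "partial_y u z = vector_derivative (\<lambda>t. u (z + \<i> * of_real t)) (at 0)"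

(* The operators d/dz and d/dzbar WITHOUT the customary factor 1/2, so that d/dz d/dzbar is the
   Laplacian d^2/dx^2 + d^2/dy^2.  This is the normalization for which delta and delta_hat
   are infinitesimally one half of the metric (d/dz d/dzbar log k_z(z)) |dz|^2: for the Szego
   kernel 1 / (1 - z * cnj w) of the unit disc the latter is (2 |dz| / (1 - |z|^2))^2, while delta
   is the pseudohyperbolic distance, infinitesimally |dz| / (1 - |z|^2). *)
definition d_dz :: "(complex \<Rightarrow> complex) \<Rightarrow> complex \<Rightarrow> complex"
  where "d_dz u z = partial_x u z - \<i> * partial_y u z"

definition d_dzbar :: "(complex \<Rightarrow> complex) \<Rightarrow> complex \<Rightarrow> complex"
  where "d_dzbar u z = partial_x u z + \<i> * partial_y u z"

definition ds_BS :: "(complex \<Rightarrow> complex \<Rightarrow> complex) \<Rightarrow> complex \<Rightarrow> complex \<Rightarrow> real"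
  where "ds_BS k z v =
    sqrt (Re (d_dz (d_dzbar (\<lambda>w. of_real (ln (Re (k w w))))) z) * (cmod v)\<^sup>2)"

definition length_BS :: "(complex \<Rightarrow> complex \<Rightarrow> complex) \<Rightarrow> real \<Rightarrow> real \<Rightarrow> (real \<Rightarrow> complex) \<Rightarrow> real"
  where "length_BS k = riemannian_length (ds_BS k)"

definition delta_BS ::
  "complex set \<Rightarrow> (complex \<Rightarrow> complex \<Rightarrow> complex) \<Rightarrow> complex \<Rightarrow> complex \<Rightarrow> real"
  where "delta_BS X k = riemannian_distance X (ds_BS k)"

(* Fubini-Study metric in homogeneous coordinates: the length of the tangent vector to P(H) at [u]
   that is the image of w under the differential of the projection from H - {0} to P(H).  In this
   normalization the Fubini-Study distance of [u] and [v] is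
   arccos (|<u,v>| / (|u| |v|)), which differs from delta and delta_hat by third order terms. *)
definition fubini_study ::
  "(('a \<Rightarrow> complex) \<Rightarrow> ('a \<Rightarrow> complex) \<Rightarrow> complex) \<Rightarrow> ('a \<Rightarrow> complex) \<Rightarrow> ('a \<Rightarrow> complex) \<Rightarrow> real"
  where "fubini_study ip u w =
    sqrt ((hnorm ip u)\<^sup>2 * (hnorm ip w)\<^sup>2 - (cmod (ip w u))\<^sup>2) / (hnorm ip u)\<^sup>2"

(* Derivative at s = 0, in the norm of H, of a curve c in H. *)
definition hderiv ::
  "('a \<Rightarrow> complex) set \<Rightarrow> (('a \<Rightarrow> complex) \<Rightarrow> ('a \<Rightarrow> complex) \<Rightarrow> complex) \<Rightarrow>
   (real \<Rightarrow> 'a \<Rightarrow> complex) \<Rightarrow> 'a \<Rightarrow> complex"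
  where "hderiv H ip c =
    (THE w. w \<in> H \<and>
       ((\<lambda>s. hnorm ip (\<lambda>z. (c s z - c 0 z) / of_real s - w z)) \<longlongrightarrow> 0) (at 0))"

(* Pullback of the Fubini-Study metric tensor along z \<mapsto> [k_z]. *)
definition ds_FS ::
  "(complex \<Rightarrow> complex) set \<Rightarrow> ((complex \<Rightarrow> complex) \<Rightarrow> (complex \<Rightarrow> complex) \<Rightarrow> complex) \<Rightarrow>
   (complex \<Rightarrow> complex \<Rightarrow> complex) \<Rightarrow> complex \<Rightarrow> complex \<Rightarrow> real"
  where "ds_FS H ip k z v = fubini_study ip (k z) (hderiv H ip (\<lambda>s. k (z + of_real s * v)))"

definition delta_check ::
  "complex set \<Rightarrow> (complex \<Rightarrow> complex) set \<Rightarrow>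
   ((complex \<Rightarrow> complex) \<Rightarrow> (complex \<Rightarrow> complex) \<Rightarrow> complex) \<Rightarrow>
   (complex \<Rightarrow> complex \<Rightarrow> complex) \<Rightarrow> complex \<Rightarrow> complex \<Rightarrow> real"
  where "delta_check X H ip k = riemannian_distance X (ds_FS H ip k)"

end

theory Submission
  imports Defs "HOL-Complex_Analysis.Complex_Analysis"
begin

text \<open>The kernels form an antiholomorphic map into \<open>H\<close> that is norm differentiable, by the uniform boundedness
  principle and Cauchy's estimates. Writing \<open>P\<close> for the density of the pulled back Fubini-Study metric, \<open>\<delta>\<close>,
  \<open>\<delta>\<close>-hat and the Fubini-Study distance \<open>arccos (\<bar>\<langle>k\<^sub>p, k\<^sub>q\<rangle>\<bar> / (\<bar>k\<^sub>p\<bar> \<bar>k\<^sub>q\<bar>))\<close> of the ambient projective space are therefore all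
  \<open>P z \<bar>p - q\<bar> + o(\<bar>p - q\<bar>)\<close> as \<open>p\<close> and \<open>q\<close> tend to \<open>z\<close>. The three are ordered as listed and lie below the restricted
  Fubini-Study distance, so their lengths agree on smooth curves; a direct computation of the Laplacian of \<open>ln k\<^sub>z(z)\<close>
  gives \<open>4 P\<^sup>2\<close>.

  On a merely continuous curve the first-order comparison bounds the restricted Fubini-Study distance by the \<open>\<delta>\<close>-length
  wherever \<open>P\<close> is positive. The zeros of \<open>P\<close> are isolated unless \<open>P\<close> vanishes identically, and a curve may skip the loops
  it makes around a zero. Strictness holds because \<open>\<delta>\<close>-hat is the chord \<open>2 sin (\<theta>/2)\<close> of the Fubini-Study angle \<open>\<theta>\<close>.\<close>

section \<open>Lengths of curves\<close>

text \<open>The difficulty lies in \<open>inner_distance\<close>: it ranges over continuous curves,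
  possibly of infinite Euclidean length, whereas \<open>delta_check\<close> and
  \<open>delta_BS\<close> are infima over smooth curves. The density can vanish under the
  hypotheses: for the span of exp z and z^2 exp z on the unit disc the image in projective space
  depends on z^2 only, so the density is 0 at the origin, and z and -z have the same line although
  the restricted distance between them is positive.

  The local comparisons hold in a disc whose radius depends on its centre. Bisection
  (\<open>Bolzano\<close>) spreads them over a parameter interval, since each of them passes to the
  union of two adjacent intervals: integrals add, \<open>curve_length\<close> is superadditive, the
  angle and the restricted distance satisfy the triangle inequality. The error must have a form that
  survives the joining: proportional to the parameter on smooth curves, a factor 1 - e on continuous
  ones.

  If H is one-dimensional, all kernels span the same line and every distance is 0; otherwise some
  function in H vanishes at x but not identically, and this keeps x away from a small circle in the
  metric.\<close>

lemma partition_mono: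
  fixes t :: "nat \<Rightarrow> real"
  assumes "\<forall>i<n. t i < t (Suc i)" "i \<le> j" "j \<le> n"
  shows "t i \<le> t j"
  using assms(2,3)
proof (induction j rule: dec_induct)
  case (step m)
  thus ?case using assms(1) by (metis Suc_le_lessD less_imp_le order_trans le_less Suc_leD)
qed simp

lemma curve_length_leI:
  assumes "\<And>(n::nat) t. t 0 = a \<Longrightarrow> t n = b \<Longrightarrow> (\<And>i. i \<le> n \<Longrightarrow> t i \<in> {a..b}) \<Longrightarrow> (\<And>i. i < n \<Longrightarrow> t i < t (Suc i)) \<Longrightarrow>
      ereal (\<Sum>i<n. d (\<gamma> (t i)) (\<gamma> (t (Suc i)))) \<le> L"
  shows "curve_length d a b \<gamma> \<le> L"
  unfolding curve_length_def
proof (rule Sup_least)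
  fix x assume "x \<in> {ereal (\<Sum>i<n. d (\<gamma> (t i)) (\<gamma> (t (Suc i)))) |(n::nat) t.
           t 0 = a \<and> t n = b \<and> (\<forall>i<n. t i < t (Suc i))}"
  then obtain n :: nat and t where t: "x = ereal (\<Sum>i<n. d (\<gamma> (t i)) (\<gamma> (t (Suc i))))"
    "t 0 = a" "t n = b" "\<forall>i<n. t i < t (Suc i)" by blast
  have "t i \<in> {a..b}" if "i \<le> n" for i
    using partition_mono[OF t(4), of 0 i] partition_mono[OF t(4), of i n] that t(2,3) by auto
  thus "x \<le> L"
    using assms[OF t(2,3)] t(1,4) by blast
qed

lemma curve_length_geI:
  fixes n :: nat
  assumes "t 0 = a" "t n = b" "\<And>i. i < n \<Longrightarrow> t i < t (Suc i)"
  shows "ereal (\<Sum>i<n. d (\<gamma> (t i)) (\<gamma> (t (Suc i)))) \<le> curve_length d a b \<gamma>"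
  unfolding curve_length_def using assms by (intro Sup_upper) blast

lemma curve_length_ge_dist:
  assumes "a < b"
  shows "ereal (d (\<gamma> a) (\<gamma> b)) \<le> curve_length d a b \<gamma>"
  using curve_length_geI[of "\<lambda>i. if i = 0 then a else b" a 1 b d \<gamma>] assms by simp

text \<open>For a = b only the partition with n = 0 exists and gives the sum 0; for a > b there is
  no partition and the length is minus infinity.\<close>

lemma curve_length_nonneg:
  assumes "a \<le> b" "0 \<le> d (\<gamma> a) (\<gamma> b)"
  shows "0 \<le> curve_length d a b \<gamma>"
proof (cases "a = b")
  case True
  thus ?thesis using curve_length_geI[of "\<lambda>i. a" a 0 b d \<gamma>] by (simp add: zero_ereal_def)
next
  case False
  thus ?thesis using curve_length_ge_dist[of a b d \<gamma>] assms
    by (metis ereal_less_eq(5) order_trans less_eq_real_def)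
qed

lemma curve_length_mono:
  assumes "\<And>s t. s \<in> {a..b} \<Longrightarrow> t \<in> {a..b} \<Longrightarrow> d (\<gamma> s) (\<gamma> t) \<le> d' (\<gamma> s) (\<gamma> t)"
  shows "curve_length d a b \<gamma> \<le> curve_length d' a b \<gamma>"
proof (rule curve_length_leI)
  fix n :: nat and t assume t: "t 0 = a" "t n = b" "\<And>i. i \<le> n \<Longrightarrow> t i \<in> {a..b}" "\<And>i. i < n \<Longrightarrow> t i < t (Suc i)"
  have "(\<Sum>i<n. d (\<gamma> (t i)) (\<gamma> (t (Suc i)))) \<le> (\<Sum>i<n. d' (\<gamma> (t i)) (\<gamma> (t (Suc i))))"
    by (intro sum_mono assms t) auto
  also have "ereal \<dots> \<le> curve_length d' a b \<gamma>"
    using t by (intro curve_length_geI)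
  finally show "ereal (\<Sum>i<n. d (\<gamma> (t i)) (\<gamma> (t (Suc i)))) \<le> curve_length d' a b \<gamma>"
    by simp
qed

lemma curve_length_le_increment:
  assumes "\<And>s t. a \<le> s \<Longrightarrow> s < t \<Longrightarrow> t \<le> b \<Longrightarrow> d (\<gamma> s) (\<gamma> t) \<le> g t - g s"
  shows "curve_length d a b \<gamma> \<le> ereal (g b - g a)"
proof (rule curve_length_leI)
  fix n :: nat and t assume t: "t 0 = a" "t n = b" "\<And>i. i \<le> n \<Longrightarrow> t i \<in> {a..b}" "\<And>i. i < n \<Longrightarrow> t i < t (Suc i)"
  have "(\<Sum>i<n. d (\<gamma> (t i)) (\<gamma> (t (Suc i)))) \<le> (\<Sum>i<n. g (t (Suc i)) - g (t i))"
    using t(3) by (intro sum_mono assms t(4)) (auto simp: Suc_le_eq)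
  also have "\<dots> = g b - g a"
    using sum_lessThan_telescope[of "\<lambda>i. g (t i)" n] t(1,2) by simp
  finally show "ereal (\<Sum>i<n. d (\<gamma> (t i)) (\<gamma> (t (Suc i)))) \<le> ereal (g b - g a)"
    by simp
qed

lemma curve_length_superadditive:
  assumes ac: "a \<le> c" and cb: "c \<le> b"
    and nonneg: "0 \<le> d (\<gamma> a) (\<gamma> c)" "0 \<le> d (\<gamma> c) (\<gamma> b)"
  shows "curve_length d a c \<gamma> + curve_length d c b \<gamma> \<le> curve_length d a b \<gamma>"
proof -
  let ?L = "curve_length d a b \<gamma>"
  have 1: "ereal (\<Sum>i<m. d (\<gamma> (s i)) (\<gamma> (s (Suc i)))) + curve_length d c b \<gamma> \<le> ?L"
    if s: "s 0 = a" "s m = c" "\<And>i. i < m \<Longrightarrow> s i < s (Suc i)" for m :: nat and s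
  proof -
    let ?A = "\<Sum>i<m. d (\<gamma> (s i)) (\<gamma> (s (Suc i)))"
    have "curve_length d c b \<gamma> \<le> ?L - ereal ?A"
    proof (rule curve_length_leI)
      fix n :: nat and t assume t: "t 0 = c" "t n = b" "\<And>i. i < n \<Longrightarrow> t i < t (Suc i)"
      \<comment> \<open>The joined partition; index m belongs to both parts, and both give c
        there.\<close>
      define u where "u i = (if i \<le> m then s i else t (i - m))" for i
      have um: "u (m + j) = t j" for j
        using s(2) t(1) by (simp add: u_def)
      have "ereal (\<Sum>i<m+n. d (\<gamma> (u i)) (\<gamma> (u (Suc i)))) \<le> ?L"
      proof (rule curve_length_geI)
        show "u 0 = a" "u (m + n) = b"
          using s(1) t(2) um[of n] by (simp_all add: u_def)
        show "u i < u (Suc i)" if "i < m + n" for i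
        proof (cases "i < m")
          case True
          thus ?thesis using s(3) by (simp add: u_def)
        next
          case False
          then obtain j where "i = m + j"
            using le_Suc_ex linorder_not_less by blast
          thus ?thesis using um[of j] um[of "Suc j"] t(3)[of j] that by simp
        qed
      qed
      moreover have "(\<Sum>i<m+n. d (\<gamma> (u i)) (\<gamma> (u (Suc i)))) = ?A + (\<Sum>j<n. d (\<gamma> (t j)) (\<gamma> (t (Suc j))))"
      proof -
        have "(\<Sum>i<m+n. d (\<gamma> (u i)) (\<gamma> (u (Suc i)))) =
            (\<Sum>i<m. d (\<gamma> (u i)) (\<gamma> (u (Suc i)))) + (\<Sum>j<n. d (\<gamma> (u (m + j))) (\<gamma> (u (m + Suc j))))"
          by (induction n) auto
        moreover have "(\<Sum>i<m. d (\<gamma> (u i)) (\<gamma> (u (Suc i)))) = ?A"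
          by (intro sum.cong) (auto simp: u_def)
        ultimately show ?thesis by (simp only: um)
      qed
      ultimately show "ereal (\<Sum>j<n. d (\<gamma> (t j)) (\<gamma> (t (Suc j)))) \<le> ?L - ereal ?A"
        by (simp add: ereal_le_minus add.commute)
    qed
    thus ?thesis by (simp add: ereal_le_minus add.commute)
  qed
  have p: "0 \<le> curve_length d a c \<gamma>" "0 \<le> curve_length d c b \<gamma>"
    using curve_length_nonneg[OF ac] curve_length_nonneg[OF cb] nonneg by blast+
  show ?thesis
  proof (cases "curve_length d c b \<gamma> = \<infinity>")
    \<comment> \<open>An infinite length cannot be subtracted, but here a single partition of the
      left half already makes the total infinite.\<close>
    case True
    obtain m :: nat and s where "s 0 = a" "s m = c" "\<And>i. i < m \<Longrightarrow> s i < s (Suc i)"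
    proof (cases "a = c")
      case True thus ?thesis using that[of "\<lambda>i. a" 0] by simp
    next
      case False thus ?thesis using that[of "\<lambda>i. if i = 0 then a else c" 1] ac by simp
    qed
    thus ?thesis using 1[of s m] True by simp
  next
    case False
    hence f: "\<bar>curve_length d c b \<gamma>\<bar> \<noteq> \<infinity>"
      using p(2) by auto
    have "curve_length d a c \<gamma> \<le> ?L - curve_length d c b \<gamma>"
    proof (rule curve_length_leI)
      fix m :: nat and s assume "s 0 = a" "s m = c" "\<And>i. i < m \<Longrightarrow> s i < s (Suc i)"
      from 1[OF this] show "ereal (\<Sum>i<m. d (\<gamma> (s i)) (\<gamma> (s (Suc i)))) \<le> ?L - curve_length d c b \<gamma>"
        using f by (simp add: ereal_le_minus)
    qed
    thus ?thesis using f by (simp add: ereal_le_minus)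
  qed
qed

lemma curve_length_subinterval:
  assumes ab: "a \<le> s" "s \<le> t" "t \<le> b"
    and nonneg: "\<And>u v. u \<in> {a..b} \<Longrightarrow> v \<in> {a..b} \<Longrightarrow> 0 \<le> d (\<gamma> u) (\<gamma> v)"
  shows "curve_length d s t \<gamma> \<le> curve_length d a b \<gamma>"
proof -
  have "curve_length d s t \<gamma> \<le> curve_length d a s \<gamma> + curve_length d s t \<gamma>"
    using curve_length_nonneg[of a s d \<gamma>] nonneg ab by (simp add: ereal_le_add_self2)
  also have "\<dots> \<le> curve_length d a t \<gamma>"
    using ab nonneg by (intro curve_length_superadditive) auto
  also have "\<dots> \<le> curve_length d a t \<gamma> + curve_length d t b \<gamma>"
    using curve_length_nonneg[of t b d \<gamma>] nonneg ab by (simp add: ereal_le_add_self)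
  also have "\<dots> \<le> curve_length d a b \<gamma>"
    using ab nonneg by (intro curve_length_superadditive) auto
  finally show ?thesis .
qed

text \<open>The derivative is an argument, so that glued and reparametrized curves carry theirs by
  formula and the degenerate interval a = b is allowed, where a derivative within the interval is
  not determined.\<close>

definition c1_curve :: "complex set \<Rightarrow> real \<Rightarrow> real \<Rightarrow> (real \<Rightarrow> complex) \<Rightarrow> (real \<Rightarrow> complex) \<Rightarrow> bool"
  where "c1_curve X a b g g' \<longleftrightarrow> g ` {a..b} \<subseteq> X \<and>
    (\<forall>t\<in>{a..b}. (g has_vector_derivative g' t) (at t within {a..b})) \<and> continuous_on {a..b} g'"

lemma c1_curve_continuous: "c1_curve X a b g g' \<Longrightarrow> continuous_on {a..b} g"
  unfolding c1_curve_def continuous_on_eq_continuous_within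
  using has_vector_derivative_continuous by blast

lemma smooth_c1_curve:
  assumes "smooth_curve_in X a b \<gamma>"
  shows "c1_curve X a b \<gamma> (\<lambda>t. vector_derivative \<gamma> (at t within {a..b}))"
proof -
  obtain D where D: "D 0 = \<gamma>" "\<And>n t. t \<in> {a..b} \<Longrightarrow> (D n has_vector_derivative D (Suc n) t) (at t within {a..b})"
    and ab: "a < b" "\<gamma> ` {a..b} \<subseteq> X"
    using assms unfolding smooth_curve_in_def by blast
  have v: "vector_derivative \<gamma> (at t within {a..b}) = D 1 t" if "t \<in> {a..b}" for t
    using vector_derivative_within_closed_interval[OF ab(1) that D(2)[OF that, of 0]] D(1) by simp
  have "continuous_on {a..b} (D 1)"
    unfolding continuous_on_eq_continuous_within
    using D(2)[of _ 1] has_vector_derivative_continuous by blast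
  hence "continuous_on {a..b} (\<lambda>t. vector_derivative \<gamma> (at t within {a..b}))"
    by (subst continuous_on_cong[OF refl v])
  thus ?thesis
    unfolding c1_curve_def using ab(2) D(2)[of _ 0] D(1) v by simp
qed

lemma smooth_curve_subinterval:
  assumes "smooth_curve_in X a b \<gamma>" "a \<le> s" "s < t" "t \<le> b"
  shows "smooth_curve_in X s t \<gamma>"
    and "\<And>u. u \<in> {s..t} \<Longrightarrow> vector_derivative \<gamma> (at u within {s..t}) = vector_derivative \<gamma> (at u within {a..b})"
proof -
  have sub: "{s..t} \<subseteq> {a..b}" using assms by auto
  show "smooth_curve_in X s t \<gamma>"
  proof -
    obtain D where D: "D 0 = \<gamma>" "\<And>n t. t \<in> {a..b} \<Longrightarrow> (D n has_vector_derivative D (Suc n) t) (at t within {a..b})"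
      and X: "\<gamma> ` {a..b} \<subseteq> X"
      using assms(1) unfolding smooth_curve_in_def by blast
    have "(D n has_vector_derivative D (Suc n) u) (at u within {s..t})" if "u \<in> {s..t}" for n u
      using D(2)[of u n] sub that by (blast intro: has_vector_derivative_within_subset)
    thus ?thesis
      unfolding smooth_curve_in_def using D(1) X sub assms(3) by blast
  qed
  show "vector_derivative \<gamma> (at u within {s..t}) = vector_derivative \<gamma> (at u within {a..b})" if u: "u \<in> {s..t}" for u
  proof (rule vector_derivative_within_closed_interval[OF assms(3) u])
    have "(\<gamma> has_vector_derivative vector_derivative \<gamma> (at u within {a..b})) (at u within {a..b})"
      using smooth_c1_curve[OF assms(1)] u sub unfolding c1_curve_def by blast
    thus "(\<gamma> has_vector_derivative vector_derivative \<gamma> (at u within {a..b})) (at u within {s..t})"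
      using sub by (rule has_vector_derivative_within_subset)
  qed
qed

section \<open>Polynomial curves as a supply of smooth curves\<close>

lemma polynomial_smooth:
  fixes p :: "real \<Rightarrow> complex"
  assumes "polynomial_function p"
  shows "\<exists>D. D 0 = p \<and> (\<forall>n t. (D n has_vector_derivative D (Suc n) t) (at t))"
proof -
  have "\<exists>D. \<forall>n. (polynomial_function (D n) \<and> (n = 0 \<longrightarrow> D n = p)) \<and> (\<forall>t. (D n has_vector_derivative D (Suc n) t) (at t))"
  proof (rule dependent_nat_choice)
    show "\<exists>f. polynomial_function f \<and> (0 = 0 \<longrightarrow> f = p)"
      using assms by blast
    show "\<exists>g. (polynomial_function g \<and> (Suc n = 0 \<longrightarrow> g = p)) \<and> (\<forall>t. (f has_vector_derivative g t) (at t))"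
      if f: "polynomial_function f \<and> (n = 0 \<longrightarrow> f = p)" for f :: "real \<Rightarrow> complex" and n :: nat
    proof -
      obtain g where "polynomial_function g" "\<And>x. (f has_vector_derivative g x) (at x)"
        using has_vector_derivative_polynomial_function f by blast
      thus ?thesis by auto
    qed
  qed
  thus ?thesis by blast
qed

lemma polynomial_smooth_curve:
  fixes p :: "real \<Rightarrow> complex"
  assumes "polynomial_function p" "a < b" "p ` {a..b} \<subseteq> X"
  shows "smooth_curve_in X a b p"
proof -
  obtain D where "D 0 = p" "\<And>n t. (D n has_vector_derivative D (Suc n) t) (at t)"
    using polynomial_smooth[OF assms(1)] by blast
  thus ?thesis
    unfolding smooth_curve_in_def using assms(2,3)
    by (intro conjI exI[of _ D]) (auto intro: has_vector_derivative_at_within)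
qed

text \<open>The closing step of the approximation arguments. The factor c may be 0, hence the
  division by c + 1 in the proof.\<close>

lemma ereal_le_if_real_le:
  fixes l :: ereal
  assumes "\<And>e. 0 < e \<Longrightarrow> ereal (x - e * c) \<le> l" "0 \<le> c"
  shows "ereal x \<le> l"
proof (cases l)
  case (real r)
  have le: "x \<le> r + e" if e: "0 < e" for e
  proof -
    have "x - e / (c + 1) * c \<le> r"
      using assms(1)[of "e / (c + 1)"] real e assms(2) by simp
    moreover have "e / (c + 1) * c \<le> e"
      using e assms(2) by (simp add: field_simps)
    ultimately show ?thesis by simp
  qed
  thus ?thesis
    using real field_le_epsilon[of x r, OF le] by simp
next
  case MInf
  thus ?thesis using assms(1)[of 1] by simp
qed simp

text \<open>The increment is the integral of \<open>g'\<close>, which stays within e of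
  \<open>g' x\<close> near x. The end points straddle x, as the intervals produced by bisection
  do.\<close>

lemma c1_curve_strict_difference:
  assumes g: "c1_curve X a b g g'" and x: "x \<in> {a..b}" and e: "0 < e"
  obtains d where "0 < d" "\<And>s t. a \<le> s \<Longrightarrow> s \<le> x \<Longrightarrow> x \<le> t \<Longrightarrow> t \<le> b \<Longrightarrow> t - s < d \<Longrightarrow>
    cmod (g t - g s - (t - s) *\<^sub>R g' x) \<le> e * (t - s)"
proof -
  have cg': "continuous_on {a..b} g'" and dg: "\<And>t. t \<in> {a..b} \<Longrightarrow> (g has_vector_derivative g' t) (at t within {a..b})"
    using g unfolding c1_curve_def by blast+
  obtain d where d: "0 < d" "\<And>t. t \<in> {a..b} \<Longrightarrow> dist t x < d \<Longrightarrow> dist (g' t) (g' x) < e"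
    using cg' x e unfolding continuous_on_iff by metis
  show ?thesis
  proof (rule that[OF d(1)])
    fix s t assume st: "a \<le> s" "s \<le> x" "x \<le> t" "t \<le> b" "t - s < d"
    have sub: "{s..t} \<subseteq> {a..b}" using st by auto
    have gi: "(g' has_integral g t - g s) {s..t}"
      using st by (intro fundamental_theorem_of_calculus has_vector_derivative_within_subset[OF dg]) auto
    have ci: "((\<lambda>u. g' x) has_integral (t - s) *\<^sub>R g' x) {s..t}"
      using has_integral_const_real[of "g' x" s t] st by simp
    have "((\<lambda>u. g' u - g' x) has_integral g t - g s - (t - s) *\<^sub>R g' x) {s..t}"
      by (rule has_integral_diff[OF gi ci])
    moreover have "cmod (integral {s..t} (\<lambda>u. g' u - g' x)) \<le> e * (t - s)"
    proof (rule integral_bound)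
      show "continuous_on {s..t} (\<lambda>u. g' u - g' x)"
        by (intro continuous_intros continuous_on_subset[OF cg' sub])
      show "norm (g' u - g' x) \<le> e" if "u \<in> {s..t}" for u
        using d(2)[of u] that st sub by (auto simp: dist_norm intro: less_imp_le)
    qed (use st in simp)
    ultimately show "cmod (g t - g s - (t - s) *\<^sub>R g' x) \<le> e * (t - s)"
      by (simp add: integral_unique)
  qed
qed

lemma integral_near_const:
  fixes f :: "real \<Rightarrow> real"
  assumes f: "continuous_on {a..b} f" and x: "x \<in> {a..b}" and e: "0 < e"
  obtains d where "0 < d" "\<And>s t. a \<le> s \<Longrightarrow> s \<le> x \<Longrightarrow> x \<le> t \<Longrightarrow> t \<le> b \<Longrightarrow> t - s < d \<Longrightarrow>
    \<bar>integral {s..t} f - (t - s) * f x\<bar> \<le> e * (t - s)"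
proof -
  obtain d where d: "0 < d" "\<And>t. t \<in> {a..b} \<Longrightarrow> dist t x < d \<Longrightarrow> dist (f t) (f x) < e"
    using f x e unfolding continuous_on_iff by metis
  show ?thesis
  proof (rule that[OF d(1)])
    fix s t assume st: "a \<le> s" "s \<le> x" "x \<le> t" "t \<le> b" "t - s < d"
    have sub: "{s..t} \<subseteq> {a..b}" using st by auto
    have "norm (integral {s..t} (\<lambda>u. f u - f x)) \<le> e * (t - s)"
    proof (rule integral_bound)
      show "continuous_on {s..t} (\<lambda>u. f u - f x)"
        by (intro continuous_intros continuous_on_subset[OF f sub])
      show "norm (f u - f x) \<le> e" if "u \<in> {s..t}" for u
        using d(2)[of u] that st sub by (auto simp: dist_norm intro: less_imp_le)
    qed (use st in simp)
    moreover have "integral {s..t} (\<lambda>u. f u - f x) = integral {s..t} f - (t - s) * f x"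
      using st by (subst Henstock_Kurzweil_Integration.integral_diff)
        (auto intro!: integrable_continuous_real continuous_on_subset[OF f sub])
    ultimately show "\<bar>integral {s..t} f - (t - s) * f x\<bar> \<le> e * (t - s)"
      by simp
  qed
qed

lemma inner_distance_mono:
  assumes "\<And>p q. p \<in> X \<Longrightarrow> q \<in> X \<Longrightarrow> d p q \<le> d' p q"
  shows "inner_distance X d x y \<le> inner_distance X d' x y"
  unfolding inner_distance_def
proof (rule Inf_mono)
  fix l assume "l \<in> {curve_length d' a b \<gamma> |a b \<gamma>. curve_in X a b \<gamma> \<and> \<gamma> a = x \<and> \<gamma> b = y}"
  then obtain a b \<gamma> where l: "l = curve_length d' a b \<gamma>" and \<gamma>: "curve_in X a b \<gamma>" "\<gamma> a = x" "\<gamma> b = y"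
    by blast
  have "curve_length d a b \<gamma> \<le> l"
    unfolding l using \<gamma>(1) by (intro curve_length_mono assms) (auto simp: curve_in_def)
  thus "\<exists>l'\<in>{curve_length d a b \<gamma> |a b \<gamma>. curve_in X a b \<gamma> \<and> \<gamma> a = x \<and> \<gamma> b = y}. l' \<le> l"
    using \<gamma> by blast
qed

lemma smooth_curve_in_curve_in:
  assumes "smooth_curve_in X a b \<gamma>"
  shows "curve_in X a b \<gamma>"
  using assms c1_curve_continuous[OF smooth_c1_curve[OF assms]]
  unfolding curve_in_def smooth_curve_in_def by blast

section \<open>Conformal metrics on plane domains\<close>

lemma c1_curve_reparametrize:
  assumes g: "c1_curve X a b g g'" and uv: "u \<le> v"
    and \<phi>: "\<And>t. t \<in> {u..v} \<Longrightarrow> (\<phi> has_real_derivative \<phi>' t) (at t within {u..v})"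
    and \<phi>': "continuous_on {u..v} \<phi>'" and im: "\<phi> ` {u..v} \<subseteq> {a..b}"
  shows "c1_curve X u v (g \<circ> \<phi>) (\<lambda>t. \<phi>' t *\<^sub>R g' (\<phi> t))"
  unfolding c1_curve_def
proof (intro conjI ballI)
  show "(g \<circ> \<phi>) ` {u..v} \<subseteq> X"
    using g im unfolding c1_curve_def by fastforce
  have c\<phi>: "continuous_on {u..v} \<phi>"
    using \<phi> by (rule DERIV_continuous_on)
  have "continuous_on {a..b} g'"
    using g unfolding c1_curve_def by blast
  thus "continuous_on {u..v} (\<lambda>t. \<phi>' t *\<^sub>R g' (\<phi> t))"
    by (intro continuous_intros \<phi>' continuous_on_compose2[OF _ c\<phi> im])
  show "(g \<circ> \<phi> has_vector_derivative \<phi>' t *\<^sub>R g' (\<phi> t)) (at t within {u..v})" if t: "t \<in> {u..v}" for t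
  proof (rule vector_diff_chain_within)
    show "(\<phi> has_vector_derivative \<phi>' t) (at t within {u..v})"
      using \<phi>[OF t] by (simp add: has_real_derivative_iff_has_vector_derivative)
    have "\<phi> t \<in> {a..b}" using im t by blast
    hence "(g has_vector_derivative g' (\<phi> t)) (at (\<phi> t) within {a..b})"
      using g unfolding c1_curve_def by blast
    thus "(g has_vector_derivative g' (\<phi> t)) (at (\<phi> t) within \<phi> ` {u..v})"
      using im by (rule has_vector_derivative_within_subset)
  qed
qed

lemma c1_curve_glue:
  assumes A: "c1_curve X u v A A'" and B: "c1_curve X v w B B'" and uvw: "u \<le> v" "v \<le> w"
    and eq: "A v = B v" "A' v = B' v"
  shows "c1_curve X u w (\<lambda>t. if t \<in> {u..v} then A t else B t) (\<lambda>t. if t \<in> {u..v} then A' t else B' t)"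
  unfolding c1_curve_def
proof (intro conjI ballI)
  have un: "{u..w} = {u..v} \<union> {v..w}"
    using uvw by auto
  have int: "{u..v} \<inter> {v..w} = {v}"
    using uvw by auto
  show "(\<lambda>t. if t \<in> {u..v} then A t else B t) ` {u..w} \<subseteq> X"
    using A B unfolding un c1_curve_def by auto
  show "continuous_on {u..w} (\<lambda>t. if t \<in> {u..v} then A' t else B' t)"
    unfolding un using A B eq uvw by (intro continuous_on_If) (auto simp: c1_curve_def)
  show "((\<lambda>t. if t \<in> {u..v} then A t else B t) has_vector_derivative (if t \<in> {u..v} then A' t else B' t))
      (at t within {u..w})" if t: "t \<in> {u..w}" for t
  proof (rule has_vector_derivative_If_within_closures)
    show "t \<in> {u..v} \<union> {v..w}" "{u..w} = {u..v} \<union> {v..w}"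
      using t un by auto
    have s1: "{u..v} \<union> (closure {u..v} \<inter> closure {v..w}) = {u..v}"
      and s2: "{v..w} \<union> (closure {u..v} \<inter> closure {v..w}) = {v..w}"
      unfolding closure_closed[OF closed_atLeastAtMost] by blast+
    show "(A has_vector_derivative A' t) (at t within {u..v} \<union> (closure {u..v} \<inter> closure {v..w}))"
      if "t \<in> {u..v} \<union> (closure {u..v} \<inter> closure {v..w})"
      using A that unfolding s1 c1_curve_def by blast
    show "(B has_vector_derivative B' t) (at t within {v..w} \<union> (closure {u..v} \<inter> closure {v..w}))"
      if "t \<in> {v..w} \<union> (closure {u..v} \<inter> closure {v..w})"
      using B that unfolding s2 c1_curve_def by blast
    show "A t = B t" "A' t = B' t" if "t \<in> closure {u..v}" "t \<in> closure {v..w}"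
      using that eq int unfolding closure_closed[OF closed_atLeastAtMost] by auto
  qed
qed

text \<open>Serves both the pulled back Fubini-Study metric and the metric of the logarithm of the
  kernel. \<open>F\<close> is kept apart from \<open>P\<close> because these two are given by
  formulas that reduce to \<open>P z * cmod v\<close> on X only. As \<open>P\<close> may vanish,
  nothing here makes the distance of distinct points positive.\<close>

locale conformal_metric =
  fixes X :: "complex set" and P :: "complex \<Rightarrow> real" and F :: "complex \<Rightarrow> complex \<Rightarrow> real"
  assumes open_domain: "open X" and connected_domain: "connected X"
    and density_continuous: "continuous_on X P"
    and density_nonneg: "\<And>z. z \<in> X \<Longrightarrow> 0 \<le> P z"
    and metric_eq: "\<And>z v. z \<in> X \<Longrightarrow> F z v = P z * cmod v"
begin

definition plen :: "real \<Rightarrow> real \<Rightarrow> (real \<Rightarrow> complex) \<Rightarrow> (real \<Rightarrow> complex) \<Rightarrow> real"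
  where "plen a b g g' = integral {a..b} (\<lambda>t. P (g t) * cmod (g' t))"

abbreviation rlen :: "real \<Rightarrow> real \<Rightarrow> (real \<Rightarrow> complex) \<Rightarrow> real"
  where "rlen \<equiv> riemannian_length F"

abbreviation rdist :: "complex \<Rightarrow> complex \<Rightarrow> real"
  where "rdist \<equiv> riemannian_distance X F"

lemma integrand_continuous:
  assumes "c1_curve X a b g g'"
  shows "continuous_on {a..b} (\<lambda>t. P (g t) * cmod (g' t))"
  using assms unfolding c1_curve_def
  by (intro continuous_intros continuous_on_compose2[OF density_continuous c1_curve_continuous[OF assms]]) auto

lemma plen_nonneg: "c1_curve X a b g g' \<Longrightarrow> 0 \<le> plen a b g g'"
  unfolding plen_def c1_curve_def
  by (intro Henstock_Kurzweil_Integration.integral_nonneg integrable_continuous_real integrand_continuous)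
    (auto simp: c1_curve_def intro!: mult_nonneg_nonneg density_nonneg)

lemma rlen_eq:
  assumes "smooth_curve_in X a b \<gamma>"
  shows "rlen a b \<gamma> = plen a b \<gamma> (\<lambda>t. vector_derivative \<gamma> (at t within {a..b}))"
proof -
  have "\<gamma> t \<in> X" if "t \<in> {a..b}" for t
    using assms that unfolding smooth_curve_in_def by blast
  thus ?thesis
    unfolding riemannian_length_def plen_def by (intro Henstock_Kurzweil_Integration.integral_cong metric_eq)
qed

lemma rlen_nonneg: "smooth_curve_in X a b \<gamma> \<Longrightarrow> 0 \<le> rlen a b \<gamma>"
  using rlen_eq plen_nonneg smooth_c1_curve by metis

lemma rdist_bdd_below:
  "bdd_below {rlen a b \<gamma> |a b \<gamma>. smooth_curve_in X a b \<gamma> \<and> \<gamma> a = x \<and> \<gamma> b = y}"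
  by (rule bdd_belowI[of _ 0]) (auto intro: rlen_nonneg)

lemma rdist_le:
  assumes "smooth_curve_in X a b \<gamma>"
  shows "rdist (\<gamma> a) (\<gamma> b) \<le> rlen a b \<gamma>"
  unfolding riemannian_distance_def by (rule cInf_lower[OF _ rdist_bdd_below]) (use assms in blast)

text \<open>Makes the set under the real-valued \<open>Inf\<close> in
  \<open>riemannian_distance\<close> nonempty, so that the infimum is meaningful.\<close>

lemma smooth_curve_exists:
  assumes "x \<in> X" "y \<in> X"
  shows "\<exists>a b \<gamma>. smooth_curve_in X a b \<gamma> \<and> \<gamma> a = x \<and> \<gamma> b = y"
proof -
  obtain g where g: "polynomial_function g" "path_image g \<subseteq> X" "pathstart g = x" "pathfinish g = y"
    using connected_open_polynomial_connected[OF open_domain connected_domain assms] by blast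
  hence "smooth_curve_in X 0 1 g"
    by (intro polynomial_smooth_curve) (auto simp: path_image_def)
  thus ?thesis
    using g by (auto simp: pathstart_def pathfinish_def)
qed

lemma rdist_nonneg:
  assumes "x \<in> X" "y \<in> X"
  shows "0 \<le> rdist x y"
  unfolding riemannian_distance_def
  by (rule cInf_greatest) (use smooth_curve_exists[OF assms] rlen_nonneg in blast)+

lemma rdist_lessE:
  assumes "x \<in> X" "y \<in> X" "rdist x y < c"
  obtains a b \<gamma> where "smooth_curve_in X a b \<gamma>" "\<gamma> a = x" "\<gamma> b = y" "rlen a b \<gamma> < c"
proof -
  have "{rlen a b \<gamma> |a b \<gamma>. smooth_curve_in X a b \<gamma> \<and> \<gamma> a = x \<and> \<gamma> b = y} \<noteq> {}"
    using smooth_curve_exists[OF assms(1,2)] by blast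
  from cInf_lessD[OF this assms(3)[unfolded riemannian_distance_def]] show ?thesis
    using that by blast
qed

lemma plen_reparametrize:
  assumes g: "c1_curve X a b g g'" and uv: "u \<le> v"
    and \<phi>: "\<And>t. t \<in> {u..v} \<Longrightarrow> (\<phi> has_real_derivative \<phi>' t) (at t within {u..v})"
    and pos: "\<And>t. t \<in> {u..v} \<Longrightarrow> 0 \<le> \<phi>' t" and im: "\<phi> ` {u..v} \<subseteq> {a..b}"
    and ends: "\<phi> u = a" "\<phi> v = b" and ab: "a \<le> b"
  shows "plen u v (g \<circ> \<phi>) (\<lambda>t. \<phi>' t *\<^sub>R g' (\<phi> t)) = plen a b g g'"
proof -
  have "((\<lambda>t. \<phi>' t *\<^sub>R (P (g (\<phi> t)) * cmod (g' (\<phi> t)))) has_integral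
      integral {\<phi> u..\<phi> v} (\<lambda>t. P (g t) * cmod (g' t))) {u..v}"
    by (rule has_integral_substitution[OF uv _ im integrand_continuous[OF g] \<phi>]) (use ends ab in auto)
  hence "integral {u..v} (\<lambda>t. \<phi>' t *\<^sub>R (P (g (\<phi> t)) * cmod (g' (\<phi> t)))) = plen a b g g'"
    unfolding plen_def ends by (rule integral_unique)
  moreover have "plen u v (g \<circ> \<phi>) (\<lambda>t. \<phi>' t *\<^sub>R g' (\<phi> t)) =
      integral {u..v} (\<lambda>t. \<phi>' t *\<^sub>R (P (g (\<phi> t)) * cmod (g' (\<phi> t))))"
    unfolding plen_def by (rule Henstock_Kurzweil_Integration.integral_cong) (simp add: pos)
  ultimately show ?thesis by simp
qed

lemma plen_glue:
  assumes A: "c1_curve X u v A A'" and B: "c1_curve X v w B B'" and uvw: "u \<le> v" "v \<le> w"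
    and eq: "A v = B v" "A' v = B' v"
  shows "plen u w (\<lambda>t. if t \<in> {u..v} then A t else B t) (\<lambda>t. if t \<in> {u..v} then A' t else B' t) =
    plen u v A A' + plen v w B B'"
proof -
  let ?G = "\<lambda>t. if t \<in> {u..v} then A t else B t" and ?G' = "\<lambda>t. if t \<in> {u..v} then A' t else B' t"
  have "plen u w ?G ?G' = integral {u..v} (\<lambda>t. P (?G t) * cmod (?G' t)) + integral {v..w} (\<lambda>t. P (?G t) * cmod (?G' t))"
    unfolding plen_def
    by (rule Henstock_Kurzweil_Integration.integral_combine[symmetric, OF uvw])
      (intro integrable_continuous_real integrand_continuous c1_curve_glue assms)
  moreover have "integral {u..v} (\<lambda>t. P (?G t) * cmod (?G' t)) = plen u v A A'"
    unfolding plen_def by (rule Henstock_Kurzweil_Integration.integral_cong) simp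
  moreover have "integral {v..w} (\<lambda>t. P (?G t) * cmod (?G' t)) = plen v w B B'"
    unfolding plen_def
  proof (rule Henstock_Kurzweil_Integration.integral_cong)
    fix t assume "t \<in> {v..w}"
    thus "P (?G t) * cmod (?G' t) = P (B t) * cmod (B' t)"
      using eq by (cases "t = v") auto
  qed
  ultimately show ?thesis by simp
qed

text \<open>Weierstrass approximation is applied to the derivative; adding a constant to the approximating
  polynomial restores the end point.\<close>

lemma c1_curve_smoothing:
  assumes g: "c1_curve X a b g g'" and ab: "a < b" and e: "0 < e"
  shows "\<exists>\<gamma>. smooth_curve_in X a b \<gamma> \<and> \<gamma> a = g a \<and> \<gamma> b = g b \<and> rlen a b \<gamma> \<le> plen a b g g' + e"
proof -
  let ?K = "g ` {a..b}"
  define L where "L = b - a"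
  have L: "0 < L" using ab by (simp add: L_def)
  have cg: "continuous_on {a..b} g" and cg': "continuous_on {a..b} g'" and KX: "?K \<subseteq> X"
    and dg: "\<And>t. t \<in> {a..b} \<Longrightarrow> (g has_vector_derivative g' t) (at t within {a..b})"
    using g c1_curve_continuous unfolding c1_curve_def by blast+
  have K: "compact ?K" using cg by (intro compact_continuous_image) auto
  obtain \<eta>0 where \<eta>0: "\<eta>0 > 0" "(\<Union>x\<in>?K. cball x \<eta>0) \<subseteq> X"
    using compact_subset_open_imp_cball_epsilon_subset[OF K open_domain KX] by blast
  \<comment> \<open>A compact neighbourhood of the trace of g; it lies in X, so \<open>P\<close> is
    bounded and uniformly continuous on it.\<close>
  let ?K' = "(\<lambda>(x, y). x + y) ` (?K \<times> cball 0 \<eta>0)"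
  have K': "compact ?K'"
    by (intro compact_continuous_image compact_Times K compact_cball) (auto intro!: continuous_intros simp: case_prod_unfold)
  have near: "z \<in> ?K'" if "t \<in> {a..b}" "cmod (z - g t) \<le> \<eta>0" for t z
    using that by (intro image_eqI[of _ _ "(g t, z - g t)"]) auto
  have K'X: "?K' \<subseteq> X"
    using \<eta>0(2) by (fastforce simp: dist_norm)
  have cP: "continuous_on ?K' P" by (rule continuous_on_subset[OF density_continuous K'X])
  obtain G where G: "\<And>t. t \<in> {a..b} \<Longrightarrow> cmod (g' t) \<le> G"
    using continuous_on_compact_bound[OF compact_Icc cg'] by blast
  have G0: "0 \<le> G" using G[of a] ab by (smt (verit) atLeastAtMost_iff norm_ge_zero)
  obtain M where M: "\<And>z. z \<in> ?K' \<Longrightarrow> P z \<le> M"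
    using continuous_on_compact_bound[OF K' cP] by (metis real_norm_def abs_le_D1)
  have gK': "g t \<in> ?K'" if "t \<in> {a..b}" for t using near[OF that, of "g t"] \<eta>0(1) by simp
  have M0: "0 \<le> M" using M[OF gK'[of a]] density_nonneg[of "g a"] KX ab by fastforce
  \<comment> \<open>The integrand of the new curve exceeds the old one by at most
    \<open>P (g t) * \<eta> + e' * (cmod (g' t) + \<eta>)\<close>; the choices of e' and \<eta> make
    each summand at most e / (2 L).\<close>
  define e' where "e' = e / (2 * L * (G + 1))"
  have e': "0 < e'" using e L G0 by (simp add: e'_def)
  obtain d where d: "d > 0" "\<And>x y. x \<in> ?K' \<Longrightarrow> y \<in> ?K' \<Longrightarrow> dist y x < d \<Longrightarrow> dist (P y) (P x) < e'"
    using compact_uniformly_continuous[OF cP K'] e' unfolding uniformly_continuous_on_def by metis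
  \<comment> \<open>The first two entries control the error of the integrand. The last two act
    through \<eta> L, which bounds the deviation of the curves: it is at most \<eta>0, which keeps
    the new curve in the neighbourhood, and less than d, which makes \<open>P\<close> change by less
    than e'.\<close>
  define \<eta> where "\<eta> = min (min 1 (e / (2 * L * (M + 1)))) (min (\<eta>0 / L) (d / (2 * L)))"
  have \<eta>: "0 < \<eta>" "\<eta> \<le> 1" "\<eta> \<le> e / (2 * L * (M + 1))" "\<eta> \<le> \<eta>0 / L" "\<eta> \<le> d / (2 * L)"
  proof -
    show "0 < \<eta>"
      using e L M0 d(1) \<eta>0(1) by (simp add: \<eta>_def)
    show "\<eta> \<le> 1" "\<eta> \<le> e / (2 * L * (M + 1))"
      unfolding \<eta>_def by (rule min.coboundedI1, simp)+
    show "\<eta> \<le> \<eta>0 / L" "\<eta> \<le> d / (2 * L)"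
      unfolding \<eta>_def by (rule min.coboundedI2, simp)+
  qed
  have \<eta>L: "\<eta> * L \<le> \<eta>0" "\<eta> * L < d"
    using \<eta>(4,5) L d(1) by (auto simp: field_simps)
  obtain p0 where p0: "polynomial_function p0" "\<And>t. t \<in> {a..b} \<Longrightarrow> cmod (g' t - p0 t) < \<eta> / 2"
    using Stone_Weierstrass_polynomial_function[OF compact_Icc cg' half_gt_zero[OF \<eta>(1)]] by blast
  have cp0: "continuous_on {a..b} p0"
    using p0(1) by (simp add: continuous_on_polymonial_function)
  define c where "c = (1 / L) *\<^sub>R integral {a..b} (\<lambda>t. g' t - p0 t)"
  define p where "p = (\<lambda>t. p0 t + c)"
  have pp: "polynomial_function p"
    using polynomial_function_add[OF p0(1) polynomial_function_const[of c]] unfolding p_def .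
  have cp: "continuous_on {a..b} p"
    using cp0 by (simp add: p_def continuous_intros)
  have "cmod (integral {a..b} (\<lambda>t. g' t - p0 t)) \<le> \<eta> / 2 * (b - a)"
    using ab p0(2) by (intro integral_bound continuous_intros cg' cp0) (auto intro: less_imp_le)
  hence c: "cmod c \<le> \<eta> / 2"
    using L by (simp add: c_def L_def field_simps)
  have pg: "cmod (p t - g' t) \<le> \<eta>" if "t \<in> {a..b}" for t
  proof -
    have eq: "p t - g' t = c - (g' t - p0 t)" by (simp add: p_def)
    show ?thesis
      unfolding eq using norm_triangle_ineq4[of c "g' t - p0 t"] c p0(2)[OF that] by simp
  qed
  have ftc: "(g' has_integral g t - g a) {a..t}" if "t \<in> {a..b}" for t
    using that by (intro fundamental_theorem_of_calculus has_vector_derivative_within_subset[OF dg]) auto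
  have ip: "p integrable_on {a..t}" "g' integrable_on {a..t}" "p0 integrable_on {a..t}" if "t \<in> {a..b}" for t
    using that by (auto intro!: integrable_continuous_real continuous_on_subset[OF cp] continuous_on_subset[OF cg'] continuous_on_subset[OF cp0])
  define Q where "Q t = g a + integral {a..t} p" for t
  have Qa: "Q a = g a" by (simp add: Q_def)
  have Qg: "Q t - g t = integral {a..t} (\<lambda>s. p s - g' s)" if "t \<in> {a..b}" for t
    using integral_unique[OF ftc[OF that]] ip[OF that] by (simp add: Q_def Henstock_Kurzweil_Integration.integral_diff)
  have "integral {a..b} (\<lambda>s. p s - g' s) = integral {a..b} (\<lambda>s. c - (g' s - p0 s))"
    by (simp add: p_def algebra_simps)
  also have "\<dots> = L *\<^sub>R c - integral {a..b} (\<lambda>s. g' s - p0 s)"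
    using ab ip[of b] by (subst Henstock_Kurzweil_Integration.integral_diff) (auto simp: L_def intro!: integrable_diff)
  also have "\<dots> = 0"
    using L by (simp add: c_def)
  finally have Qb: "Q b = g b"
    using Qg[of b] ab by simp
  have Qn: "cmod (Q t - g t) \<le> \<eta> * L" if t: "t \<in> {a..b}" for t
  proof -
    have "cmod (Q t - g t) \<le> \<eta> * (t - a)"
      unfolding Qg[OF t] using t pg
      by (intro integral_bound continuous_on_subset[OF continuous_on_diff[OF cp cg']]) auto
    also have "\<dots> \<le> \<eta> * L"
      using t \<eta>(1) by (intro mult_left_mono) (auto simp: L_def)
    finally show ?thesis .
  qed
  have QK': "Q t \<in> ?K'" if "t \<in> {a..b}" for t
    using near[OF that] Qn[OF that] \<eta>L by simp
  have dQ: "(Q has_vector_derivative p t) (at t within {a..b})" if "t \<in> {a..b}" for t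
    using integral_has_vector_derivative[OF cp that] unfolding Q_def
    by (auto intro!: derivative_eq_intros)
  have smooth: "smooth_curve_in X a b Q"
    unfolding smooth_curve_in_def
  proof (intro conjI ab)
    show "Q ` {a..b} \<subseteq> X" using QK' K'X by blast
    obtain D where D: "D 0 = p" "\<And>n t. (D n has_vector_derivative D (Suc n) t) (at t)"
      using polynomial_smooth[OF pp] by blast
    show "\<exists>D. D 0 = Q \<and> (\<forall>n. \<forall>t\<in>{a..b}. (D n has_vector_derivative D (Suc n) t) (at t within {a..b}))"
    proof (intro exI conjI allI ballI)
      show "case_nat Q D 0 = Q" by simp
      show "(case_nat Q D n has_vector_derivative case_nat Q D (Suc n) t) (at t within {a..b})"
        if "t \<in> {a..b}" for n t
        using dQ[OF that] D by (cases n) (auto intro: has_vector_derivative_at_within)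
    qed
  qed
  have c1Q: "c1_curve X a b Q p"
    unfolding c1_curve_def using QK' K'X dQ cp by blast
  have "rlen a b Q = plen a b Q p"
    unfolding rlen_eq[OF smooth] plen_def
    using vector_derivative_within_closed_interval[OF ab _ dQ] by (intro Henstock_Kurzweil_Integration.integral_cong) simp
  also have "\<dots> \<le> integral {a..b} (\<lambda>t. P (g t) * cmod (g' t) + e / L)"
    unfolding plen_def
  proof (rule Henstock_Kurzweil_Integration.integral_le)
    show "(\<lambda>t. P (Q t) * cmod (p t)) integrable_on {a..b}"
      by (intro integrable_continuous_real integrand_continuous c1Q)
    show "(\<lambda>t. P (g t) * cmod (g' t) + e / L) integrable_on {a..b}"
      by (intro integrable_continuous_real continuous_intros integrand_continuous g)
    fix t assume t: "t \<in> {a..b}"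
    have "dist (P (Q t)) (P (g t)) < e'"
      using Qn[OF t] \<eta>L(2) by (intro d(2) gK' QK' t) (simp add: dist_norm)
    hence PQ: "P (Q t) \<le> P (g t) + e'" by (simp add: dist_real_def)
    have pt: "cmod (p t) \<le> cmod (g' t) + \<eta>"
      using pg[OF t] norm_triangle_sub[of "p t" "g' t"] by simp
    have Pg: "0 \<le> P (g t)" "P (g t) \<le> M"
      using density_nonneg[OF subsetD[OF KX imageI[OF t]]] M[OF gK'[OF t]] by auto
    have cancel: "m * (e / (2 * L * m)) = e / (2 * L)" if "m \<noteq> 0" for m
      using that by simp
    have "P (Q t) * cmod (p t) \<le> (P (g t) + e') * (cmod (g' t) + \<eta>)"
      using PQ pt Pg e' by (intro mult_mono) auto
    also have "\<dots> = P (g t) * cmod (g' t) + (P (g t) * \<eta> + e' * (cmod (g' t) + \<eta>))"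
      by (simp add: algebra_simps)
    also have "P (g t) * \<eta> \<le> (M + 1) * (e / (2 * L * (M + 1)))"
      using Pg \<eta> M0 e L by (intro mult_mono) auto
    also have "(M + 1) * (e / (2 * L * (M + 1))) = e / (2 * L)"
      using cancel[of "M + 1"] M0 by simp
    also have "e' * (cmod (g' t) + \<eta>) \<le> e' * (G + 1)"
      using G[OF t] \<eta> e' by (intro mult_left_mono) auto
    also have "e' * (G + 1) = e / (2 * L)"
      using cancel[of "G + 1"] G0 by (simp add: e'_def mult.commute)
    also have "e / (2 * L) + e / (2 * L) = e / L"
      using L by (simp add: field_simps)
    finally show "P (Q t) * cmod (p t) \<le> P (g t) * cmod (g' t) + e / L"
      by simp
  qed
  also have "\<dots> = plen a b g g' + e"
    unfolding plen_def using ab L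
    by (subst Henstock_Kurzweil_Integration.integral_add)
      (auto intro!: integrable_continuous_real integrand_continuous g simp: L_def)
  finally show ?thesis
    using smooth Qa Qb by blast
qed

lemma rdist_le_plen:
  assumes g: "c1_curve X a b g g'" and ab: "a < b"
  shows "rdist (g a) (g b) \<le> plen a b g g'"
proof (rule field_le_epsilon)
  fix e :: real assume "0 < e"
  from c1_curve_smoothing[OF g ab this] show "rdist (g a) (g b) \<le> plen a b g g' + e"
    using rdist_le by (metis order_trans)
qed

text \<open>The curves are reparametrized so that they stop at the common end point; their concatenation is then
  continuously differentiable.\<close>

lemma rdist_triangle:
  assumes "x \<in> X" "y \<in> X" "z \<in> X"
  shows "rdist x z \<le> rdist x y + rdist y z"
proof (rule field_le_epsilon)
  fix e :: real assume e: "0 < e"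
  obtain a b \<gamma> where \<gamma>: "smooth_curve_in X a b \<gamma>" "\<gamma> a = x" "\<gamma> b = y" "rlen a b \<gamma> < rdist x y + e / 2"
    using rdist_lessE[OF assms(1,2), of "rdist x y + e / 2"] e by auto
  obtain c d \<eta> where \<eta>: "smooth_curve_in X c d \<eta>" "\<eta> c = y" "\<eta> d = z" "rlen c d \<eta> < rdist y z + e / 2"
    using rdist_lessE[OF assms(2,3), of "rdist y z + e / 2"] e by auto
  have ab: "a < b" and cd: "c < d"
    using \<gamma>(1) \<eta>(1) unfolding smooth_curve_in_def by auto
  \<comment> \<open>The cubic from 0 to 1 on the unit interval whose derivative 6 t (1 - t) vanishes
    at both ends; both velocities at the joint are therefore 0.\<close>
  define s :: "real \<Rightarrow> real" where "s t = t^2 * (3 - 2 * t)" for t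
  have s: "0 \<le> s t" "s t \<le> 1" if "t \<in> {0..1}" for t
  proof -
    show "0 \<le> s t" using that by (simp add: s_def)
    have "1 - s t = (1 - t)^2 * (1 + 2 * t)"
      by (simp add: s_def algebra_simps power2_eq_square)
    also have "0 \<le> (1 - t)^2 * (1 + 2 * t)"
      using that by (intro mult_nonneg_nonneg) auto
    finally show "s t \<le> 1" by simp
  qed
  have seg: "l + (u - l) * s t \<in> {l..u}" if "t \<in> {0..1}" "l \<le> u" for l u t
    using s[OF that(1)] that(2) mult_left_mono[of "s t" 1 "u - l"] by simp
  define \<phi> where "\<phi> t = a + (b - a) * s t" for t
  define \<psi> where "\<psi> t = c + (d - c) * s (t - 1)" for t
  define \<phi>' where "\<phi>' t = (b - a) * (6 * t * (1 - t))" for t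
  define \<psi>' where "\<psi>' t = (d - c) * (6 * (t - 1) * (2 - t))" for t
  have d\<phi>: "(\<phi> has_real_derivative \<phi>' t) (at t within {0..1})" for t
    unfolding \<phi>_def \<phi>'_def s_def by (auto intro!: derivative_eq_intros simp: algebra_simps power2_eq_square)
  have d\<psi>: "(\<psi> has_real_derivative \<psi>' t) (at t within {1..2})" for t
    unfolding \<psi>_def \<psi>'_def s_def by (auto intro!: derivative_eq_intros simp: algebra_simps power2_eq_square)
  have im: "\<phi> ` {0..1} \<subseteq> {a..b}" "\<psi> ` {1..2} \<subseteq> {c..d}"
    unfolding \<phi>_def \<psi>_def using seg ab cd by auto
  have cont: "continuous_on {0..1} \<phi>'" "continuous_on {1..2} \<psi>'"
    unfolding \<phi>'_def \<psi>'_def by (intro continuous_intros)+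
  have pos: "\<And>t. t \<in> {0..1} \<Longrightarrow> 0 \<le> \<phi>' t" "\<And>t. t \<in> {1..2} \<Longrightarrow> 0 \<le> \<psi>' t"
    unfolding \<phi>'_def \<psi>'_def using ab cd by auto
  have ends: "\<phi> 0 = a" "\<phi> 1 = b" "\<psi> 1 = c" "\<psi> 2 = d"
    by (simp_all add: \<phi>_def \<psi>_def s_def)
  let ?A = "\<gamma> \<circ> \<phi>" and ?A' = "\<lambda>t. \<phi>' t *\<^sub>R vector_derivative \<gamma> (at (\<phi> t) within {a..b})"
  let ?B = "\<eta> \<circ> \<psi>" and ?B' = "\<lambda>t. \<psi>' t *\<^sub>R vector_derivative \<eta> (at (\<psi> t) within {c..d})"
  note c1 = smooth_c1_curve[OF \<gamma>(1)] smooth_c1_curve[OF \<eta>(1)]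
  have A: "c1_curve X 0 1 ?A ?A'"
    by (rule c1_curve_reparametrize[OF c1(1) _ d\<phi> cont(1) im(1)]) simp
  have B: "c1_curve X 1 2 ?B ?B'"
    by (rule c1_curve_reparametrize[OF c1(2) _ d\<psi> cont(2) im(2)]) simp
  have eq: "?A 1 = ?B 1" "?A' 1 = ?B' 1"
    using ends \<gamma>(3) \<eta>(2) by (simp_all add: \<phi>'_def \<psi>'_def)
  have plen: "plen 0 1 ?A ?A' = rlen a b \<gamma>" "plen 1 2 ?B ?B' = rlen c d \<eta>"
    unfolding rlen_eq[OF \<gamma>(1)] rlen_eq[OF \<eta>(1)]
    using plen_reparametrize[OF c1(1) _ d\<phi> pos(1) im(1) ends(1,2)]
      plen_reparametrize[OF c1(2) _ d\<psi> pos(2) im(2) ends(3,4)] ab cd by simp_all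
  have xz: "?A 0 = x" "?B 2 = z"
    by (simp_all add: ends \<gamma>(2) \<eta>(3))
  have "rdist x z \<le> plen 0 1 ?A ?A' + plen 1 2 ?B ?B'"
    using rdist_le_plen[OF c1_curve_glue[OF A B _ _ eq]] plen_glue[OF A B _ _ eq]
    by (simp add: xz del: o_apply)
  thus "rdist x z \<le> rdist x y + rdist y z + e"
    unfolding plen using \<gamma>(4) \<eta>(4) by simp
qed

section \<open>Upper bounds for the distance\<close>

lemma rdist_le_segment:
  assumes ball: "ball z r \<subseteq> X" and M: "\<And>w. w \<in> ball z r \<Longrightarrow> P w \<le> M"
    and pq: "p \<in> ball z r" "q \<in> ball z r"
  shows "rdist p q \<le> M * cmod (q - p)"
proof -
  define \<gamma> where "\<gamma> t = p + t *\<^sub>R (q - p)" for t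
  have b: "\<gamma> t \<in> ball z r" if "t \<in> {0..1}" for t
  proof -
    have "(1 - t) *\<^sub>R p + t *\<^sub>R q \<in> ball z r"
      using that pq by (intro convexD[OF convex_ball]) auto
    thus ?thesis by (simp add: \<gamma>_def algebra_simps)
  qed
  have d: "(\<gamma> has_vector_derivative q - p) (at t within {0..1})" for t
    unfolding \<gamma>_def by (auto intro!: derivative_eq_intros)
  have c1: "c1_curve X 0 1 \<gamma> (\<lambda>t. q - p)"
    unfolding c1_curve_def using b ball d by auto
  have "rdist p q \<le> plen 0 1 \<gamma> (\<lambda>t. q - p)"
    using rdist_le_plen[OF c1] by (simp add: \<gamma>_def)
  also have "\<dots> \<le> integral {0..1::real} (\<lambda>t. M * cmod (q - p))"
    unfolding plen_def
  proof (rule Henstock_Kurzweil_Integration.integral_le)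
    show "(\<lambda>t. P (\<gamma> t) * cmod (q - p)) integrable_on {0..1}"
      by (rule integrable_continuous_real[OF integrand_continuous[OF c1]])
    show "P (\<gamma> t) * cmod (q - p) \<le> M * cmod (q - p)" if "t \<in> {0..1}" for t
      using M[OF b[OF that]] by (intro mult_right_mono) auto
  qed auto
  finally show ?thesis by simp
qed

lemma rdist_self: "rdist x x = 0" if x: "x \<in> X"
proof -
  obtain r where r: "0 < r" "cball x r \<subseteq> X"
    using open_domain x open_contains_cball by blast
  obtain M where "\<And>w. w \<in> cball x r \<Longrightarrow> P w \<le> M"
    using continuous_on_compact_bound[OF compact_cball continuous_on_subset[OF density_continuous r(2)]]
    by (metis real_norm_def abs_le_D1)
  hence "rdist x x \<le> M * cmod (x - x)"
    using r by (intro rdist_le_segment[of x r]) auto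
  thus ?thesis
    using rdist_nonneg[OF x x] by simp
qed

lemma rdist_locally_lipschitz:
  assumes z: "z \<in> X"
  obtains r M where "0 < r" "ball z r \<subseteq> X" "\<And>p q. p \<in> ball z r \<Longrightarrow> q \<in> ball z r \<Longrightarrow> rdist p q \<le> M * cmod (q - p)"
proof -
  obtain r where r: "0 < r" "cball z r \<subseteq> X"
    using open_domain z open_contains_cball by blast
  obtain M where "\<And>w. w \<in> cball z r \<Longrightarrow> P w \<le> M"
    using continuous_on_compact_bound[OF compact_cball continuous_on_subset[OF density_continuous r(2)]]
    by (metis real_norm_def abs_le_D1)
  hence "rdist p q \<le> M * cmod (q - p)" if "p \<in> ball z r" "q \<in> ball z r" for p q
    using r that by (intro rdist_le_segment[of z r]) auto
  thus ?thesis
    using that r by (meson ball_subset_cball order_trans)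
qed

text \<open>Supplies the primitive of the speed as the function \<open>g\<close> of
  \<open>curve_length_le_increment\<close>.\<close>

lemma rdist_smooth_increment:
  assumes \<gamma>: "smooth_curve_in X a b \<gamma>" and st: "a \<le> s" "s < t" "t \<le> b"
  defines "f \<equiv> \<lambda>t. P (\<gamma> t) * cmod (vector_derivative \<gamma> (at t within {a..b}))"
  shows "rdist (\<gamma> s) (\<gamma> t) \<le> integral {a..t} f - integral {a..s} f"
proof -
  have fi: "f integrable_on {a..t}"
    unfolding f_def using st
    by (intro integrable_continuous_real continuous_on_subset[OF integrand_continuous[OF smooth_c1_curve[OF \<gamma>]]]) auto
  have sm: "smooth_curve_in X s t \<gamma>"
    using smooth_curve_subinterval[OF \<gamma> st] by blast
  have "rdist (\<gamma> s) (\<gamma> t) \<le> rlen s t \<gamma>"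
    by (rule rdist_le[OF sm])
  also have "\<dots> = integral {s..t} f"
    unfolding rlen_eq[OF sm] plen_def f_def
    by (intro Henstock_Kurzweil_Integration.integral_cong) (simp add: smooth_curve_subinterval(2)[OF \<gamma> st])
  also have "\<dots> = integral {a..t} f - integral {a..s} f"
    using Henstock_Kurzweil_Integration.integral_combine[OF st(1) less_imp_le[OF st(2)] fi] by simp
  finally show ?thesis .
qed

lemma curve_length_rdist_le:
  assumes \<gamma>: "smooth_curve_in X a b \<gamma>"
  shows "curve_length rdist a b \<gamma> \<le> ereal (rlen a b \<gamma>)"
proof -
  let ?f = "\<lambda>t. P (\<gamma> t) * cmod (vector_derivative \<gamma> (at t within {a..b}))"
  have "curve_length rdist a b \<gamma> \<le> ereal (integral {a..b} ?f - integral {a..a} ?f)"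
    by (rule curve_length_le_increment) (rule rdist_smooth_increment[OF \<gamma>])
  thus ?thesis
    unfolding rlen_eq[OF \<gamma>] plen_def by simp
qed

end

section \<open>Gram determinants and uniform boundedness\<close>

text \<open>The square root of the Gram determinant, that is the area spanned by u and w. For fixed
  u it is a seminorm in w that ignores the component along u; divided by the square of the norm of u
  it is \<open>fubini_study\<close>.\<close>

definition gram ::
  "(('a \<Rightarrow> complex) \<Rightarrow> ('a \<Rightarrow> complex) \<Rightarrow> complex) \<Rightarrow> ('a \<Rightarrow> complex) \<Rightarrow> ('a \<Rightarrow> complex) \<Rightarrow> real"
  where "gram ip u w = sqrt ((hnorm ip u)\<^sup>2 * (hnorm ip w)\<^sup>2 - (cmod (ip w u))\<^sup>2)"

context reproducing_kernel_hilbert_space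
begin

abbreviation nrm :: "('a \<Rightarrow> complex) \<Rightarrow> real"
  where "nrm \<equiv> hnorm ip"

section \<open>Inner product and norm\<close>

lemma diff_mem:
  assumes "f \<in> H" "g \<in> H"
  shows "(\<lambda>z. f z - g z) \<in> H"
  using add_mem[OF assms(1) scale_mem[OF assms(2), of "-1"]] by simp

lemma ip_diff:
  assumes "f \<in> H" "g \<in> H" "h \<in> H"
  shows "ip (\<lambda>z. f z - g z) h = ip f h - ip g h"
  using ip_add[OF assms(1) scale_mem[OF assms(2), of "-1"] assms(3)] ip_scale[OF assms(2,3), of "-1"]
  by simp

lemma ip_add_right:
  assumes "f \<in> H" "g \<in> H" "h \<in> H"
  shows "ip h (\<lambda>z. f z + g z) = ip h f + ip h g"
  using ip_cnj[OF add_mem[OF assms(1,2)] assms(3)] ip_add[OF assms] ip_cnj[of f h] ip_cnj[of g h] assms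
  by simp

lemma ip_diff_right:
  assumes "f \<in> H" "g \<in> H" "h \<in> H"
  shows "ip h (\<lambda>z. f z - g z) = ip h f - ip h g"
  using ip_cnj[OF diff_mem[OF assms(1,2)] assms(3)] ip_diff[OF assms] ip_cnj[of f h] ip_cnj[of g h] assms
  by simp

lemma ip_scale_right:
  assumes "f \<in> H" "g \<in> H"
  shows "ip g (\<lambda>z. c * f z) = cnj c * ip g f"
  using ip_cnj[OF scale_mem[OF assms(1), of c] assms(2)] ip_scale[OF assms, of c] ip_cnj[OF assms]
  by simp

lemma nrm_nonneg: "f \<in> H \<Longrightarrow> 0 \<le> nrm f"
  by (simp add: hnorm_def ip_nonneg)

lemma ip_self:
  assumes "f \<in> H"
  shows "ip f f = of_real ((nrm f)\<^sup>2)"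
proof -
  have "ip f f = cnj (ip f f)"
    using ip_cnj[OF assms assms] .
  hence "Im (ip f f) = 0"
    by (simp add: complex_eq_iff)
  thus ?thesis
    using ip_nonneg[OF assms] by (simp add: hnorm_def complex_eq_iff)
qed

lemma nrm_zero: "nrm (\<lambda>z. 0) = 0"
  using ip_scale[OF zero_mem zero_mem, of 0] by (simp add: hnorm_def)

lemma nrm_eq_0:
  assumes "f \<in> H"
  shows "nrm f = 0 \<longleftrightarrow> f = (\<lambda>z. 0)"
  using ip_self[OF assms] ip_definite[OF assms] nrm_zero by auto

lemma nrm_scale:
  assumes "f \<in> H"
  shows "nrm (\<lambda>z. c * f z) = cmod c * nrm f"
proof -
  have "ip (\<lambda>z. c * f z) (\<lambda>z. c * f z) = of_real ((cmod c)\<^sup>2 * (nrm f)\<^sup>2)"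
    using assms by (simp add: ip_scale ip_scale_right scale_mem ip_self complex_norm_square[symmetric]
        mult.assoc[symmetric] del: of_real_power)
  thus ?thesis
    using nrm_nonneg[OF assms]
    by (simp add: hnorm_def real_sqrt_mult)
qed

text \<open>The component of w orthogonal to u, multiplied by the square of the norm of u in order
  to avoid a division.\<close>

definition pcomp :: "('a \<Rightarrow> complex) \<Rightarrow> ('a \<Rightarrow> complex) \<Rightarrow> 'a \<Rightarrow> complex"
  where "pcomp u w = (\<lambda>z. of_real ((nrm u)\<^sup>2) * w z - ip w u * u z)"

lemma pcomp_mem: "u \<in> H \<Longrightarrow> w \<in> H \<Longrightarrow> pcomp u w \<in> H"
  unfolding pcomp_def by (intro diff_mem scale_mem)

lemma ip_pcomp:
  assumes "u \<in> H" "w \<in> H" "v \<in> H"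
  shows "ip (pcomp u w) v = of_real ((nrm u)\<^sup>2) * ip w v - ip w u * ip u v"
  using assms by (simp add: pcomp_def ip_diff scale_mem ip_scale)

lemma ip_pcomp_orth:
  assumes "u \<in> H" "w \<in> H"
  shows "ip (pcomp u w) u = 0"
  using assms by (simp add: ip_pcomp ip_self)

lemma ip_pcomp_pcomp:
  assumes "u \<in> H" "w \<in> H" "v \<in> H"
  shows "ip (pcomp u w) (pcomp u v) = of_real ((nrm u)\<^sup>2) * ip (pcomp u w) v"
proof -
  have "ip (pcomp u w) (pcomp u v) =
      cnj (of_real ((nrm u)\<^sup>2)) * ip (pcomp u w) v - cnj (ip v u) * ip (pcomp u w) u"
    unfolding pcomp_def[of u v] using assms
    by (simp add: ip_diff_right scale_mem pcomp_mem ip_scale_right)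
  thus ?thesis
    using ip_pcomp_orth[OF assms(1,2)] by simp
qed

lemma nrm_pcomp_sq:
  assumes "u \<in> H" "w \<in> H"
  shows "(nrm (pcomp u w))\<^sup>2 = (nrm u)\<^sup>2 * ((nrm u)\<^sup>2 * (nrm w)\<^sup>2 - (cmod (ip w u))\<^sup>2)"
proof -
  have "complex_of_real ((nrm (pcomp u w))\<^sup>2) = ip (pcomp u w) (pcomp u w)"
    using ip_self[OF pcomp_mem[OF assms]] by simp
  also have "\<dots> = of_real ((nrm u)\<^sup>2) * (of_real ((nrm u)\<^sup>2) * of_real ((nrm w)\<^sup>2) - ip w u * cnj (ip w u))"
    using assms ip_cnj[OF assms(2,1)] by (simp add: ip_pcomp_pcomp ip_pcomp ip_self)
  also have "\<dots> = of_real ((nrm u)\<^sup>2 * ((nrm u)\<^sup>2 * (nrm w)\<^sup>2 - (cmod (ip w u))\<^sup>2))"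
    by (simp only: complex_norm_square[symmetric] of_real_mult of_real_diff)
  finally show ?thesis
    using of_real_eq_iff by blast
qed

text \<open>By \<open>nrm_pcomp_sq\<close> the defect times the square of \<open>nrm u\<close> is
  itself a square.\<close>

lemma cauchy_schwarz_sq:
  assumes "u \<in> H" "w \<in> H"
  shows "(cmod (ip w u))\<^sup>2 \<le> (nrm u)\<^sup>2 * (nrm w)\<^sup>2"
proof (cases "nrm u = 0")
  case True
  hence "u = (\<lambda>z. 0 * u z)"
    using nrm_eq_0[OF assms(1)] by simp
  hence "ip w u = 0"
    using ip_scale_right[OF assms, of 0] by simp
  thus ?thesis by simp
next
  case False
  hence "0 < (nrm u)\<^sup>2" by simp
  moreover have "0 \<le> (nrm u)\<^sup>2 * ((nrm u)\<^sup>2 * (nrm w)\<^sup>2 - (cmod (ip w u))\<^sup>2)"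
    using nrm_pcomp_sq[OF assms] by (metis zero_le_power2)
  ultimately show ?thesis
    by (simp add: zero_le_mult_iff)
qed

lemma cauchy_schwarz:
  assumes "u \<in> H" "w \<in> H"
  shows "cmod (ip w u) \<le> nrm w * nrm u"
  using cauchy_schwarz_sq[OF assms] nrm_nonneg[OF assms(1)] nrm_nonneg[OF assms(2)]
  by (metis mult.commute mult_nonneg_nonneg power2_le_imp_le power_mult_distrib)

lemma nrm_add:
  assumes "f \<in> H" "g \<in> H"
  shows "nrm (\<lambda>z. f z + g z) \<le> nrm f + nrm g"
proof (rule power2_le_imp_le)
  have "complex_of_real ((nrm (\<lambda>z. f z + g z))\<^sup>2) = ip f f + ip g g + (ip f g + cnj (ip f g))"
    using assms ip_cnj[OF assms]
    by (simp add: ip_self[OF add_mem[OF assms], symmetric] ip_add ip_add_right add_mem del: of_real_power)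
  also have "\<dots> = of_real ((nrm f)\<^sup>2 + (nrm g)\<^sup>2 + 2 * Re (ip f g))"
    using assms by (simp add: ip_self complex_add_cnj)
  finally have "(nrm (\<lambda>z. f z + g z))\<^sup>2 = (nrm f)\<^sup>2 + (nrm g)\<^sup>2 + 2 * Re (ip f g)"
    using of_real_eq_iff by blast
  also have "\<dots> \<le> (nrm f)\<^sup>2 + (nrm g)\<^sup>2 + 2 * (nrm f * nrm g)"
    using cauchy_schwarz[OF assms(2,1)] complex_Re_le_cmod[of "ip f g"] by simp
  finally show "(nrm (\<lambda>z. f z + g z))\<^sup>2 \<le> (nrm f + nrm g)\<^sup>2"
    by (simp add: power2_sum)
qed (simp add: assms nrm_nonneg)

lemma nrm_minus:
  assumes "f \<in> H" "g \<in> H"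
  shows "nrm (\<lambda>z. f z - g z) = nrm (\<lambda>z. g z - f z)"
  using nrm_scale[OF diff_mem[OF assms], of "-1"] by simp

lemma nrm_diff_triangle:
  assumes "f \<in> H" "g \<in> H" "h \<in> H"
  shows "nrm (\<lambda>z. f z - h z) \<le> nrm (\<lambda>z. f z - g z) + nrm (\<lambda>z. g z - h z)"
  using nrm_add[OF diff_mem[OF assms(1,2)] diff_mem[OF assms(2,3)]] by simp

lemma nrm_abs_diff:
  assumes "f \<in> H" "g \<in> H"
  shows "\<bar>nrm f - nrm g\<bar> \<le> nrm (\<lambda>z. f z - g z)"
  using nrm_add[OF diff_mem[OF assms] assms(2)] nrm_add[OF diff_mem[OF assms(2,1)] assms(1)]
    nrm_minus[OF assms] by simp

lemma nrm_complete:
  assumes "\<And>n::nat. F n \<in> H"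
    and "\<And>e. 0 < e \<Longrightarrow> \<exists>N. \<forall>m\<ge>N. \<forall>n\<ge>N. nrm (\<lambda>z. F m z - F n z) < e"
  obtains f where "f \<in> H" "(\<lambda>n. nrm (\<lambda>z. F n z - f z)) \<longlonglongrightarrow> 0"
  using complete[of F, folded hnorm_def, OF assms] by blast

text \<open>Turns a weak bound of the form |ip f g| <= C nrm f into a norm bound on g; testing it
  with f = g is enough.\<close>

lemma nrm_le_dual:
  assumes "g \<in> H" "cmod (ip g g) \<le> C * nrm g" "0 \<le> C"
  shows "nrm g \<le> C"
proof (cases "nrm g = 0")
  case False
  hence "0 < nrm g" using nrm_nonneg[OF assms(1)] by simp
  moreover have "nrm g * nrm g \<le> C * nrm g"
    using assms(2) by (simp add: ip_self[OF assms(1)] power2_eq_square norm_mult)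
  ultimately show ?thesis by simp
qed (simp add: assms)

section \<open>The Gram determinant as a seminorm\<close>

lemma gram_nonneg: "0 \<le> gram ip u w" if "u \<in> H" "w \<in> H"
  using cauchy_schwarz_sq[OF that] by (simp add: gram_def)

lemma gram_sq:
  assumes "u \<in> H" "w \<in> H"
  shows "(gram ip u w)\<^sup>2 = (nrm u)\<^sup>2 * (nrm w)\<^sup>2 - (cmod (ip w u))\<^sup>2"
  using cauchy_schwarz_sq[OF assms] by (simp add: gram_def)

lemma gram_commute:
  assumes "u \<in> H" "w \<in> H"
  shows "gram ip u w = gram ip w u"
  using ip_cnj[OF assms] by (simp add: gram_def mult.commute)

lemma nrm_pcomp:
  assumes "u \<in> H" "w \<in> H"
  shows "nrm (pcomp u w) = nrm u * gram ip u w"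
  by (rule power2_eq_imp_eq)
    (simp_all add: nrm_pcomp_sq gram_sq power_mult_distrib nrm_nonneg gram_nonneg pcomp_mem assms)

lemma gram_le:
  assumes "u \<in> H" "w \<in> H"
  shows "gram ip u w \<le> nrm u * nrm w"
  by (rule power2_le_imp_le) (simp_all add: gram_sq power_mult_distrib nrm_nonneg assms)

lemma gram_zero_left:
  assumes "w \<in> H"
  shows "gram ip (\<lambda>z. 0) w = 0"
  using gram_le[OF zero_mem assms] gram_nonneg[OF zero_mem assms] by (simp add: nrm_zero)

text \<open>\<open>pcomp u\<close> is linear and
  \<open>nrm (pcomp u w) = nrm u * gram ip u w\<close>, so this is the triangle inequality of the
  norm with \<open>nrm u\<close> cancelled.\<close>

lemma gram_add:
  assumes "u \<in> H" "w \<in> H" "v \<in> H"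
  shows "gram ip u (\<lambda>z. w z + v z) \<le> gram ip u w + gram ip u v"
proof (cases "nrm u = 0")
  case True
  thus ?thesis
    using assms by (simp add: nrm_eq_0 gram_zero_left add_mem)
next
  case False
  hence "0 < nrm u" using nrm_nonneg[OF assms(1)] by simp
  moreover have "pcomp u (\<lambda>z. w z + v z) = (\<lambda>z. pcomp u w z + pcomp u v z)"
    using assms by (simp add: pcomp_def ip_add algebra_simps)
  ultimately show ?thesis
    using nrm_add[OF pcomp_mem[OF assms(1,2)] pcomp_mem[OF assms(1,3)]]
      nrm_pcomp[OF assms(1) add_mem[OF assms(2,3)]] nrm_pcomp[OF assms(1,2)] nrm_pcomp[OF assms(1,3)]
    by (simp add: distrib_left[symmetric])
qed

lemma gram_scale:
  assumes "u \<in> H" "w \<in> H"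
  shows "gram ip u (\<lambda>z. c * w z) = cmod c * gram ip u w"
  by (rule power2_eq_imp_eq)
    (simp_all add: gram_sq assms scale_mem nrm_scale ip_scale norm_mult power_mult_distrib
      gram_nonneg algebra_simps)

lemma gram_diff:
  assumes "u \<in> H" "w \<in> H" "v \<in> H"
  shows "\<bar>gram ip u w - gram ip u v\<bar> \<le> gram ip u (\<lambda>z. w z - v z)"
proof -
  have "gram ip u (\<lambda>z. v z - w z) = gram ip u (\<lambda>z. w z - v z)"
    using gram_scale[OF assms(1) diff_mem[OF assms(2,3)], of "-1"] by simp
  thus ?thesis
    using gram_add[OF assms(1) diff_mem[OF assms(2,3)] assms(3)]
      gram_add[OF assms(1) diff_mem[OF assms(3,2)] assms(2)] by simp
qed

lemma gram_self: "gram ip u u = 0" if "u \<in> H"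
  using that by (simp add: gram_def ip_self power2_eq_square norm_mult)

text \<open>Allows \<open>k q\<close> to be replaced by \<open>k q - k p\<close> in
  \<open>gram ip (k p) (k q)\<close>, which exhibits the first-order smallness of that
  number.\<close>

lemma gram_diff_self:
  assumes "u \<in> H" "w \<in> H"
  shows "gram ip u (\<lambda>z. w z - u z) = gram ip u w"
  using gram_diff[OF assms(1) diff_mem[OF assms(2,1)] assms(2)]
    gram_scale[OF assms(1,1), of "-1"] gram_self[OF assms(1)] by simp

text \<open>Divided by the norms this says that cos (\<alpha> + \<beta>) is at most the cosine of
  the third angle. Split u and v into parts along w and orthogonal to w; Cauchy-Schwarz bounds the
  product of the orthogonal parts.\<close>

lemma gram_triangle:
  assumes "u \<in> H" "v \<in> H" "w \<in> H"
  shows "cmod (ip u w) * cmod (ip w v) - gram ip u w * gram ip w v \<le> (nrm w)\<^sup>2 * cmod (ip u v)"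
proof (cases "nrm w = 0")
  case True
  hence "w = (\<lambda>z. 0 * w z)"
    using nrm_eq_0[OF assms(3)] by simp
  hence "ip u w = 0"
    using ip_scale_right[OF assms(3,1), of 0] by simp
  thus ?thesis
    using True gram_nonneg assms by simp
next
  case False
  hence w: "0 < nrm w" using nrm_nonneg[OF assms(3)] by simp
  have "(nrm w)\<^sup>2 * cmod (ip (pcomp w u) v) = cmod (ip (pcomp w u) (pcomp w v))"
    using assms by (simp add: ip_pcomp_pcomp norm_mult norm_power)
  also have "\<dots> \<le> (nrm w)\<^sup>2 * (gram ip w u * gram ip w v)"
    using cauchy_schwarz[OF pcomp_mem pcomp_mem, of w v w u] assms
    by (simp add: nrm_pcomp power2_eq_square mult_ac)
  finally have "cmod (ip (pcomp w u) v) \<le> gram ip u w * gram ip w v"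
    using w gram_commute assms by simp
  moreover have "ip u w * ip w v = of_real ((nrm w)\<^sup>2) * ip u v - ip (pcomp w u) v"
    using ip_pcomp assms by simp
  hence "cmod (ip u w) * cmod (ip w v) \<le> (nrm w)\<^sup>2 * cmod (ip u v) + cmod (ip (pcomp w u) v)"
    by (metis norm_mult norm_triangle_ineq4 norm_of_real abs_power2 power2_abs)
  ultimately show ?thesis by simp
qed

text \<open>Gliding hump: each step of size $3^{-n}$ spoils the functional with index \<open>n\<close>, and all later
  steps together are too small to repair it.\<close>

lemma weakly_bounded_imp_bounded:
  assumes mem: "\<And>n::nat. \<phi> n \<in> H"
    and bdd: "\<And>f. f \<in> H \<Longrightarrow> bounded (range (\<lambda>n. ip f (\<phi> n)))"
  shows "\<exists>M. \<forall>n. nrm (\<phi> n) \<le> M"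
proof (rule ccontr)
  assume "\<not> ?thesis"
  \<comment> \<open>Norms beyond 4^i against steps of size (1/3)^i produce values of order (4/3)^i,
    which are unbounded.\<close>
  hence "\<forall>i::nat. \<exists>n. nrm (\<phi> n) > 4 ^ i"
    by (meson linorder_not_le)
  then obtain j where j: "\<And>i. nrm (\<phi> (j i)) > 4 ^ i"
    by metis
  define T where "T i = \<phi> (j i)" for i
  have Tm: "T i \<in> H" for i
    by (simp add: T_def mem)
  have T0: "nrm (T i) > 4 ^ i" for i
    using j by (simp add: T_def)
  have Tpos: "0 < nrm (T i)" for i
    using T0[of i] by (smt (verit) zero_less_power)
  have step: "\<exists>y. y \<in> H \<and> nrm (\<lambda>z. y z - x z) = (1/3) ^ i \<and> (1/3) ^ i * nrm (T i) \<le> cmod (ip y (T i))"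
    if x: "x \<in> H" for x i
  proof -
    define c where "c = complex_of_real ((1/3) ^ i / nrm (T i))"
    define a where "a = ip x (T i)"
    define b where "b = complex_of_real ((1/3) ^ i * nrm (T i))"
    have cT: "ip (\<lambda>z. c * T i z) (T i) = b"
      using Tpos[of i] unfolding ip_scale[OF Tm Tm] ip_self[OF Tm] c_def b_def
      by (simp add: power2_eq_square)
    have "2 * cmod b \<le> cmod (a + b) + cmod (a - b)"
      using norm_triangle_ineq4[of "a + b" "a - b"] by (simp add: norm_mult)
    \<comment> \<open>For one of the two signs the new term b is not cancelled by the old value
      a.\<close>
    then obtain s :: complex where s: "s = 1 \<or> s = -1" "cmod b \<le> cmod (a + s * b)"
      using that[of 1] that[of "-1"] by fastforce
    let ?y = "\<lambda>z. x z + s * (c * T i z)"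
    have "?y \<in> H"
      by (intro add_mem scale_mem x Tm)
    moreover have "nrm (\<lambda>z. (s * c) * T i z) = (1/3) ^ i"
      unfolding nrm_scale[OF Tm] using s(1) Tpos[of i]
      by (auto simp: c_def norm_mult norm_divide norm_power)
    hence "nrm (\<lambda>z. ?y z - x z) = (1/3) ^ i"
      by (simp only: mult.assoc add_diff_cancel_left')
    moreover have "ip ?y (T i) = a + s * b"
      by (simp add: ip_add x Tm scale_mem a_def ip_scale[OF scale_mem] cT)
    moreover have "cmod b = (1/3) ^ i * nrm (T i)"
      using Tpos[of i] by (simp add: b_def norm_mult norm_power norm_divide)
    ultimately show ?thesis
      using s(2) by (intro exI[of _ ?y]) simp
  qed
  have "\<exists>x. \<forall>i. x i \<in> H \<and> (nrm (\<lambda>z. x (Suc i) z - x i z) = (1/3) ^ i \<and>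
      (1/3) ^ i * nrm (T i) \<le> cmod (ip (x (Suc i)) (T i)))"
  proof (rule dependent_nat_choice)
    show "\<exists>x. x \<in> H"
      using zero_mem by blast
    show "\<exists>y. y \<in> H \<and> (nrm (\<lambda>z. y z - x z) = (1/3) ^ i \<and> (1/3) ^ i * nrm (T i) \<le> cmod (ip y (T i)))"
      if "x \<in> H" for x i
      using step[OF that] by simp
  qed
  then obtain x where xm: "\<And>i. x i \<in> H"
    and xd: "\<And>i. nrm (\<lambda>z. x (Suc i) z - x i z) = (1/3) ^ i"
    and xT: "\<And>i. (1/3) ^ i * nrm (T i) \<le> cmod (ip (x (Suc i)) (T i))"
    by blast
  have xc: "nrm (\<lambda>z. x (n + d) z - x n z) \<le> 3/2 * (1/3) ^ n - 3/2 * (1/3) ^ (n + d)" for n d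
  proof (induction d)
    case (Suc d)
    then show ?case
      using nrm_diff_triangle[OF xm[of "n + Suc d"] xm[of "n + d"] xm[of n]] xd[of "n + d"] by simp
  qed (simp add: nrm_zero)
  have xc': "nrm (\<lambda>z. x m z - x n z) \<le> 3/2 * (1/3) ^ n" if "n \<le> m" for m n
  proof -
    have "0 \<le> (1/3::real) ^ m" by simp
    thus ?thesis
      using xc[of n "m - n"] that by (simp del: zero_le_power)
  qed
  have cauchy: "\<exists>N. \<forall>m\<ge>N. \<forall>n\<ge>N. nrm (\<lambda>z. x m z - x n z) < e" if e: "0 < e" for e
  proof -
    obtain N where N: "(1/3::real) ^ N < e / 3"
      using real_arch_pow_inv[of "e/3" "1/3"] e by auto
    have "nrm (\<lambda>z. x m z - x n z) < e" if "m \<ge> N" "n \<ge> N" for m n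
      using nrm_diff_triangle[OF xm[of m] xm[of N] xm[of n]] xc'[OF that(1)] xc'[OF that(2)]
        nrm_minus[OF xm[of n] xm[of N]] N by simp
    thus ?thesis by blast
  qed
  obtain f where f: "f \<in> H" "(\<lambda>n. nrm (\<lambda>z. x n z - f z)) \<longlonglongrightarrow> 0"
    using nrm_complete[of x] xm cauchy by blast
  have fx: "nrm (\<lambda>z. f z - x n z) \<le> 3/2 * (1/3) ^ n" for n
  proof (rule tendsto_lowerbound)
    show "(\<lambda>m. nrm (\<lambda>z. x m z - f z) + 3/2 * (1/3) ^ n) \<longlonglongrightarrow> 3/2 * (1/3) ^ n"
      using tendsto_add[OF f(2) tendsto_const[of "3/2 * (1/3) ^ n"]] by simp
    show "\<forall>\<^sub>F m in sequentially. nrm (\<lambda>z. f z - x n z) \<le> nrm (\<lambda>z. x m z - f z) + 3/2 * (1/3) ^ n"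
      using eventually_ge_at_top[of n]
    proof eventually_elim
      case (elim m)
      then show ?case
        using nrm_diff_triangle[OF f(1) xm[of m] xm[of n]] xc'[OF elim] nrm_minus[OF f(1) xm[of m]] by simp
    qed
  qed simp
  \<comment> \<open>After step i the remaining steps have total size at most 3/2 * (1/3)^(i+1), half
    of (1/3)^i, so they destroy at most half of the gain.\<close>
  have big: "(4/3) ^ i \<le> 2 * cmod (ip f (T i))" for i
  proof -
    have "cmod (ip (\<lambda>z. f z - x (Suc i) z) (T i)) \<le> 3/2 * (1/3) ^ Suc i * nrm (T i)"
      using cauchy_schwarz[OF Tm[of i] diff_mem[OF f(1) xm[of "Suc i"]]] fx[of "Suc i"]
        mult_right_mono[of _ _ "nrm (T i)"] Tpos[of i] by (meson less_imp_le order_trans)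
    moreover have "cmod (ip (x (Suc i)) (T i)) \<le> cmod (ip f (T i)) + cmod (ip (\<lambda>z. f z - x (Suc i) z) (T i))"
      using norm_triangle_ineq4[of "ip f (T i)" "ip (\<lambda>z. f z - x (Suc i) z) (T i)"]
      by (simp add: ip_diff f xm Tm)
    ultimately have "(1/3) ^ i * nrm (T i) \<le> 2 * cmod (ip f (T i))"
      using xT[of i] by simp
    moreover have "(1/3) ^ i * 4 ^ i \<le> (1/3) ^ i * nrm (T i)"
      using T0[of i] by (intro mult_left_mono) auto
    moreover have "(4/3::real) ^ i = (1/3) ^ i * 4 ^ i"
      by (simp add: power_mult_distrib[symmetric])
    ultimately show ?thesis by linarith
  qed
  obtain B where B: "\<And>n. cmod (ip f (\<phi> n)) \<le> B"
    using bdd[OF f(1)] by (auto simp: bounded_iff)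
  obtain i where "2 * B < (4/3::real) ^ i"
    using real_arch_pow[of "4/3" "2 * B"] by auto
  thus False
    using big[of i] B[of "j i"] by (simp add: T_def)
qed

end

section \<open>Differentiability of weakly antiholomorphic maps\<close>

text \<open>Cauchy's inequality on discs of radius r/2 bounds the second derivative by 2 B / (r/2)^2
  = 8 B / r^2; two applications of the mean value bound give the claim. That the bound is linear in
  B makes it uniform over the unit ball of H.\<close>

lemma holomorphic_strict_derivative:
  fixes F :: "complex \<Rightarrow> complex"
  assumes hol: "F holomorphic_on X" and op: "open X" and sub: "cball z0 r \<subseteq> X"
    and r: "0 < r" and B: "\<And>z. z \<in> cball z0 r \<Longrightarrow> cmod (F z) \<le> B"
    and \<rho>: "0 < \<rho>" "\<rho> \<le> r / 2"
    and p: "p \<in> ball z0 \<rho>" and q: "q \<in> ball z0 \<rho>"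
  shows "cmod (F q - F p - deriv F z0 * (q - p)) \<le> 8 * B / r\<^sup>2 * \<rho> * cmod (q - p)"
proof -
  have bX: "ball z0 \<rho> \<subseteq> X"
    using sub \<rho> r by (smt (verit) ball_subset_cball subset_ball subset_trans field_sum_of_halves)
  have B0: "0 \<le> B"
    using B[of z0] r by (smt (verit) centre_in_cball norm_ge_zero)
  have d2: "cmod (deriv (deriv F) w) \<le> 8 * B / r\<^sup>2" if w: "w \<in> ball z0 \<rho>" for w
  proof -
    have wr: "cball w (r/2) \<subseteq> cball z0 r"
    proof
      fix x assume "x \<in> cball w (r/2)"
      thus "x \<in> cball z0 r"
        using w \<rho> dist_triangle[of z0 x w] by (simp add: dist_commute)
    qed
    have "cmod ((deriv ^^ 2) F w) \<le> fact 2 * B / (r/2) ^ 2"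
    proof (rule Cauchy_inequality)
      show "F holomorphic_on ball w (r/2)"
        using hol wr sub by (meson ball_subset_cball holomorphic_on_subset subset_trans)
      show "continuous_on (cball w (r/2)) F"
        using hol wr sub by (meson continuous_on_subset holomorphic_on_imp_continuous_on subset_trans)
      show "cmod (F x) \<le> B" if "cmod (w - x) = r/2" for x
        using B that wr by (auto simp: dist_norm subset_iff)
    qed (use r in simp)
    thus ?thesis
      by (simp add: numeral_2_eq_2 power_divide)
  qed
  have dd: "(deriv F has_field_derivative deriv (deriv F) w) (at w within ball z0 \<rho>)"
    if "w \<in> ball z0 \<rho>" for w
    using hol op bX that
    by (meson DERIV_deriv_iff_field_differentiable has_field_derivative_at_within
        holomorphic_deriv holomorphic_on_imp_differentiable_at subsetD)
  have d1: "cmod (deriv F w - deriv F z0) \<le> 8 * B / r\<^sup>2 * \<rho>" if w: "w \<in> ball z0 \<rho>" for w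
  proof -
    have "cmod (deriv F w - deriv F z0) \<le> 8 * B / r\<^sup>2 * cmod (w - z0)"
      using field_differentiable_bound[OF convex_ball dd d2 w] \<rho> by simp
    also have "\<dots> \<le> 8 * B / r\<^sup>2 * \<rho>"
      using w B0 by (intro mult_left_mono) (auto simp: dist_norm norm_minus_commute)
    finally show ?thesis .
  qed
  have "cmod ((F q - deriv F z0 * q) - (F p - deriv F z0 * p)) \<le> 8 * B / r\<^sup>2 * \<rho> * cmod (q - p)"
  proof (rule field_differentiable_bound[OF convex_ball _ d1])
    fix w assume "w \<in> ball z0 \<rho>"
    hence "(F has_field_derivative deriv F w) (at w within ball z0 \<rho>)"
      using hol op bX by (meson DERIV_deriv_iff_field_differentiable has_field_derivative_at_within
          holomorphic_on_imp_differentiable_at subsetD)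
    thus "((\<lambda>z. F z - deriv F z0 * z) has_field_derivative deriv F w - deriv F z0) (at w within ball z0 \<rho>)"
      by (auto intro!: derivative_eq_intros)
  qed (use p q in auto)
  thus ?thesis
    by (simp add: algebra_simps)
qed

text \<open>\<open>kernel_nonzero\<close> says that the functions in H have no common zero, so that
  every point of X determines a line in H.\<close>

locale holomorphic_rkhs = reproducing_kernel_hilbert_space X H ip k
  for X :: "complex set"
    and H :: "(complex \<Rightarrow> complex) set"
    and ip :: "(complex \<Rightarrow> complex) \<Rightarrow> (complex \<Rightarrow> complex) \<Rightarrow> complex"
    and k :: "complex \<Rightarrow> complex \<Rightarrow> complex" +
  assumes open_X: "open X"
    and connected_X: "connected X"
    and holomorphic_mem: "f \<in> H \<Longrightarrow> f holomorphic_on X"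
    and kernel_nonzero: "x \<in> X \<Longrightarrow> k x \<noteq> (\<lambda>z. 0)"
begin

text \<open>Points of the disc along which the norm is unbounded would give a weakly bounded
  sequence, because each function \<open>\<lambda>z. ip f (\<phi> z)\<close> is continuous on the
  compact disc; uniform boundedness excludes this.\<close>

lemma weakly_holomorphic_locally_bounded:
  assumes mem: "\<And>z. z \<in> X \<Longrightarrow> \<phi> z \<in> H"
    and hol: "\<And>f. f \<in> H \<Longrightarrow> (\<lambda>z. ip f (\<phi> z)) holomorphic_on X"
    and z0: "z0 \<in> X"
  obtains r M where "0 < r" "cball z0 r \<subseteq> X" "0 \<le> M" "\<And>z. z \<in> cball z0 r \<Longrightarrow> nrm (\<phi> z) \<le> M"
proof -
  obtain r where r: "0 < r" "cball z0 r \<subseteq> X"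
    using open_X z0 open_contains_cball by blast
  have "\<exists>M. \<forall>z\<in>cball z0 r. nrm (\<phi> z) \<le> M"
  proof (rule ccontr)
    assume "\<not> ?thesis"
    hence "\<forall>n::nat. \<exists>z\<in>cball z0 r. nrm (\<phi> z) > n"
      by (meson linorder_not_le)
    then obtain \<zeta> where \<zeta>: "\<And>n::nat. \<zeta> n \<in> cball z0 r" "\<And>n. nrm (\<phi> (\<zeta> n)) > n"
      by metis
    have "bounded (range (\<lambda>n. ip f (\<phi> (\<zeta> n))))" if "f \<in> H" for f
    proof (rule bounded_subset)
      show "bounded ((\<lambda>z. ip f (\<phi> z)) ` cball z0 r)"
        by (intro compact_imp_bounded compact_continuous_image compact_cball holomorphic_on_imp_continuous_on
            holomorphic_on_subset[OF hol[OF that]] r)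
      show "range (\<lambda>n. ip f (\<phi> (\<zeta> n))) \<subseteq> (\<lambda>z. ip f (\<phi> z)) ` cball z0 r"
        using \<zeta>(1) by blast
    qed
    then obtain M where M: "\<And>n. nrm (\<phi> (\<zeta> n)) \<le> M"
      using weakly_bounded_imp_bounded[of "\<lambda>n. \<phi> (\<zeta> n)"] mem \<zeta>(1) r(2) by blast
    obtain n :: nat where "M < n"
      using reals_Archimedean2 by blast
    thus False
      using M[of n] \<zeta>(2)[of n] by linarith
  qed
  then obtain M where "\<forall>z\<in>cball z0 r. nrm (\<phi> z) \<le> M"
    by blast
  thus ?thesis
    using that[of r "max M 0"] r by fastforce
qed

text \<open>The difference quotient with two moving points is used throughout because the distances compare
  two nearby points, neither of which is fixed.\<close>

definition strict_antiderivative :: "(complex \<Rightarrow> complex \<Rightarrow> complex) \<Rightarrow> (complex \<Rightarrow> complex) \<Rightarrow> complex \<Rightarrow> bool"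
  where "strict_antiderivative \<phi> \<psi> z \<longleftrightarrow>
    (\<forall>e>0. \<exists>r>0. ball z r \<subseteq> X \<and> (\<forall>p\<in>ball z r. \<forall>q\<in>ball z r.
       nrm (\<lambda>x. \<phi> q x - \<phi> p x - cnj (q - p) * \<psi> x) \<le> e * cmod (q - p)))"

text \<open>The scalar difference estimate depends on f only through \<open>nrm f\<close>. Testing
  it with the vectors in question themselves (\<open>nrm_le_dual\<close>) makes the difference
  quotients Cauchy in norm, and then gives the strict estimate for their limit. The conjugates arise
  because \<open>\<phi>\<close> stands in the antilinear slot.\<close>

lemma weakly_holomorphic_strict:
  assumes mem: "\<And>z. z \<in> X \<Longrightarrow> \<phi> z \<in> H"
    and hol: "\<And>f. f \<in> H \<Longrightarrow> (\<lambda>z. ip f (\<phi> z)) holomorphic_on X"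
    and z0: "z0 \<in> X"
  shows "\<exists>\<psi>\<in>H. (\<forall>f\<in>H. ip f \<psi> = deriv (\<lambda>z. ip f (\<phi> z)) z0) \<and> strict_antiderivative \<phi> \<psi> z0"
proof -
  obtain r M where r: "0 < r" and sub: "cball z0 r \<subseteq> X" and M0: "0 \<le> M"
    and M: "\<And>z. z \<in> cball z0 r \<Longrightarrow> nrm (\<phi> z) \<le> M"
    using weakly_holomorphic_locally_bounded[OF mem hol z0] by blast
  define C where "C = 8 * M / r\<^sup>2"
  have C0: "0 \<le> C" using M0 by (simp add: C_def)
  define d where "d f = deriv (\<lambda>z. ip f (\<phi> z)) z0" for f
  have bX: "ball z0 \<rho> \<subseteq> X" if "\<rho> \<le> r / 2" for \<rho>
    using sub that r by (smt (verit) ball_subset_cball subset_ball subset_trans field_sum_of_halves)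
  have strict: "cmod (ip f (\<phi> q) - ip f (\<phi> p) - d f * (q - p)) \<le> C * nrm f * \<rho> * cmod (q - p)"
    if f: "f \<in> H" and "0 < \<rho>" "\<rho> \<le> r / 2" "p \<in> ball z0 \<rho>" "q \<in> ball z0 \<rho>" for f \<rho> p q
  proof -
    have "cmod (ip f (\<phi> z)) \<le> M * nrm f" if z: "z \<in> cball z0 r" for z
    proof -
      have "cmod (ip f (\<phi> z)) \<le> nrm f * nrm (\<phi> z)"
        using z sub by (intro cauchy_schwarz mem f) auto
      also have "\<dots> \<le> nrm f * M"
        using M[OF z] nrm_nonneg[OF f] by (intro mult_left_mono)
      finally show ?thesis by (simp add: mult.commute)
    qed
    from holomorphic_strict_derivative[OF hol[OF f] open_X sub r this that(2-5)]
    show ?thesis by (simp add: C_def d_def)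
  qed
  \<comment> \<open>Real increments suffice to construct the limit. At most r/4, they make the disc
    of radius 2 h n admissible in \<open>strict\<close>.\<close>
  define h where "h n = r / 4 / real (Suc n)" for n
  have h: "0 < h n" "h n \<le> r / 4" for n
    using r by (auto simp: h_def field_simps)
  have h_lim: "h \<longlonglongrightarrow> 0"
    unfolding h_def by (intro real_tendsto_divide_at_top[OF tendsto_const] filterlim_compose[OF filterlim_real_sequentially filterlim_Suc])
  define D where "D n = (\<lambda>x. complex_of_real (1 / h n) * (\<phi> (z0 + of_real (h n)) x - \<phi> z0 x))" for n
  have in_ball: "z0 + of_real (h n) \<in> ball z0 (2 * h n)" "z0 \<in> ball z0 (2 * h n)" for n
    using h[of n] by (auto simp: dist_norm)
  have memh: "\<phi> (z0 + of_real (h n)) \<in> H" for n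
    using bX[of "2 * h n"] h[of n] in_ball[of n] by (intro mem) auto
  have Dm: "D n \<in> H" for n
    unfolding D_def by (intro scale_mem diff_mem memh mem z0)
  have Dd: "cmod (ip f (D n) - d f) \<le> 2 * C * nrm f * h n" if f: "f \<in> H" for f n
  proof -
    have "ip f (D n) - d f = (ip f (\<phi> (z0 + of_real (h n))) - ip f (\<phi> z0) - d f * of_real (h n)) / of_real (h n)"
      unfolding D_def ip_scale_right[OF diff_mem[OF memh mem[OF z0]] f] ip_diff_right[OF memh mem[OF z0] f]
      using h[of n] by (simp add: diff_divide_distrib)
    also have "cmod \<dots> \<le> (C * nrm f * (2 * h n) * h n) / h n"
      using strict[OF f _ _ in_ball(2) in_ball(1), of n] h[of n]
      unfolding norm_divide by (intro divide_mono) auto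
    also have "\<dots> = 2 * C * nrm f * h n"
      using h[of n] by simp
    finally show ?thesis .
  qed
  have DD: "nrm (\<lambda>x. D m x - D n x) \<le> 2 * C * (h m + h n)" for m n
  proof (rule nrm_le_dual)
    let ?g = "\<lambda>x. D m x - D n x"
    show g: "?g \<in> H" by (intro diff_mem Dm)
    have "ip ?g ?g = (ip ?g (D m) - d ?g) - (ip ?g (D n) - d ?g)"
      by (simp add: ip_diff_right[OF Dm Dm g])
    moreover have "cmod ((ip ?g (D m) - d ?g) - (ip ?g (D n) - d ?g)) \<le> 2 * C * nrm ?g * h m + 2 * C * nrm ?g * h n"
      by (rule order_trans[OF norm_triangle_ineq4 add_mono[OF Dd[OF g] Dd[OF g]]])
    ultimately show "cmod (ip ?g ?g) \<le> 2 * C * (h m + h n) * nrm ?g"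
      by (simp only: distrib_left distrib_right mult_ac)
  qed (use C0 h in \<open>simp add: add_nonneg_nonneg less_imp_le\<close>)
  have "\<exists>N. \<forall>m\<ge>N. \<forall>n\<ge>N. nrm (\<lambda>z. D m z - D n z) < e" if e: "0 < e" for e
  proof -
    have "(\<lambda>n. 4 * C * h n) \<longlonglongrightarrow> 4 * C * 0"
      by (intro tendsto_intros h_lim)
    hence "\<forall>\<^sub>F n in sequentially. 4 * C * h n < e"
      using e by (auto dest: order_tendstoD(2))
    then obtain N where N: "\<And>n. n \<ge> N \<Longrightarrow> 4 * C * h n < e"
      by (auto simp: eventually_sequentially)
    have "nrm (\<lambda>z. D m z - D n z) < e" if "m \<ge> N" "n \<ge> N" for m n
      using DD[of m n] N[OF that(1)] N[OF that(2)] by (simp add: distrib_left)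
    thus ?thesis by blast
  qed
  then obtain \<psi> where \<psi>: "\<psi> \<in> H" "(\<lambda>n. nrm (\<lambda>z. D n z - \<psi> z)) \<longlonglongrightarrow> 0"
    using nrm_complete[of D] Dm by blast
  have \<psi>d: "ip f \<psi> = d f" if f: "f \<in> H" for f
  proof -
    have "cmod (ip f \<psi> - d f) \<le> 0"
    proof (rule tendsto_lowerbound)
      have "(\<lambda>n. nrm f * nrm (\<lambda>z. D n z - \<psi> z) + 2 * C * nrm f * h n) \<longlonglongrightarrow> nrm f * 0 + 2 * C * nrm f * 0"
        by (intro tendsto_intros h_lim \<psi>)
      thus "(\<lambda>n. nrm f * nrm (\<lambda>z. D n z - \<psi> z) + 2 * C * nrm f * h n) \<longlonglongrightarrow> 0"
        by simp
      have "cmod (ip f \<psi> - d f) \<le> nrm f * nrm (\<lambda>z. D n z - \<psi> z) + 2 * C * nrm f * h n" for n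
      proof -
        have eq: "ip f \<psi> - d f = (ip f (D n) - d f) - ip f (\<lambda>z. D n z - \<psi> z)"
          by (simp add: ip_diff_right Dm \<psi> f)
        show ?thesis
          unfolding eq
          using norm_triangle_ineq4[of "ip f (D n) - d f" "ip f (\<lambda>z. D n z - \<psi> z)"]
            Dd[OF f, of n] cauchy_schwarz[OF diff_mem[OF Dm \<psi>(1)] f, of n] by simp
      qed
      thus "\<forall>\<^sub>F n in sequentially. cmod (ip f \<psi> - d f) \<le> nrm f * nrm (\<lambda>z. D n z - \<psi> z) + 2 * C * nrm f * h n"
        by simp
    qed simp
    thus ?thesis by simp
  qed
  have "strict_antiderivative \<phi> \<psi> z0"
    unfolding strict_antiderivative_def
  proof (intro allI impI)
    fix e :: real assume e: "0 < e"
    define \<rho> where "\<rho> = min (r / 2) (e / (C + 1))"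
    have \<rho>: "0 < \<rho>" "\<rho> \<le> r / 2" "C * \<rho> \<le> e"
    proof -
      show "\<rho> \<le> r / 2"
        unfolding \<rho>_def by (rule min.cobounded1)
      have "C * \<rho> \<le> C * (e / (C + 1))"
        using C0 by (intro mult_left_mono) (auto simp: \<rho>_def)
      also have "\<dots> \<le> e"
        using C0 e by (simp add: field_simps)
      finally show "C * \<rho> \<le> e" .
    qed (use r e C0 in \<open>auto simp: \<rho>_def\<close>)
    have "nrm (\<lambda>x. \<phi> q x - \<phi> p x - cnj (q - p) * \<psi> x) \<le> e * cmod (q - p)"
      if pq: "p \<in> ball z0 \<rho>" "q \<in> ball z0 \<rho>" for p q
    proof (rule nrm_le_dual)
      let ?g = "\<lambda>x. \<phi> q x - \<phi> p x - cnj (q - p) * \<psi> x"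
      have m: "\<phi> p \<in> H" "\<phi> q \<in> H"
        using pq bX[OF \<rho>(2)] mem by auto
      show g: "?g \<in> H" by (intro diff_mem scale_mem m \<psi>)
      have "ip f ?g = ip f (\<phi> q) - ip f (\<phi> p) - d f * (q - p)" if "f \<in> H" for f
        unfolding ip_diff_right[OF diff_mem[OF m(2,1)] scale_mem[OF \<psi>(1)] that] ip_diff_right[OF m(2,1) that]
          ip_scale_right[OF \<psi>(1) that] \<psi>d[OF that] by simp
      from this[OF g] have "cmod (ip ?g ?g) \<le> C * nrm ?g * \<rho> * cmod (q - p)"
        using strict[OF g \<rho>(1,2) pq] by (simp only:)
      moreover have "C * \<rho> * (nrm ?g * cmod (q - p)) \<le> e * (nrm ?g * cmod (q - p))"
        using \<rho>(3) nrm_nonneg[OF g] by (intro mult_right_mono) auto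
      ultimately show "cmod (ip ?g ?g) \<le> e * cmod (q - p) * nrm ?g"
        by (simp only: mult_ac)
    qed (use e in simp)
    thus "\<exists>r>0. ball z0 r \<subseteq> X \<and> (\<forall>p\<in>ball z0 r. \<forall>q\<in>ball z0 r.
        nrm (\<lambda>x. \<phi> q x - \<phi> p x - cnj (q - p) * \<psi> x) \<le> e * cmod (q - p))"
      using \<rho>(1) bX[OF \<rho>(2)] by blast
  qed
  thus ?thesis
    using \<psi>(1) \<psi>d by (auto simp: d_def)
qed

text \<open>\<open>\<psi>\<close> satisfies the hypotheses made on \<open>\<phi>\<close>, so
  differentiation can be repeated; the Laplacian takes a second derivative of the kernel.\<close>

lemma weakly_holomorphic_has_antiderivative:
  assumes mem: "\<And>z. z \<in> X \<Longrightarrow> \<phi> z \<in> H"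
    and hol: "\<And>f. f \<in> H \<Longrightarrow> (\<lambda>z. ip f (\<phi> z)) holomorphic_on X"
  obtains \<psi> where "\<And>z. z \<in> X \<Longrightarrow> \<psi> z \<in> H" "\<And>f. f \<in> H \<Longrightarrow> (\<lambda>z. ip f (\<psi> z)) holomorphic_on X"
    "\<And>z. z \<in> X \<Longrightarrow> strict_antiderivative \<phi> (\<psi> z) z"
proof -
  have "\<forall>z\<in>X. \<exists>\<psi>\<in>H. (\<forall>f\<in>H. ip f \<psi> = deriv (\<lambda>z. ip f (\<phi> z)) z) \<and> strict_antiderivative \<phi> \<psi> z"
    using weakly_holomorphic_strict[OF assms] by blast
  then obtain \<psi> where \<psi>: "\<And>z. z \<in> X \<Longrightarrow> \<psi> z \<in> H"
    "\<And>z f. z \<in> X \<Longrightarrow> f \<in> H \<Longrightarrow> ip f (\<psi> z) = deriv (\<lambda>z. ip f (\<phi> z)) z"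
    "\<And>z. z \<in> X \<Longrightarrow> strict_antiderivative \<phi> (\<psi> z) z"
    by metis
  show ?thesis
  proof (rule that)
    show "(\<lambda>z. ip f (\<psi> z)) holomorphic_on X" if "f \<in> H" for f
      using holomorphic_deriv[OF hol[OF that] open_X] \<psi>(2) that by (simp cong: holomorphic_cong)
  qed (use \<psi> in auto)
qed

section \<open>The kernel and its derivative\<close>

lemma ip_kernel_holomorphic:
  assumes "f \<in> H"
  shows "(\<lambda>z. ip f (k z)) holomorphic_on X"
  using holomorphic_mem[OF assms] reproducing[OF assms] by (simp cong: holomorphic_cong)

text \<open>The derivative of the kernel map in the conjugate variable: the vector that represents f
  \<mapsto> f'(z).\<close>

definition kd :: "complex \<Rightarrow> complex \<Rightarrow> complex"
  where "kd = (SOME \<psi>. (\<forall>z\<in>X. \<psi> z \<in> H) \<and> (\<forall>f\<in>H. (\<lambda>z. ip f (\<psi> z)) holomorphic_on X) \<and>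
    (\<forall>z\<in>X. strict_antiderivative k (\<psi> z) z))"

lemma
  shows kd_mem: "z \<in> X \<Longrightarrow> kd z \<in> H"
    and ip_kd_holomorphic: "f \<in> H \<Longrightarrow> (\<lambda>z. ip f (kd z)) holomorphic_on X"
    and strict_kd: "z \<in> X \<Longrightarrow> strict_antiderivative k (kd z) z"
proof -
  have "\<exists>\<psi>. (\<forall>z\<in>X. \<psi> z \<in> H) \<and> (\<forall>f\<in>H. (\<lambda>z. ip f (\<psi> z)) holomorphic_on X) \<and>
    (\<forall>z\<in>X. strict_antiderivative k (\<psi> z) z)"
    using weakly_holomorphic_has_antiderivative[OF kernel_mem ip_kernel_holomorphic] by metis
  from someI_ex[OF this] show "z \<in> X \<Longrightarrow> kd z \<in> H"
    "f \<in> H \<Longrightarrow> (\<lambda>z. ip f (kd z)) holomorphic_on X"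
    "z \<in> X \<Longrightarrow> strict_antiderivative k (kd z) z"
    unfolding kd_def by blast+
qed

lemma strict_antiderivativeD:
  assumes "strict_antiderivative \<phi> \<psi> z" "0 < e"
  shows "\<exists>r>0. ball z r \<subseteq> X \<and> (\<forall>p\<in>ball z r. \<forall>q\<in>ball z r.
       nrm (\<lambda>x. \<phi> q x - \<phi> p x - cnj (q - p) * \<psi> x) \<le> e * cmod (q - p))"
  using assms unfolding strict_antiderivative_def by simp

lemma strict_antiderivative_along:
  assumes s: "strict_antiderivative \<phi> \<psi> z" and mem: "\<And>z. z \<in> X \<Longrightarrow> \<phi> z \<in> H" and \<psi>: "\<psi> \<in> H"
  shows "((\<lambda>t::real. nrm (\<lambda>x. \<phi> (z + of_real t * v) x - \<phi> z x - cnj (of_real t * v) * \<psi> x) / \<bar>t\<bar>) \<longlongrightarrow> 0) (at 0)"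
    (is "(?f \<longlongrightarrow> 0) (at 0)")
  unfolding Lim_at
proof (intro allI impI)
  fix e :: real assume e: "0 < e"
  define e' where "e' = e / 2 / (cmod v + 1)"
  have v: "0 < cmod v + 1" by (simp add: add_nonneg_pos)
  have e': "0 < e'" using e v by (simp add: e'_def)
  obtain r where r: "r > 0" "ball z r \<subseteq> X" "\<And>p q. p \<in> ball z r \<Longrightarrow> q \<in> ball z r \<Longrightarrow>
       nrm (\<lambda>x. \<phi> q x - \<phi> p x - cnj (q - p) * \<psi> x) \<le> e' * cmod (q - p)"
    using strict_antiderivativeD[OF s e'] by metis
  have "dist (?f t) 0 < e" if t: "0 < dist t 0" "dist t 0 < r / (cmod v + 1)" for t
  proof -
    have "\<bar>t\<bar> * cmod v \<le> \<bar>t\<bar> * (cmod v + 1)" by (intro mult_left_mono) auto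
    also have "\<dots> < r"
      using t(2) v by (simp add: field_simps)
    finally have tr: "z + of_real t * v \<in> ball z r" by (simp add: dist_norm norm_mult)
    have zr: "z \<in> ball z r" using r by simp
    have "nrm (\<lambda>x. \<phi> (z + of_real t * v) x - \<phi> z x - cnj (of_real t * v) * \<psi> x) \<le> e' * (\<bar>t\<bar> * cmod v)"
      using r(3)[OF zr tr] by (simp add: norm_mult)
    also have "\<dots> \<le> e' * (\<bar>t\<bar> * (cmod v + 1))"
      using e' by (intro mult_left_mono) auto
    also have "\<dots> = e / 2 * \<bar>t\<bar>"
      using less_imp_neq[OF v] by (simp add: e'_def divide_simps)
    finally have "?f t \<le> e / 2"
      using t(1) by (simp add: divide_le_eq)
    moreover have "0 \<le> ?f t"
      using tr zr r(2) by (intro divide_nonneg_nonneg nrm_nonneg diff_mem scale_mem mem \<psi>) auto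
    ultimately show ?thesis using e by (simp only: dist_real_def)
  qed
  thus "\<exists>d>0. \<forall>t. 0 < dist t 0 \<and> dist t 0 < d \<longrightarrow> dist (?f t) 0 < e"
    using r(1) v by (intro exI[of _ "r / (cmod v + 1)"]) auto
qed


lemma nrm_kernel_pos: "0 < nrm (k z)" if "z \<in> X"
  using nrm_nonneg[OF kernel_mem[OF that]] nrm_eq_0[OF kernel_mem[OF that]] kernel_nonzero[OF that] by linarith

text \<open>The velocity of an antiholomorphic map in direction v carries the factor
  \<open>cnj v\<close>. The second half shows that norm limits are unique, as the definite
  description requires.\<close>

lemma hderiv_kernel:
  assumes z: "z \<in> X"
  shows "hderiv H ip (\<lambda>s. k (z + of_real s * v)) = (\<lambda>x. cnj v * kd z x)"
  unfolding hderiv_def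
proof (rule the_equality)
  let ?w = "\<lambda>x. cnj v * kd z x"
  have w: "?w \<in> H" by (intro scale_mem kd_mem z)
  have near: "\<forall>\<^sub>F s in at (0::real). s \<noteq> 0 \<and> z + of_real s * v \<in> X"
  proof (rule eventually_conj)
    show "\<forall>\<^sub>F s in at (0::real). s \<noteq> 0"
      by (simp add: eventually_at_filter)
    have "((\<lambda>s::real. z + of_real s * v) \<longlongrightarrow> z + of_real 0 * v) (at 0)"
      by (intro tendsto_intros)
    thus "\<forall>\<^sub>F s in at (0::real). z + of_real s * v \<in> X"
      using topological_tendstoD[OF _ open_X] z by simp
  qed
  have lim: "((\<lambda>s. nrm (\<lambda>x. (k (z + of_real s * v) x - k (z + of_real 0 * v) x) / of_real s - ?w x)) \<longlongrightarrow> 0) (at 0)"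
  proof (rule Lim_transform_eventually[OF strict_antiderivative_along[OF strict_kd[OF z] kernel_mem kd_mem[OF z], of v]])
    show "\<forall>\<^sub>F s in at 0. nrm (\<lambda>x. k (z + of_real s * v) x - k z x - cnj (of_real s * v) * kd z x) / \<bar>s\<bar> =
        nrm (\<lambda>x. (k (z + of_real s * v) x - k (z + of_real 0 * v) x) / of_real s - ?w x)"
      using near
    proof eventually_elim
      case (elim s)
      let ?g = "\<lambda>x. k (z + of_real s * v) x - k z x - cnj (of_real s * v) * kd z x"
      have "?g \<in> H"
        using elim by (intro diff_mem scale_mem kernel_mem kd_mem z) auto
      from nrm_scale[OF this, of "1 / of_real s"]
      have "nrm ?g / \<bar>s\<bar> = nrm (\<lambda>x. 1 / of_real s * ?g x)"
        by (simp only: norm_divide norm_one norm_of_real times_divide_eq_left mult_1)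
      moreover have "(\<lambda>x. 1 / of_real s * ?g x) =
          (\<lambda>x. (k (z + of_real s * v) x - k (z + of_real 0 * v) x) / of_real s - ?w x)"
        using elim by (auto simp: field_simps)
      ultimately show ?case by simp
    qed
  qed
  show "?w \<in> H \<and> ((\<lambda>s. nrm (\<lambda>x. (k (z + of_real s * v) x - k (z + of_real 0 * v) x) / of_real s - ?w x)) \<longlongrightarrow> 0) (at 0)"
    using w lim by blast
  fix w' assume w': "w' \<in> H \<and> ((\<lambda>s. nrm (\<lambda>x. (k (z + of_real s * v) x - k (z + of_real 0 * v) x) / of_real s - w' x)) \<longlongrightarrow> 0) (at 0)"
  have "nrm (\<lambda>x. w' x - ?w x) \<le> 0"
  proof (rule tendsto_lowerbound)
    show "((\<lambda>s. nrm (\<lambda>x. (k (z + of_real s * v) x - k (z + of_real 0 * v) x) / of_real s - w' x) +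
        nrm (\<lambda>x. (k (z + of_real s * v) x - k (z + of_real 0 * v) x) / of_real s - ?w x)) \<longlongrightarrow> 0) (at 0)"
      using tendsto_add[OF conjunct2[OF w'] lim] by simp
    show "\<forall>\<^sub>F s in at 0. nrm (\<lambda>x. w' x - ?w x) \<le>
       nrm (\<lambda>x. (k (z + of_real s * v) x - k (z + of_real 0 * v) x) / of_real s - w' x) +
        nrm (\<lambda>x. (k (z + of_real s * v) x - k (z + of_real 0 * v) x) / of_real s - ?w x)"
      using near
    proof eventually_elim
      case (elim s)
      have g: "(\<lambda>x. 1 / of_real s * (k (z + of_real s * v) x - k (z + of_real 0 * v) x)) \<in> H"
        using elim z by (intro scale_mem diff_mem kernel_mem) auto
      hence g: "(\<lambda>x. (k (z + of_real s * v) x - k (z + of_real 0 * v) x) / of_real s) \<in> H"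
        by simp
      show ?case
        using nrm_diff_triangle[OF conjunct1[OF w'] g w] nrm_minus[OF conjunct1[OF w'] g] by simp
    qed
  qed simp
  moreover have m: "(\<lambda>x. w' x - ?w x) \<in> H"
    using w' w diff_mem by blast
  ultimately have "(\<lambda>x. w' x - ?w x) = (\<lambda>x. 0)"
    using nrm_nonneg[OF m] nrm_eq_0[OF m] by linarith
  thus "w' = ?w"
    by (metis (no_types) eq_iff_diff_eq_0)
qed

section \<open>The three distances\<close>

text \<open>The P of the overview. It does not depend on the direction because the velocity in
  direction v is the multiple \<open>cnj v\<close> of the single vector \<open>kd z\<close>.\<close>

definition dens :: "complex \<Rightarrow> real"
  where "dens z = gram ip (k z) (kd z) / (nrm (k z))\<^sup>2"

lemma dens_nonneg: "0 \<le> dens z" if "z \<in> X"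
  by (simp add: dens_def gram_nonneg kernel_mem kd_mem that)

lemma ds_FS_eq:
  assumes z: "z \<in> X"
  shows "ds_FS H ip k z v = dens z * cmod v"
proof -
  have "ds_FS H ip k z v = gram ip (k z) (\<lambda>x. cnj v * kd z x) / (nrm (k z))\<^sup>2"
    unfolding ds_FS_def hderiv_kernel[OF z] fubini_study_def gram_def ..
  thus ?thesis
    by (simp add: gram_scale kernel_mem kd_mem z dens_def)
qed

definition coeff :: "complex \<Rightarrow> complex \<Rightarrow> real"
  where "coeff p q = cmod (ip (k p) (k q)) / (nrm (k p) * nrm (k q))"

definition angle :: "complex \<Rightarrow> complex \<Rightarrow> real"
  where "angle p q = arccos (coeff p q)"

lemma coeff_bounds:
  assumes "p \<in> X" "q \<in> X"
  shows "0 \<le> coeff p q" "coeff p q \<le> 1"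
  using nrm_kernel_pos[OF assms(1)] nrm_kernel_pos[OF assms(2)]
    cauchy_schwarz[OF kernel_mem[OF assms(2)] kernel_mem[OF assms(1)]]
  by (auto simp: coeff_def)

lemma ip_normalized_kernel:
  assumes "p \<in> X" "q \<in> X"
  shows "cmod (ip (normalized_kernel ip k p) (normalized_kernel ip k q)) = coeff p q"
proof -
  let ?c = "\<lambda>x. complex_of_real (1 / nrm (k x))"
  have "normalized_kernel ip k x = (\<lambda>z. ?c x * k x z)" for x
    by (simp add: normalized_kernel_def)
  hence "ip (normalized_kernel ip k p) (normalized_kernel ip k q) = ?c p * (cnj (?c q) * ip (k p) (k q))"
    by (simp only: ip_scale[OF kernel_mem[OF assms(1)] scale_mem[OF kernel_mem[OF assms(2)]]]
      ip_scale_right[OF kernel_mem[OF assms(2)] kernel_mem[OF assms(1)]])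
  thus ?thesis
    using nrm_kernel_pos[OF assms(1)] nrm_kernel_pos[OF assms(2)] by (simp add: norm_mult norm_divide coeff_def)
qed

lemma delta_eq:
  assumes "p \<in> X" "q \<in> X"
  shows "delta ip k p q = sqrt (1 - (coeff p q)\<^sup>2)"
    and "delta_hat ip k p q = sqrt 2 * sqrt (1 - coeff p q)"
  using ip_normalized_kernel[OF assms] by (simp_all add: delta_def delta_hat_def)

lemma delta_gram:
  assumes "p \<in> X" "q \<in> X"
  shows "delta ip k p q = gram ip (k p) (k q) / (nrm (k p) * nrm (k q))"
proof (rule power2_eq_imp_eq)
  have "(delta ip k p q)\<^sup>2 = 1 - (coeff p q)\<^sup>2"
    using coeff_bounds[OF assms] delta_eq[OF assms] by (simp add: power_le_one)
  also have "\<dots> = (gram ip (k p) (k q) / (nrm (k p) * nrm (k q)))\<^sup>2"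
    using nrm_kernel_pos[OF assms(1)] nrm_kernel_pos[OF assms(2)] ip_cnj[OF kernel_mem kernel_mem, of q p] assms
    by (simp add: power_divide gram_sq kernel_mem coeff_def field_simps)
  finally show "(delta ip k p q)\<^sup>2 = (gram ip (k p) (k q) / (nrm (k p) * nrm (k q)))\<^sup>2" .
  show "0 \<le> delta ip k p q"
    using coeff_bounds[OF assms] delta_eq[OF assms] by (simp add: power_le_one)
  show "0 \<le> gram ip (k p) (k q) / (nrm (k p) * nrm (k q))"
    using assms by (intro divide_nonneg_nonneg mult_nonneg_nonneg gram_nonneg nrm_nonneg kernel_mem)
qed

lemma delta_nonneg:
  assumes "p \<in> X" "q \<in> X"
  shows "0 \<le> delta ip k p q"
  using coeff_bounds[OF assms] delta_eq[OF assms] by (simp add: power_le_one)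

lemma delta_le_delta_hat:
  assumes "p \<in> X" "q \<in> X"
  shows "delta ip k p q \<le> delta_hat ip k p q"
proof -
  have "0 \<le> (1 - coeff p q)\<^sup>2" by simp
  hence "1 - (coeff p q)\<^sup>2 \<le> 2 * (1 - coeff p q)"
    by (simp add: power2_eq_square algebra_simps)
  thus ?thesis
    unfolding delta_eq[OF assms] real_sqrt_mult[symmetric] by (rule real_sqrt_le_mono)
qed

lemma angle_bounds:
  assumes "p \<in> X" "q \<in> X"
  shows "0 \<le> angle p q" "angle p q \<le> pi / 2" "cos (angle p q) = coeff p q"
    "sin (angle p q) = delta ip k p q"
  using coeff_bounds[OF assms] unfolding angle_def delta_eq(1)[OF assms]
  by (intro arccos_lbound arccos_le_pi2 cos_arccos sin_arccos; simp)+

lemma delta_hat_eq: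
  assumes "p \<in> X" "q \<in> X"
  shows "delta_hat ip k p q = 2 * sin (angle p q / 2)"
proof -
  have "1 - coeff p q = 2 * (sin (angle p q / 2))\<^sup>2"
    using cos_double_sin[of "angle p q / 2"] angle_bounds[OF assms] by simp
  moreover have "0 \<le> sin (angle p q / 2)"
    using angle_bounds[OF assms] by (intro sin_ge_zero) auto
  ultimately show ?thesis
    unfolding delta_eq[OF assms] by (simp add: real_sqrt_mult real_sqrt_abs)
qed

lemma delta_hat_le_angle:
  assumes "p \<in> X" "q \<in> X"
  shows "delta_hat ip k p q \<le> angle p q"
  unfolding delta_hat_eq[OF assms] using sin_x_le_x[of "angle p q / 2"] angle_bounds[OF assms] by simp

text \<open>Halving once more yields strictness: 2 sin (\<theta>/2) = 4 sin (\<theta>/4) cos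
  (\<theta>/4) < 4 sin (\<theta>/4) <= \<theta>.\<close>

lemma delta_hat_less_angle:
  assumes "p \<in> X" "q \<in> X" "0 < angle p q"
  shows "delta_hat ip k p q < angle p q"
proof -
  let ?a = "angle p q / 4"
  have a: "0 < ?a" "?a < pi / 2"
    using assms(3) angle_bounds[OF assms(1,2)] pi_gt_zero by linarith+
  have "cos ?a < 1"
    using cos_monotone_0_pi[of 0 ?a] a by simp
  hence "sin ?a * cos ?a < sin ?a * 1"
    using sin_gt_zero2[OF a] by (intro mult_strict_left_mono)
  moreover have "sin (angle p q / 2) = 2 * sin ?a * cos ?a"
    using sin_double[of ?a] by simp
  ultimately show ?thesis
    unfolding delta_hat_eq[OF assms(1,2)] using sin_x_le_x[of ?a] a by simp
qed

text \<open>Each angle is at most pi/2, so the sum of two stays in the interval from 0 to pi, where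
  the cosine is decreasing and the inequality \<open>gram_triangle\<close> can be read off for the
  angles.\<close>

lemma angle_triangle:
  assumes "p \<in> X" "q \<in> X" "w \<in> X"
  shows "angle p q \<le> angle p w + angle w q"
proof -
  note n = nrm_kernel_pos[OF assms(1)] nrm_kernel_pos[OF assms(2)] nrm_kernel_pos[OF assms(3)]
  have "cos (angle p w + angle w q) = coeff p w * coeff w q - delta ip k p w * delta ip k w q"
    using assms by (simp add: cos_add angle_bounds)
  also have "\<dots> = (cmod (ip (k p) (k w)) * cmod (ip (k w) (k q)) - gram ip (k p) (k w) * gram ip (k w) (k q))
      / (nrm (k p) * nrm (k q) * (nrm (k w))\<^sup>2)"
    using n assms by (simp add: coeff_def delta_gram field_simps power2_eq_square)
  also have "\<dots> \<le> (nrm (k w))\<^sup>2 * cmod (ip (k p) (k q)) / (nrm (k p) * nrm (k q) * (nrm (k w))\<^sup>2)"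
    using gram_triangle[OF kernel_mem kernel_mem kernel_mem, OF assms] n by (intro divide_right_mono) auto
  also have "\<dots> = cos (angle p q)"
    using n angle_bounds[OF assms(1,2)] by (simp add: coeff_def)
  finally have "cos (angle p w + angle w q) \<le> cos (angle p q)" .
  thus ?thesis
    using cos_mono_le_eq[of "angle p w + angle w q" "angle p q"] angle_bounds[OF assms(1,2)]
      angle_bounds[OF assms(1,3)] angle_bounds[OF assms(3,2)] by simp
qed

lemma angle_self: "angle p p = 0" if "p \<in> X"
  using nrm_kernel_pos[OF that] ip_self[OF kernel_mem[OF that]]
  by (simp add: angle_def coeff_def power2_eq_square norm_mult)

text \<open>The bound \<theta> <= tan \<theta> avoids an expansion of \<open>arccos\<close> at 1,
  where it is not differentiable.\<close>

lemma angle_le_gram: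
  assumes "p \<in> X" "q \<in> X" "ip (k p) (k q) \<noteq> 0"
  shows "angle p q \<le> gram ip (k p) (k q) / cmod (ip (k p) (k q))"
proof -
  note n = nrm_kernel_pos[OF assms(1)] nrm_kernel_pos[OF assms(2)]
  have c: "0 < cos (angle p q)"
    using angle_bounds[OF assms(1,2)] n assms(3) by (simp add: coeff_def)
  hence "angle p q < pi / 2"
    using angle_bounds[OF assms(1,2)] by (smt (verit) cos_pi_half)
  hence "angle p q = arctan (tan (angle p q))"
    using angle_bounds[OF assms(1,2)] pi_gt_zero by (intro arctan_tan[symmetric]) linarith+
  also have "\<dots> \<le> tan (angle p q)"
    using c angle_bounds[OF assms(1,2)] delta_nonneg[OF assms(1,2)]
    by (intro arctan_le_self) (simp add: tan_def)
  also have "\<dots> = gram ip (k p) (k q) / cmod (ip (k p) (k q))"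
    using n assms(3) unfolding tan_def angle_bounds(3,4)[OF assms(1,2)] delta_gram[OF assms(1,2)] coeff_def
    by simp
  finally show ?thesis .
qed

end

text \<open>Pairs of distinct points both tending to z. Strict differentiability becomes an ordinary
  limit along this filter, and quotients by the distance of the two points are defined.\<close>

definition offdiag :: "complex \<Rightarrow> (complex \<times> complex) filter"
  where "offdiag z = at (z, z) within {w. fst w \<noteq> snd w}"

lemma eventually_offdiag:
  "eventually (\<lambda>w. Q (fst w) (snd w)) (offdiag z) \<longleftrightarrow>
    (\<exists>r>0. \<forall>p\<in>ball z r. \<forall>q\<in>ball z r. p \<noteq> q \<longrightarrow> Q p q)"
proof
  assume "eventually (\<lambda>w. Q (fst w) (snd w)) (offdiag z)"
  then obtain d where d: "d > 0"
    "\<And>w. fst w \<noteq> snd w \<Longrightarrow> w \<noteq> (z, z) \<Longrightarrow> dist w (z, z) < d \<Longrightarrow> Q (fst w) (snd w)"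
    unfolding offdiag_def eventually_at by auto
  have "Q p q" if "p \<in> ball z (d/2)" "q \<in> ball z (d/2)" "p \<noteq> q" for p q
  proof -
    have "dist (p, q) (z, z) \<le> dist p z + dist q z"
      unfolding dist_Pair_Pair by (rule sqrt_sum_squares_le_sum) auto
    also have "\<dots> < d"
      using that by (auto simp: dist_commute)
    finally show ?thesis
      using d(2)[of "(p, q)"] that by auto
  qed
  thus "\<exists>r>0. \<forall>p\<in>ball z r. \<forall>q\<in>ball z r. p \<noteq> q \<longrightarrow> Q p q"
    using d(1) by (intro exI[of _ "d/2"]) simp
next
  assume "\<exists>r>0. \<forall>p\<in>ball z r. \<forall>q\<in>ball z r. p \<noteq> q \<longrightarrow> Q p q"
  then obtain r where r: "r > 0" "\<And>p q. p \<in> ball z r \<Longrightarrow> q \<in> ball z r \<Longrightarrow> p \<noteq> q \<Longrightarrow> Q p q"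
    by auto
  show "eventually (\<lambda>w. Q (fst w) (snd w)) (offdiag z)"
    unfolding offdiag_def eventually_at
  proof (intro exI[of _ r] conjI ballI impI r(1))
    fix w assume "w \<in> {w. fst w \<noteq> snd w}" "w \<noteq> (z, z) \<and> dist w (z, z) < r"
    moreover from this have "dist (fst w) z < r" "dist (snd w) z < r"
      using dist_fst_le[of w "(z, z)"] dist_snd_le[of w "(z, z)"] by auto
    ultimately show "Q (fst w) (snd w)"
      using r(2) by (simp add: dist_commute)
  qed
qed

lemma filterlim_offdiag:
  "filterlim fst (nhds z) (offdiag z)" "filterlim snd (nhds z) (offdiag z)"
proof -
  have id: "((\<lambda>w. w) \<longlongrightarrow> (z, z)) (offdiag z)"
    unfolding offdiag_def by (rule tendsto_ident_at)
  show "filterlim fst (nhds z) (offdiag z)" "filterlim snd (nhds z) (offdiag z)"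
    using tendsto_fst[OF id] tendsto_snd[OF id] unfolding fst_conv snd_conv .
qed

lemma offdiag_nontrivial: "offdiag z \<noteq> bot"
proof
  assume "offdiag z = bot"
  then obtain r where r: "r > 0" "\<forall>p\<in>ball z r. \<forall>q\<in>ball z r. p \<noteq> q \<longrightarrow> False"
    using eventually_offdiag[of "\<lambda>p q. False" z] by auto
  moreover have "z + of_real (r/2) \<in> ball z r" "z + of_real (r/2) \<noteq> z" "z \<in> ball z r"
    using r(1) by (auto simp: dist_norm)
  ultimately show False by metis
qed

context holomorphic_rkhs
begin

section \<open>First-order comparison of the distances\<close>

lemma eventually_X: "z \<in> X \<Longrightarrow> \<forall>\<^sub>F p in nhds z. p \<in> X"
  by (rule eventually_nhds_in_open[OF open_X])

text \<open>The strict estimate with e = 1 is already a Lipschitz bound at z.\<close>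

lemma strict_antiderivative_continuous:
  assumes s: "strict_antiderivative \<phi> \<psi> z" and mem: "\<And>z. z \<in> X \<Longrightarrow> \<phi> z \<in> H" and \<psi>: "\<psi> \<in> H"
  shows "((\<lambda>p. nrm (\<lambda>x. \<phi> p x - \<phi> z x)) \<longlongrightarrow> 0) (nhds z)"
proof (rule Lim_null_comparison)
  obtain r where r: "r > 0" "ball z r \<subseteq> X" "\<And>p q. p \<in> ball z r \<Longrightarrow> q \<in> ball z r \<Longrightarrow>
       nrm (\<lambda>x. \<phi> q x - \<phi> p x - cnj (q - p) * \<psi> x) \<le> 1 * cmod (q - p)"
    using strict_antiderivativeD[OF s zero_less_one] by metis
  have z: "z \<in> ball z r" using r by simp
  show "\<forall>\<^sub>F p in nhds z. norm (nrm (\<lambda>x. \<phi> p x - \<phi> z x)) \<le> (1 + nrm \<psi>) * cmod (p - z)"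
    using eventually_nhds_in_open[OF open_ball z]
  proof eventually_elim
    case (elim p)
    have m: "\<phi> p \<in> H" "\<phi> z \<in> H"
      using mem[of p] mem[of z] subsetD[OF r(2) elim] subsetD[OF r(2) z] by blast+
    have "nrm (\<lambda>x. (\<phi> p x - \<phi> z x - cnj (p - z) * \<psi> x) + cnj (p - z) * \<psi> x)
        \<le> nrm (\<lambda>x. \<phi> p x - \<phi> z x - cnj (p - z) * \<psi> x) + nrm (\<lambda>x. cnj (p - z) * \<psi> x)"
      by (intro nrm_add diff_mem scale_mem m \<psi>)
    hence "nrm (\<lambda>x. \<phi> p x - \<phi> z x) \<le> 1 * cmod (p - z) + cmod (p - z) * nrm \<psi>"
      unfolding nrm_scale[OF \<psi>] complex_mod_cnj using r(3)[OF z elim] by (simp del: complex_cnj_diff)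
    thus ?case
      using nrm_nonneg[OF diff_mem[OF m]] by (simp add: algebra_simps)
  qed
  have "((\<lambda>p. (1 + nrm \<psi>) * cmod (p - z)) \<longlongrightarrow> (1 + nrm \<psi>) * cmod (z - z)) (nhds z)"
    by (intro tendsto_intros filterlim_ident)
  thus "((\<lambda>p. (1 + nrm \<psi>) * cmod (p - z)) \<longlongrightarrow> 0) (nhds z)"
    by simp
qed

lemma tendsto_nrm:
  assumes "((\<lambda>p. nrm (\<lambda>x. \<phi> p x - f x)) \<longlongrightarrow> 0) F" "\<forall>\<^sub>F p in F. \<phi> p \<in> H" "f \<in> H"
  shows "((\<lambda>p. nrm (\<phi> p)) \<longlongrightarrow> nrm f) F"
proof (rule LIM_zero_cancel, rule Lim_null_comparison[OF _ assms(1)])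
  show "\<forall>\<^sub>F p in F. norm (nrm (\<phi> p) - nrm f) \<le> nrm (\<lambda>x. \<phi> p x - f x)"
    using assms(2) by eventually_elim (use nrm_abs_diff assms(3) in simp)
qed

lemma tendsto_ip:
  assumes "((\<lambda>p. nrm (\<lambda>x. \<phi> p x - f x)) \<longlongrightarrow> 0) F" "\<forall>\<^sub>F p in F. \<phi> p \<in> H" "f \<in> H"
    and "((\<lambda>p. nrm (\<lambda>x. \<eta> p x - g x)) \<longlongrightarrow> 0) F" "\<forall>\<^sub>F p in F. \<eta> p \<in> H" "g \<in> H"
  shows "((\<lambda>p. ip (\<phi> p) (\<eta> p)) \<longlongrightarrow> ip f g) F"
proof (rule LIM_zero_cancel, rule Lim_null_comparison)
  show "\<forall>\<^sub>F p in F. norm (ip (\<phi> p) (\<eta> p) - ip f g) \<le>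
      nrm (\<lambda>x. \<phi> p x - f x) * nrm (\<eta> p) + nrm f * nrm (\<lambda>x. \<eta> p x - g x)"
    using assms(2,5)
  proof eventually_elim
    case (elim p)
    have eq: "ip (\<phi> p) (\<eta> p) - ip f g = ip (\<lambda>x. \<phi> p x - f x) (\<eta> p) + ip f (\<lambda>x. \<eta> p x - g x)"
      using elim assms(3,6) by (simp add: ip_diff ip_diff_right)
    show ?case
      unfolding eq
      by (rule order_trans[OF norm_triangle_ineq add_mono])
        (intro cauchy_schwarz diff_mem elim assms)+
  qed
  have "((\<lambda>p. nrm (\<lambda>x. \<phi> p x - f x) * nrm (\<eta> p) + nrm f * nrm (\<lambda>x. \<eta> p x - g x)) \<longlongrightarrow>
     0 * nrm g + nrm f * 0) F"
    by (intro tendsto_intros assms tendsto_nrm)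
  thus "((\<lambda>p. nrm (\<lambda>x. \<phi> p x - f x) * nrm (\<eta> p) + nrm f * nrm (\<lambda>x. \<eta> p x - g x)) \<longlongrightarrow> 0) F"
    by simp
qed

lemma kernel_lim_offdiag:
  assumes z: "z \<in> X"
  shows "((\<lambda>w. nrm (\<lambda>x. k (fst w) x - k z x)) \<longlongrightarrow> 0) (offdiag z)"
    and "((\<lambda>w. nrm (\<lambda>x. k (snd w) x - k z x)) \<longlongrightarrow> 0) (offdiag z)"
    and "\<forall>\<^sub>F w in offdiag z. fst w \<in> X" "\<forall>\<^sub>F w in offdiag z. snd w \<in> X"
    and "\<forall>\<^sub>F w in offdiag z. k (fst w) \<in> H" "\<forall>\<^sub>F w in offdiag z. k (snd w) \<in> H"
proof -
  note L = strict_antiderivative_continuous[OF strict_kd[OF z] kernel_mem kd_mem[OF z]]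
  show "((\<lambda>w. nrm (\<lambda>x. k (fst w) x - k z x)) \<longlongrightarrow> 0) (offdiag z)"
    by (rule filterlim_compose[OF L filterlim_offdiag(1)])
  show "((\<lambda>w. nrm (\<lambda>x. k (snd w) x - k z x)) \<longlongrightarrow> 0) (offdiag z)"
    by (rule filterlim_compose[OF L filterlim_offdiag(2)])
  show X1: "\<forall>\<^sub>F w in offdiag z. fst w \<in> X" and X2: "\<forall>\<^sub>F w in offdiag z. snd w \<in> X"
    using filterlim_iff[THEN iffD1, OF filterlim_offdiag(1)] filterlim_iff[THEN iffD1, OF filterlim_offdiag(2)]
      eventually_X[OF z] by blast+
  show "\<forall>\<^sub>F w in offdiag z. k (fst w) \<in> H"
    using X1 by eventually_elim (rule kernel_mem)
  show "\<forall>\<^sub>F w in offdiag z. k (snd w) \<in> H"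
    using X2 by eventually_elim (rule kernel_mem)
qed

lemma strict_kd_offdiag:
  assumes z: "z \<in> X"
  shows "((\<lambda>w. nrm (\<lambda>x. k (snd w) x - k (fst w) x - cnj (snd w - fst w) * kd z x) / cmod (snd w - fst w)) \<longlongrightarrow> 0)
    (offdiag z)" (is "(?f \<longlongrightarrow> 0) _")
  unfolding tendsto_iff
proof (intro allI impI)
  fix e :: real assume e: "0 < e"
  obtain r where r: "r > 0" "ball z r \<subseteq> X" "\<And>p q. p \<in> ball z r \<Longrightarrow> q \<in> ball z r \<Longrightarrow>
       nrm (\<lambda>x. k q x - k p x - cnj (q - p) * kd z x) \<le> e / 2 * cmod (q - p)"
    using strict_antiderivativeD[OF strict_kd[OF z] half_gt_zero[OF e]] by metis
  have "\<forall>p\<in>ball z r. \<forall>q\<in>ball z r. p \<noteq> q \<longrightarrow>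
      dist (nrm (\<lambda>x. k q x - k p x - cnj (q - p) * kd z x) / cmod (q - p)) 0 < e"
  proof (intro ballI impI)
    fix p q assume pq: "p \<in> ball z r" "q \<in> ball z r" "p \<noteq> q"
    have "nrm (\<lambda>x. k q x - k p x - cnj (q - p) * kd z x) / cmod (q - p) \<le> e / 2"
      using r(3)[OF pq(1,2)] pq(3) by (simp add: divide_le_eq)
    moreover have "0 \<le> nrm (\<lambda>x. k q x - k p x - cnj (q - p) * kd z x) / cmod (q - p)"
      using pq r(2) by (intro divide_nonneg_nonneg nrm_nonneg diff_mem scale_mem kernel_mem kd_mem z) auto
    ultimately show "dist (nrm (\<lambda>x. k q x - k p x - cnj (q - p) * kd z x) / cmod (q - p)) 0 < e"
      using e by (simp only: dist_real_def)
  qed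
  thus "\<forall>\<^sub>F w in offdiag z. dist (?f w) 0 < e"
    using r(1) eventually_offdiag[of "\<lambda>p q. dist (nrm (\<lambda>x. k q x - k p x - cnj (q - p) * kd z x) / cmod (q - p)) 0 < e"]
    by blast
qed

text \<open>In \<open>gram ip (k p) (k q)\<close> the second vector may be replaced by
  \<open>k q - k p\<close>, which is \<open>cnj (q - p) * kd z\<close> up to a smaller error; what
  remains is the continuity of \<open>gram\<close> in its first argument.\<close>

lemma gram_offdiag:
  assumes z: "z \<in> X"
  shows "((\<lambda>w. gram ip (k (fst w)) (k (snd w)) / cmod (snd w - fst w)) \<longlongrightarrow> gram ip (k z) (kd z)) (offdiag z)"
proof (rule LIM_zero_cancel, rule Lim_null_comparison)
  let ?D = "\<lambda>w. nrm (\<lambda>x. k (snd w) x - k (fst w) x - cnj (snd w - fst w) * kd z x)"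
  have ne: "\<forall>\<^sub>F w in offdiag z. fst w \<noteq> snd w"
    by (simp add: offdiag_def eventually_at_filter)
  show "\<forall>\<^sub>F w in offdiag z. norm (gram ip (k (fst w)) (k (snd w)) / cmod (snd w - fst w) - gram ip (k z) (kd z))
    \<le> nrm (k (fst w)) * (?D w / cmod (snd w - fst w)) + nrm (kd z) * nrm (\<lambda>x. k (fst w) x - k z x)"
    using kernel_lim_offdiag(5,6)[OF z] ne
  proof eventually_elim
    case (elim w)
    define h where "h = snd w - fst w"
    have h: "0 < cmod h" using elim by (simp add: h_def)
    note m = elim(1,2) kd_mem[OF z] kernel_mem[OF z]
    have "\<bar>gram ip (k (fst w)) (\<lambda>x. k (snd w) x - k (fst w) x) - gram ip (k (fst w)) (\<lambda>x. cnj h * kd z x)\<bar>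
        \<le> gram ip (k (fst w)) (\<lambda>x. k (snd w) x - k (fst w) x - cnj h * kd z x)"
      by (intro gram_diff diff_mem scale_mem m)
    also have "\<dots> \<le> nrm (k (fst w)) * ?D w"
      unfolding h_def by (intro gram_le diff_mem scale_mem m)
    finally have 1: "\<bar>gram ip (k (fst w)) (k (snd w)) - cmod h * gram ip (k (fst w)) (kd z)\<bar> \<le> nrm (k (fst w)) * ?D w"
      by (simp add: gram_diff_self gram_scale m)
    have "gram ip (k (fst w)) (k (snd w)) / cmod h - gram ip (k (fst w)) (kd z) =
        (gram ip (k (fst w)) (k (snd w)) - cmod h * gram ip (k (fst w)) (kd z)) / cmod h"
      using h by (simp add: diff_divide_distrib)
    hence "\<bar>gram ip (k (fst w)) (k (snd w)) / cmod h - gram ip (k (fst w)) (kd z)\<bar> \<le> nrm (k (fst w)) * ?D w / cmod h"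
      using divide_right_mono[OF 1, of "cmod h"] h by simp
    \<comment> \<open>The arguments are exchanged because \<open>gram_diff\<close> varies the second
      one.\<close>
    moreover have "\<bar>gram ip (kd z) (k (fst w)) - gram ip (kd z) (k z)\<bar> \<le> nrm (kd z) * nrm (\<lambda>x. k (fst w) x - k z x)"
      by (rule order_trans[OF gram_diff gram_le]) (intro diff_mem m)+
    ultimately show ?case
      unfolding h_def by (simp add: gram_commute[OF m(3)] m)
  qed
  have "((\<lambda>w. nrm (k (fst w)) * (?D w / cmod (snd w - fst w)) + nrm (kd z) * nrm (\<lambda>x. k (fst w) x - k z x)) \<longlongrightarrow>
    nrm (k z) * 0 + nrm (kd z) * 0) (offdiag z)"
    by (intro tendsto_intros strict_kd_offdiag kernel_lim_offdiag tendsto_nrm z kernel_mem)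
  thus "((\<lambda>w. nrm (k (fst w)) * (?D w / cmod (snd w - fst w)) + nrm (kd z) * nrm (\<lambda>x. k (fst w) x - k z x)) \<longlongrightarrow> 0)
      (offdiag z)"
    by simp
qed

text \<open>\<open>\<delta>\<close> is the sine and the quotient below the tangent of the Fubini-Study distance, so both estimates
  pin that distance down to first order.\<close>

lemma dist_offdiag:
  assumes z: "z \<in> X"
  shows "((\<lambda>w. delta ip k (fst w) (snd w) / cmod (snd w - fst w)) \<longlongrightarrow> dens z) (offdiag z)"
    and "((\<lambda>w. gram ip (k (fst w)) (k (snd w)) / cmod (ip (k (fst w)) (k (snd w))) / cmod (snd w - fst w)) \<longlongrightarrow> dens z)
      (offdiag z)"
    and "\<forall>\<^sub>F w in offdiag z. ip (k (fst w)) (k (snd w)) \<noteq> 0"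
proof -
  note L = kernel_lim_offdiag[OF z]
  have n: "((\<lambda>w. nrm (k (fst w)) * nrm (k (snd w))) \<longlongrightarrow> nrm (k z) * nrm (k z)) (offdiag z)"
    by (intro tendsto_intros tendsto_nrm L kernel_mem z)
  have "((\<lambda>w. gram ip (k (fst w)) (k (snd w)) / cmod (snd w - fst w) / (nrm (k (fst w)) * nrm (k (snd w)))) \<longlongrightarrow>
     gram ip (k z) (kd z) / (nrm (k z) * nrm (k z))) (offdiag z)"
    using nrm_kernel_pos[OF z] by (intro tendsto_divide gram_offdiag z n) simp
  moreover have "\<forall>\<^sub>F w in offdiag z. gram ip (k (fst w)) (k (snd w)) / cmod (snd w - fst w) / (nrm (k (fst w)) * nrm (k (snd w)))
      = delta ip k (fst w) (snd w) / cmod (snd w - fst w)"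
    using L(3,4) by eventually_elim (simp add: delta_gram)
  ultimately show "((\<lambda>w. delta ip k (fst w) (snd w) / cmod (snd w - fst w)) \<longlongrightarrow> dens z) (offdiag z)"
    unfolding dens_def power2_eq_square by (rule Lim_transform_eventually)
  have i: "((\<lambda>w. ip (k (fst w)) (k (snd w))) \<longlongrightarrow> ip (k z) (k z)) (offdiag z)"
    by (intro tendsto_ip L kernel_mem z)
  have zz: "ip (k z) (k z) \<noteq> 0" "cmod (ip (k z) (k z)) = (nrm (k z))\<^sup>2"
    using nrm_kernel_pos[OF z] by (simp_all add: ip_self kernel_mem z norm_power)
  show "\<forall>\<^sub>F w in offdiag z. ip (k (fst w)) (k (snd w)) \<noteq> 0"
    using tendsto_imp_eventually_ne[OF i zz(1)] .
  have "((\<lambda>w. gram ip (k (fst w)) (k (snd w)) / cmod (snd w - fst w) / cmod (ip (k (fst w)) (k (snd w)))) \<longlongrightarrow>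
     gram ip (k z) (kd z) / cmod (ip (k z) (k z))) (offdiag z)"
    using zz(1) by (intro tendsto_divide gram_offdiag z tendsto_norm i) simp
  thus "((\<lambda>w. gram ip (k (fst w)) (k (snd w)) / cmod (ip (k (fst w)) (k (snd w))) / cmod (snd w - fst w)) \<longlongrightarrow> dens z)
      (offdiag z)"
    unfolding dens_def zz(2) by (simp add: mult.commute)
qed

lemma delta_self: "delta ip k p p = 0" if "p \<in> X"
  using angle_bounds(4)[OF that that] angle_self[OF that] by simp

text \<open>The angle is bounded from above only; \<delta>, being its sine, bounds it from
  below.\<close>

lemma local_distances:
  assumes z: "z \<in> X" and e: "0 < e"
  obtains r where "0 < r" "ball z r \<subseteq> X"
    "\<And>p q. p \<in> ball z r \<Longrightarrow> q \<in> ball z r \<Longrightarrow> \<bar>delta ip k p q - dens z * cmod (q - p)\<bar> \<le> e * cmod (q - p)"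
    "\<And>p q. p \<in> ball z r \<Longrightarrow> q \<in> ball z r \<Longrightarrow> angle p q \<le> (dens z + e) * cmod (q - p)"
proof -
  have ne: "\<forall>\<^sub>F w in offdiag z. fst w \<noteq> snd w"
    by (simp add: offdiag_def eventually_at_filter)
  have "\<forall>\<^sub>F w in offdiag z. \<bar>delta ip k (fst w) (snd w) / cmod (snd w - fst w) - dens z\<bar> < e"
    using tendstoD[OF dist_offdiag(1)[OF z] e] by (simp add: dist_real_def)
  moreover have "\<forall>\<^sub>F w in offdiag z.
      \<bar>gram ip (k (fst w)) (k (snd w)) / cmod (ip (k (fst w)) (k (snd w))) / cmod (snd w - fst w) - dens z\<bar> < e"
    using tendstoD[OF dist_offdiag(2)[OF z] e] by (simp add: dist_real_def)
  ultimately have "\<forall>\<^sub>F w in offdiag z.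
      \<bar>delta ip k (fst w) (snd w) - dens z * cmod (snd w - fst w)\<bar> \<le> e * cmod (snd w - fst w) \<and>
      angle (fst w) (snd w) \<le> (dens z + e) * cmod (snd w - fst w)"
    using kernel_lim_offdiag(3,4)[OF z] dist_offdiag(3)[OF z] ne
  proof eventually_elim
    case (elim w)
    define h where "h = cmod (snd w - fst w)"
    have h: "0 < h" using elim by (simp add: h_def)
    have "delta ip k (fst w) (snd w) - dens z * h = (delta ip k (fst w) (snd w) / h - dens z) * h"
      using h by (simp add: algebra_simps)
    hence "\<bar>delta ip k (fst w) (snd w) - dens z * h\<bar> = \<bar>delta ip k (fst w) (snd w) / h - dens z\<bar> * h"
      using h by (simp add: abs_mult)
    also have "\<dots> \<le> e * h"
      using elim(1) h unfolding h_def[symmetric] by (intro mult_right_mono) auto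
    finally have 1: "\<bar>delta ip k (fst w) (snd w) - dens z * h\<bar> \<le> e * h" .
    have "gram ip (k (fst w)) (k (snd w)) / cmod (ip (k (fst w)) (k (snd w))) / h \<le> dens z + e"
      using elim(2) unfolding h_def[symmetric] by linarith
    hence "gram ip (k (fst w)) (k (snd w)) / cmod (ip (k (fst w)) (k (snd w))) \<le> (dens z + e) * h"
      using h by (simp only: pos_divide_le_eq)
    hence "angle (fst w) (snd w) \<le> (dens z + e) * h"
      using angle_le_gram[OF elim(3,4,5)] by linarith
    thus ?case
      using 1 by (simp add: h_def)
  qed
  then obtain r where r: "r > 0" "\<And>p q. p \<in> ball z r \<Longrightarrow> q \<in> ball z r \<Longrightarrow> p \<noteq> q \<Longrightarrow>
      \<bar>delta ip k p q - dens z * cmod (q - p)\<bar> \<le> e * cmod (q - p) \<and> angle p q \<le> (dens z + e) * cmod (q - p)"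
    unfolding eventually_offdiag[of "\<lambda>p q. \<bar>delta ip k p q - dens z * cmod (q - p)\<bar> \<le> e * cmod (q - p) \<and>
      angle p q \<le> (dens z + e) * cmod (q - p)"] by blast
  obtain r' where r': "r' > 0" "ball z r' \<subseteq> X"
    using open_X z open_contains_ball by blast
  show ?thesis
  proof (rule that[of "min r r'"])
    show "ball z (min r r') \<subseteq> X" using r'(2) by auto
    fix p q assume pq: "p \<in> ball z (min r r')" "q \<in> ball z (min r r')"
    hence "p \<in> X" using r'(2) by auto
    thus "\<bar>delta ip k p q - dens z * cmod (q - p)\<bar> \<le> e * cmod (q - p)" "angle p q \<le> (dens z + e) * cmod (q - p)"
      using r(2)[of p q] pq delta_self angle_self by (cases "p = q"; simp)+
  qed (use r r' in auto)
qed

text \<open>A consequence of strictness: near z all quotients of pairs are close to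
  \<open>dens z\<close>, and \<open>dens p\<close> is a limit of such quotients.\<close>

lemma dens_continuous: "continuous_on X dens"
proof -
  have "isCont dens z" if z: "z \<in> X" for z
    unfolding continuous_at_eps_delta
  proof (intro allI impI)
    fix e :: real assume e: "0 < e"
    obtain r where r: "0 < r" "ball z r \<subseteq> X"
      "\<And>p q. p \<in> ball z r \<Longrightarrow> q \<in> ball z r \<Longrightarrow> \<bar>delta ip k p q - dens z * cmod (q - p)\<bar> \<le> e / 2 * cmod (q - p)"
      using local_distances[OF z half_gt_zero[OF e]] by metis
    have "dist (dens p) (dens z) < e" if p: "dist p z < r" for p
    proof -
      have pb: "p \<in> ball z r" using p by (simp add: dist_commute)
      have "((\<lambda>w. \<bar>delta ip k (fst w) (snd w) / cmod (snd w - fst w) - dens z\<bar>) \<longlongrightarrow> \<bar>dens p - dens z\<bar>) (offdiag p)"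
        using pb r(2) by (intro tendsto_intros dist_offdiag) auto
      moreover have "\<forall>\<^sub>F w in offdiag p. \<bar>delta ip k (fst w) (snd w) / cmod (snd w - fst w) - dens z\<bar> \<le> e / 2"
      proof -
        obtain s where s: "s > 0" "ball p s \<subseteq> ball z r"
          using pb open_ball open_contains_ball by blast
        have "\<bar>delta ip k p' q' / cmod (q' - p') - dens z\<bar> \<le> e / 2"
          if "p' \<in> ball p s" "q' \<in> ball p s" "p' \<noteq> q'" for p' q'
        proof -
          have h: "0 < cmod (q' - p')" using that by simp
          have "delta ip k p' q' / cmod (q' - p') - dens z = (delta ip k p' q' - dens z * cmod (q' - p')) / cmod (q' - p')"
            using h by (simp add: diff_divide_distrib)
          moreover have "\<bar>delta ip k p' q' - dens z * cmod (q' - p')\<bar> \<le> e / 2 * cmod (q' - p')"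
            using r(3) s(2) that by blast
          ultimately show ?thesis
            using h by (simp add: divide_le_eq)
        qed
        thus ?thesis
          using eventually_offdiag[of "\<lambda>p' q'. \<bar>delta ip k p' q' / cmod (q' - p') - dens z\<bar> \<le> e / 2" p] s(1) by blast
      qed
      ultimately have "\<bar>dens p - dens z\<bar> \<le> e / 2"
        using tendsto_upperbound offdiag_nontrivial by blast
      thus ?thesis using e by (simp add: dist_real_def)
    qed
    thus "\<exists>d>0. \<forall>x'. dist x' z < d \<longrightarrow> dist (dens x') (dens z) < e"
      using r(1) by blast
  qed
  thus ?thesis
    by (simp add: continuous_at_imp_continuous_on)
qed

section \<open>The Laplacian of the kernel\<close>

text \<open>The product rule along a line. Directional derivatives are used because the pairing of
  two antiholomorphic maps is neither holomorphic nor antiholomorphic.\<close>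

lemma ip_path_derivative:
  fixes v z :: complex
  assumes s\<phi>: "strict_antiderivative \<phi> \<phi>' z" and mem\<phi>: "\<And>z. z \<in> X \<Longrightarrow> \<phi> z \<in> H" and \<phi>': "\<phi>' \<in> H"
    and s\<eta>: "strict_antiderivative \<eta> \<eta>' z" and mem\<eta>: "\<And>z. z \<in> X \<Longrightarrow> \<eta> z \<in> H" and \<eta>': "\<eta>' \<in> H"
    and z: "z \<in> X"
  shows "((\<lambda>t. ip (\<phi> (z + of_real t * v)) (\<eta> (z + of_real t * v))) has_vector_derivative
    cnj v * ip \<phi>' (\<eta> z) + v * ip (\<phi> z) \<eta>') (at 0)"
  unfolding has_vector_derivative_def has_derivative_at
proof (intro conjI bounded_linear_scaleR_left)
  let ?p = "\<lambda>t::real. z + of_real t * v"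
  let ?c = "cnj v * ip \<phi>' (\<eta> z) + v * ip (\<phi> z) \<eta>'"
  let ?A = "\<lambda>t x. \<phi> (?p t) x - \<phi> z x - cnj (of_real t * v) * \<phi>' x"
  let ?B = "\<lambda>t x. \<eta> (?p t) x - \<eta> z x - cnj (of_real t * v) * \<eta>' x"
  have lim_p: "filterlim ?p (nhds z) (at 0)"
    by (rule tendsto_eq_intros refl)+ simp
  have near: "\<forall>\<^sub>F t in at (0::real). t \<noteq> 0" "\<forall>\<^sub>F t in at (0::real). ?p t \<in> X"
    using filterlim_iff[THEN iffD1, OF lim_p] eventually_X[OF z] by (auto simp: eventually_at_filter)
  have \<eta>_mem: "\<forall>\<^sub>F t in at (0::real). \<eta> (?p t) \<in> H"
    using near(2) by eventually_elim (rule mem\<eta>)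
  have \<eta>_lim: "((\<lambda>t. nrm (\<lambda>x. \<eta> (?p t) x - \<eta> z x)) \<longlongrightarrow> 0) (at 0)"
    by (rule filterlim_compose[OF strict_antiderivative_continuous[OF s\<eta> mem\<eta> \<eta>'] lim_p])
  let ?R = "\<lambda>t. nrm (?A t) / \<bar>t\<bar> * nrm (\<eta> (?p t)) + cmod v * (nrm \<phi>' * nrm (\<lambda>x. \<eta> (?p t) x - \<eta> z x))
      + nrm (\<phi> z) * (nrm (?B t) / \<bar>t\<bar>)"
  show "(\<lambda>h. norm (ip (\<phi> (?p (0 + h))) (\<eta> (?p (0 + h))) - ip (\<phi> (?p 0)) (\<eta> (?p 0)) - h *\<^sub>R ?c) / norm h) \<midarrow>0\<rightarrow> 0"
  proof (rule Lim_null_comparison)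
    have "(?R \<longlongrightarrow> 0 * nrm (\<eta> z) + cmod v * (nrm \<phi>' * 0) + nrm (\<phi> z) * 0) (at 0)"
      by (intro tendsto_intros strict_antiderivative_along[OF s\<phi> mem\<phi> \<phi>'] strict_antiderivative_along[OF s\<eta> mem\<eta> \<eta>']
        tendsto_nrm \<eta>_lim \<eta>_mem mem\<eta> z)
    thus "(?R \<longlongrightarrow> 0) (at 0)"
      by simp
    show "\<forall>\<^sub>F h in at 0. norm (norm (ip (\<phi> (?p (0 + h))) (\<eta> (?p (0 + h))) - ip (\<phi> (?p 0)) (\<eta> (?p 0)) - h *\<^sub>R ?c) / norm h) \<le> ?R h"
      using near
    proof eventually_elim
      case (elim t)
      note m = mem\<phi>[OF elim(2)] mem\<phi>[OF z] mem\<eta>[OF elim(2)] mem\<eta>[OF z]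
      define s where "s = of_real t * v"
      have s: "cmod s = \<bar>t\<bar> * cmod v" by (simp add: s_def norm_mult)
      have tc: "t *\<^sub>R ?c = cnj s * ip \<phi>' (\<eta> z) + s * ip (\<phi> z) \<eta>'"
        by (simp add: s_def scaleR_conv_of_real algebra_simps)
      have A: "ip (?A t) (\<eta> (?p t)) = ip (\<phi> (?p t)) (\<eta> (?p t)) - ip (\<phi> z) (\<eta> (?p t)) - cnj s * ip \<phi>' (\<eta> (?p t))"
        unfolding s_def by (simp only: ip_diff diff_mem scale_mem m \<phi>' ip_scale)
      have B: "ip (\<phi> z) (?B t) = ip (\<phi> z) (\<eta> (?p t)) - ip (\<phi> z) (\<eta> z) - s * ip (\<phi> z) \<eta>'"
        unfolding s_def by (simp only: ip_diff_right diff_mem scale_mem m \<eta>' ip_scale_right complex_cnj_cnj)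
      have C: "ip \<phi>' (\<lambda>x. \<eta> (?p t) x - \<eta> z x) = ip \<phi>' (\<eta> (?p t)) - ip \<phi>' (\<eta> z)"
        by (simp only: ip_diff_right m \<phi>')
      \<comment> \<open>Two remainders of first-order expansions, and a cross term that is small
        because \<open>\<eta>\<close> is continuous.\<close>
      have eq: "ip (\<phi> (?p t)) (\<eta> (?p t)) - ip (\<phi> z) (\<eta> z) - t *\<^sub>R ?c =
          ip (?A t) (\<eta> (?p t)) + cnj s * ip \<phi>' (\<lambda>x. \<eta> (?p t) x - \<eta> z x) + ip (\<phi> z) (?B t)"
        unfolding tc A B C by (simp add: algebra_simps)
      have "cmod (ip (\<phi> (?p t)) (\<eta> (?p t)) - ip (\<phi> z) (\<eta> z) - t *\<^sub>R ?c) \<le> cmod (ip (?A t) (\<eta> (?p t))) + cmod (cnj s * ip \<phi>' (\<lambda>x. \<eta> (?p t) x - \<eta> z x))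
          + cmod (ip (\<phi> z) (?B t))"
        unfolding eq by (rule order_trans[OF norm_triangle_ineq add_mono[OF norm_triangle_ineq order_refl]])
      also have "\<dots> \<le> nrm (?A t) * nrm (\<eta> (?p t)) + cmod s * (nrm \<phi>' * nrm (\<lambda>x. \<eta> (?p t) x - \<eta> z x))
          + nrm (\<phi> z) * nrm (?B t)"
        unfolding norm_mult complex_mod_cnj
        by (intro add_mono mult_left_mono norm_ge_zero cauchy_schwarz diff_mem scale_mem m \<phi>' \<eta>')
      also have "\<dots> = ?R t * \<bar>t\<bar>"
        using elim(1) unfolding s by (simp add: distrib_right)
      finally have "cmod (ip (\<phi> (?p t)) (\<eta> (?p t)) - ip (\<phi> z) (\<eta> z) - t *\<^sub>R ?c) / \<bar>t\<bar> \<le> ?R t"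
        using elim(1) by (simp only: pos_divide_le_eq zero_less_abs_iff simp_thms)
      thus ?case by simp
    qed
  qed
qed

lemma path_transform:
  assumes z: "z \<in> X" and d: "((\<lambda>t. f (z + of_real t * v)) has_vector_derivative D) (at 0)"
    and eq: "\<And>p. p \<in> X \<Longrightarrow> f p = g p"
  shows "((\<lambda>t. g (z + of_real t * v)) has_vector_derivative D) (at 0)"
proof (rule has_vector_derivative_transform_within_open[OF d])
  show "open ((\<lambda>t. z + of_real t * v) -` X)"
    by (intro open_vimage open_X continuous_intros)
qed (use z eq in auto)

lemma Re_kernel_diagonal: "Re (k p p) = (nrm (k p))\<^sup>2" if "p \<in> X"
  using reproducing[OF kernel_mem[OF that] that] ip_self[OF kernel_mem[OF that]] by (metis Re_complex_of_real)

text \<open>The logarithmic derivative of \<open>ip (k z) (k z)\<close>. Only the first slot depends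
  on the conjugate variable; the factor 2 stems from the normalization of
  \<open>d_dzbar\<close>.\<close>

lemma d_dzbar_log_kernel:
  assumes z: "z \<in> X"
  shows "d_dzbar (\<lambda>w. of_real (ln (Re (k w w)))) z = 2 * ip (kd z) (k z) / ip (k z) (k z)"
proof -
  let ?u = "\<lambda>w. complex_of_real (ln (Re (k w w)))"
  define a where "a = ip (kd z) (k z)"
  define N where "N = (nrm (k z))\<^sup>2"
  have N: "0 < N" using nrm_kernel_pos[OF z] by (simp add: N_def)
  have "((\<lambda>t. ?u (z + of_real t * v)) has_vector_derivative of_real (2 * Re (cnj v * a) / N)) (at 0)" for v
  proof (rule path_transform[OF z])
    have "((\<lambda>t. ip (k (z + of_real t * v)) (k (z + of_real t * v))) has_vector_derivative
        cnj v * a + v * ip (k z) (kd z)) (at 0)"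
      unfolding a_def by (intro ip_path_derivative strict_kd z kernel_mem kd_mem)
    hence "((\<lambda>t. Re (ip (k (z + of_real t * v)) (k (z + of_real t * v)))) has_vector_derivative
        Re (cnj v * a + v * ip (k z) (kd z))) (at 0)"
      by (rule bounded_linear.has_vector_derivative[OF bounded_linear_Re])
    moreover have "Re (cnj v * a + v * ip (k z) (kd z)) = 2 * Re (cnj v * a)"
      using ip_cnj[OF kd_mem[OF z] kernel_mem[OF z]] by (simp add: a_def)
    ultimately have "((\<lambda>t. Re (ip (k (z + of_real t * v)) (k (z + of_real t * v)))) has_real_derivative
        2 * Re (cnj v * a)) (at 0)"
      by (simp only: has_real_derivative_iff_has_vector_derivative)
    moreover have "Re (ip (k (z + of_real 0 * v)) (k (z + of_real 0 * v))) = N"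
      by (simp add: N_def ip_self kernel_mem z)
    ultimately have "((\<lambda>t. ln (Re (ip (k (z + of_real t * v)) (k (z + of_real t * v))))) has_real_derivative
        1 / N * (2 * Re (cnj v * a))) (at 0)"
      using DERIV_ln_divide[OF N] by (intro DERIV_chain2[of ln "1 / N"]) simp_all
    hence "((\<lambda>t. ln (Re (ip (k (z + of_real t * v)) (k (z + of_real t * v))))) has_real_derivative
        2 * Re (cnj v * a) / N) (at 0)"
      by simp
    thus "((\<lambda>t. of_real (ln (Re (ip (k (z + of_real t * v)) (k (z + of_real t * v)))))) has_vector_derivative
       of_real (2 * Re (cnj v * a) / N)) (at 0)"
      unfolding has_real_derivative_iff_has_vector_derivative
      by (rule bounded_linear.has_vector_derivative[OF bounded_linear_of_real])
    show "of_real (ln (Re (ip (k p) (k p)))) = of_real (ln (Re (k p p)))" if "p \<in> X" for p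
      using reproducing[OF kernel_mem[OF that] that] by simp
  qed
  \<comment> \<open>The directions 1 and \<i> yield the real and the imaginary part of a.\<close>
  from vector_derivative_at[OF this[of 1]] vector_derivative_at[OF this[of \<i>]]
  have "partial_x ?u z = of_real (2 * Re a / N)" "partial_y ?u z = of_real (2 * Im a / N)"
    by (simp_all add: partial_x_def partial_y_def mult.commute)
  hence "d_dzbar ?u z = 2 * a / of_real N"
    using N by (simp add: d_dzbar_def complex_eq_iff)
  thus ?thesis
    by (simp add: a_def N_def ip_self kernel_mem z)
qed

text \<open>When the directions 1 and \<i> are combined, the terms with the second derivative of the
  kernel and with a^2 cancel. What remains is 4 (n N - |a|^2) / N^2, four times the squared density,
  with a factor 2 from each of the two operators.\<close>

lemma ds_BS_eq:
  assumes z: "z \<in> X"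
  shows "ds_BS k z v = 2 * dens z * cmod v"
proof -
  let ?g = "d_dzbar (\<lambda>w. of_real (ln (Re (k w w))))"
  obtain kdd where kdd: "\<And>z. z \<in> X \<Longrightarrow> kdd z \<in> H" "\<And>z. z \<in> X \<Longrightarrow> strict_antiderivative kd (kdd z) z"
    using weakly_holomorphic_has_antiderivative[OF kd_mem ip_kd_holomorphic] by (metis (no_types))
  define a b n where "a = ip (kd z) (k z)" "b = ip (kdd z) (k z)" "n = ip (kd z) (kd z)"
  note abn = this
  define N where "N = ip (k z) (k z)"
  have N: "N \<noteq> 0" using nrm_kernel_pos[OF z] by (simp add: N_def ip_self kernel_mem z)
  have cnj_a: "ip (k z) (kd z) = cnj a"
    using ip_cnj[OF kd_mem[OF z] kernel_mem[OF z]] by (simp add: abn)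
  have D: "((\<lambda>t. ?g (z + of_real t * v)) has_vector_derivative
      2 * ((cnj v * b + v * n) / N - a * (cnj v * a + v * cnj a) / N\<^sup>2)) (at 0)" for v
  proof (rule path_transform[OF z])
    let ?p = "\<lambda>t. z + of_real t * v"
    have 1: "((\<lambda>t. ip (kd (?p t)) (k (?p t))) has_vector_derivative cnj v * b + v * n) (at 0)"
      unfolding abn by (intro ip_path_derivative strict_kd kdd z kernel_mem kd_mem)
    have 2: "((\<lambda>t. ip (k (?p t)) (k (?p t))) has_vector_derivative cnj v * a + v * cnj a) (at 0)"
      unfolding cnj_a[symmetric] unfolding abn by (intro ip_path_derivative strict_kd z kernel_mem kd_mem)
    have "(inverse has_field_derivative - (inverse N)\<^sup>2) (at (ip (k (?p 0)) (k (?p 0))))"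
      using N by (auto intro!: derivative_eq_intros simp: N_def power2_eq_square)
    from has_vector_derivative_mult[OF 1 field_vector_diff_chain_at[OF 2 this]]
    have "((\<lambda>t. ip (kd (?p t)) (k (?p t)) * inverse (ip (k (?p t)) (k (?p t)))) has_vector_derivative
       a * ((cnj v * a + v * cnj a) * (- (inverse N)\<^sup>2)) + (cnj v * b + v * n) * inverse N) (at 0)"
      by (simp add: o_def abn N_def)
    from has_vector_derivative_mult_right[OF this, of 2]
    show "((\<lambda>t. 2 * (ip (kd (?p t)) (k (?p t)) * inverse (ip (k (?p t)) (k (?p t))))) has_vector_derivative
       2 * ((cnj v * b + v * n) / N - a * (cnj v * a + v * cnj a) / N\<^sup>2)) (at 0)"
      by (simp add: divide_inverse power_inverse algebra_simps)
    show "2 * (ip (kd p) (k p) * inverse (ip (k p) (k p))) = ?g p" if "p \<in> X" for p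
      using d_dzbar_log_kernel[OF that] by (simp add: divide_inverse)
  qed
  from vector_derivative_at[OF D[of 1]] vector_derivative_at[OF D[of \<i>]]
  have "partial_x ?g z = 2 * ((b + n) / N - a * (a + cnj a) / N\<^sup>2)"
    "partial_y ?g z = 2 * ((- \<i> * b + \<i> * n) / N - a * (- \<i> * a + \<i> * cnj a) / N\<^sup>2)"
    by (simp_all add: partial_x_def partial_y_def mult.commute)
  hence "d_dz ?g z = 4 * (n * N - a * cnj a) / N\<^sup>2"
    unfolding d_dz_def \<open>partial_x ?g z = _\<close> \<open>partial_y ?g z = _\<close>
    using N by (simp add: field_simps power2_eq_square)
  also have "\<dots> = of_real (4 * (dens z)\<^sup>2)"
    using gram_sq[OF kernel_mem[OF z] kd_mem[OF z]]
    unfolding dens_def power_divide N_def abn ip_self[OF kernel_mem[OF z]] ip_self[OF kd_mem[OF z]]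
    by (simp add: complex_norm_square[symmetric] mult.commute)
  finally have "Re (d_dz ?g z) = (2 * dens z)\<^sup>2"
    by (simp add: power_mult_distrib)
  thus ?thesis
    using dens_nonneg[OF z] by (simp add: ds_BS_def real_sqrt_mult)
qed

section \<open>Smooth curves\<close>

sublocale FS: conformal_metric X dens "ds_FS H ip k"
  by unfold_locales (auto simp: open_X connected_X dens_continuous dens_nonneg ds_FS_eq)

sublocale BS: conformal_metric X "\<lambda>z. 2 * dens z" "ds_BS k"
  by unfold_locales (auto simp: open_X connected_X dens_nonneg ds_BS_eq intro!: continuous_intros dens_continuous)

text \<open>Up to e (t - s), all quantities equal \<open>D * G * (t - s)\<close>, where D is the
  density at g x and G the speed at x.\<close>

lemma local_curve:
  assumes g: "c1_curve X a b g g'" and x: "x \<in> {a..b}" and e: "0 < e"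
  defines "f \<equiv> \<lambda>t. dens (g t) * cmod (g' t)"
  obtains d where "0 < d" "\<And>s t. a \<le> s \<Longrightarrow> s \<le> x \<Longrightarrow> x \<le> t \<Longrightarrow> t \<le> b \<Longrightarrow> t - s < d \<Longrightarrow>
    angle (g s) (g t) \<le> integral {s..t} f + e * (t - s) \<and> integral {s..t} f - e * (t - s) \<le> delta ip k (g s) (g t)"
proof -
  define D where "D = dens (g x)"
  define G where "G = cmod (g' x)"
  have gX: "g x \<in> X" using g x unfolding c1_curve_def by blast
  have D: "0 \<le> D" using dens_nonneg[OF gX] by (simp add: D_def)
  have G: "0 \<le> G" by (simp add: G_def)
  \<comment> \<open>The errors come from the increment of g (D e1), from the first-order comparison
    (e3 times at most G + 1, thanks to e1 <= 1) and from the integral. Each is at most e/4 per unit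
    of the parameter.\<close>
  define e1 where "e1 = min 1 (e / 4 / (D + 1))"
  define e3 where "e3 = e / 4 / (G + 1)"
  have e1: "0 < e1" "e1 \<le> 1" "D * e1 \<le> e / 4"
  proof -
    show "0 < e1" "e1 \<le> 1" using D e by (auto simp: e1_def)
    have "D * e1 \<le> D * (e / 4 / (D + 1))"
      unfolding e1_def using D by (intro mult_left_mono) auto
    also have "\<dots> \<le> e / 4" using D e by (simp add: field_simps)
    finally show "D * e1 \<le> e / 4" .
  qed
  have e3: "0 < e3" "e3 * (G + 1) = e / 4"
  proof -
    show "0 < e3" using G e by (simp add: e3_def)
    show "e3 * (G + 1) = e / 4"
      by (rule nonzero_eq_divide_eq[THEN iffD1, OF _ e3_def]) (use G in simp)
  qed
  obtain r where r: "0 < r" "ball (g x) r \<subseteq> X"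
    "\<And>p q. p \<in> ball (g x) r \<Longrightarrow> q \<in> ball (g x) r \<Longrightarrow> \<bar>delta ip k p q - D * cmod (q - p)\<bar> \<le> e3 * cmod (q - p)"
    "\<And>p q. p \<in> ball (g x) r \<Longrightarrow> q \<in> ball (g x) r \<Longrightarrow> angle p q \<le> (D + e3) * cmod (q - p)"
    using local_distances[OF gX e3(1)] unfolding D_def by blast
  obtain d1 where d1: "0 < d1" "\<And>t. t \<in> {a..b} \<Longrightarrow> dist t x < d1 \<Longrightarrow> dist (g t) (g x) < r"
    using c1_curve_continuous[OF g] x r(1) unfolding continuous_on_iff by metis
  obtain d2 where d2: "0 < d2" "\<And>s t. a \<le> s \<Longrightarrow> s \<le> x \<Longrightarrow> x \<le> t \<Longrightarrow> t \<le> b \<Longrightarrow> t - s < d2 \<Longrightarrow>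
    cmod (g t - g s - (t - s) *\<^sub>R g' x) \<le> e1 * (t - s)"
    using c1_curve_strict_difference[OF g x e1(1)] by blast
  have cf: "continuous_on {a..b} f"
    unfolding f_def by (rule FS.integrand_continuous[OF g])
  obtain d3 where d3: "0 < d3" "\<And>s t. a \<le> s \<Longrightarrow> s \<le> x \<Longrightarrow> x \<le> t \<Longrightarrow> t \<le> b \<Longrightarrow> t - s < d3 \<Longrightarrow>
    \<bar>integral {s..t} f - (t - s) * f x\<bar> \<le> e / 4 * (t - s)"
    using integral_near_const[OF cf x, of "e / 4"] e by auto
  show ?thesis
  proof (rule that[of "min d1 (min d2 d3)"])
    show "0 < min d1 (min d2 d3)" using d1 d2 d3 by simp
    fix s t assume st: "a \<le> s" "s \<le> x" "x \<le> t" "t \<le> b" "t - s < min d1 (min d2 d3)"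
    define h where "h = t - s"
    define w where "w = cmod (g t - g s)"
    have h: "0 \<le> h" using st by (simp add: h_def)
    have b: "g s \<in> ball (g x) r" "g t \<in> ball (g x) r"
      using d1(2)[of s] d1(2)[of t] st by (auto simp: dist_commute dist_real_def)
    have "\<bar>w - cmod (h *\<^sub>R g' x)\<bar> \<le> e1 * h"
      using d2(2)[OF st(1-4)] st(5) norm_triangle_ineq3[of "g t - g s" "h *\<^sub>R g' x"] by (simp add: w_def h_def)
    hence "\<bar>w - h * G\<bar> \<le> e1 * h"
      using h by (simp add: G_def)
    hence w: "w \<le> (G + e1) * h" "(G - e1) * h \<le> w"
      unfolding left_diff_distrib distrib_right by (simp_all add: mult.commute abs_le_iff)
    have wG: "e3 * w \<le> e / 4 * h"
    proof -
      have "e3 * w \<le> e3 * ((G + 1) * h)"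
        using w(1) mult_right_mono[OF e1(2) h] e3 by (intro mult_left_mono) (auto simp: distrib_right)
      also have "\<dots> = e / 4 * h"
        using e3(2) by (simp only: mult.assoc[symmetric])
      finally show ?thesis .
    qed
    have Dw: "D * w \<le> D * G * h + e / 4 * h" "D * G * h - e / 4 * h \<le> D * w"
      using mult_left_mono[OF w(1) D] mult_left_mono[OF w(2) D] mult_right_mono[OF e1(3) h]
      by (simp_all add: algebra_simps)
    have int: "\<bar>integral {s..t} f - h * (D * G)\<bar> \<le> e / 4 * h"
      using d3(2)[OF st(1-4)] st(5) by (simp add: h_def f_def D_def G_def)
    have eh: "0 \<le> e * h" using e h by simp
    have int': "integral {s..t} f \<le> D * G * h + e * h / 4" "D * G * h - e * h / 4 \<le> integral {s..t} f"
      using int[unfolded abs_le_iff] by (simp_all add: algebra_simps)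
    note bounds = wG[unfolded times_divide_eq_left] Dw[unfolded times_divide_eq_left] int' eh
    have "angle (g s) (g t) \<le> D * w + e3 * w"
      using r(4)[OF b] by (simp add: w_def distrib_right)
    hence "angle (g s) (g t) \<le> integral {s..t} f + e * h"
      using bounds by linarith
    moreover have "D * w - e3 * w \<le> delta ip k (g s) (g t)"
      using r(3)[OF b] unfolding w_def abs_le_iff by linarith
    hence "integral {s..t} f - e * h \<le> delta ip k (g s) (g t)"
      using bounds by linarith
    ultimately show "angle (g s) (g t) \<le> integral {s..t} f + e * (t - s) \<and>
        integral {s..t} f - e * (t - s) \<le> delta ip k (g s) (g t)"
      by (simp add: h_def)
  qed
qed

text \<open>Bisection with the error e (t - s), which is additive over adjacent intervals; the
  triangle inequality joins two halves.\<close>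

lemma angle_le_rlen:
  assumes \<gamma>: "smooth_curve_in X a b \<gamma>"
  shows "angle (\<gamma> a) (\<gamma> b) \<le> FS.rlen a b \<gamma>"
proof -
  note c1 = smooth_c1_curve[OF \<gamma>]
  define f where "f = (\<lambda>t. dens (\<gamma> t) * cmod (vector_derivative \<gamma> (at t within {a..b})))"
  have ab: "a < b" using \<gamma> by (simp add: smooth_curve_in_def)
  have \<gamma>X: "\<gamma> t \<in> X" if "t \<in> {a..b}" for t
    using c1 that unfolding c1_curve_def by blast
  have fi: "f integrable_on {s..t}" if "a \<le> s" "t \<le> b" for s t
    unfolding f_def using that
    by (intro integrable_continuous_real continuous_on_subset[OF FS.integrand_continuous[OF c1]]) auto
  have "angle (\<gamma> a) (\<gamma> b) \<le> integral {a..b} f + e * (b - a)" if e: "0 < e" for e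
  proof -
    have "a \<le> a \<and> b \<le> b \<longrightarrow> angle (\<gamma> a) (\<gamma> b) \<le> integral {a..b} f + e * (b - a)"
    proof (induction rule: Bolzano[OF less_imp_le[OF ab], where P = "\<lambda>s t. a \<le> s \<and> t \<le> b \<longrightarrow>
        angle (\<gamma> s) (\<gamma> t) \<le> integral {s..t} f + e * (t - s)"])
      case (1 s u t)
      show ?case
      proof
        assume st: "a \<le> s \<and> t \<le> b"
        have "angle (\<gamma> s) (\<gamma> t) \<le> angle (\<gamma> s) (\<gamma> u) + angle (\<gamma> u) (\<gamma> t)"
          using st 1 by (intro angle_triangle \<gamma>X) auto
        moreover have "integral {s..t} f = integral {s..u} f + integral {u..t} f"
          using Henstock_Kurzweil_Integration.integral_combine[OF 1(3,4) fi] st by simp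
        ultimately show "angle (\<gamma> s) (\<gamma> t) \<le> integral {s..t} f + e * (t - s)"
          using 1 st by (simp add: algebra_simps)
      qed
    next
      case (2 x)
      hence "x \<in> {a..b}" by simp
      from local_curve[OF c1 this e] obtain d where d: "0 < d" "\<And>s t. a \<le> s \<Longrightarrow> s \<le> x \<Longrightarrow> x \<le> t \<Longrightarrow> t \<le> b \<Longrightarrow> t - s < d \<Longrightarrow>
          angle (\<gamma> s) (\<gamma> t) \<le> integral {s..t} f + e * (t - s) \<and>
          integral {s..t} f - e * (t - s) \<le> delta ip k (\<gamma> s) (\<gamma> t)"
        unfolding f_def by blast
      show ?case
        by (intro exI[of _ d] conjI d(1) allI impI) (use d(2) in simp)
    qed
    thus ?thesis by simp
  qed
  \<comment> \<open>Both sides are negated because \<open>ereal_le_if_real_le\<close> treats errors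
    that are subtracted on the left.\<close>
  hence "ereal (- integral {a..b} f - e * (b - a)) \<le> ereal (- angle (\<gamma> a) (\<gamma> b))" if "0 < e" for e
    using that by force
  from ereal_le_if_real_le[OF this] show ?thesis
    using ab unfolding FS.rlen_eq[OF \<gamma>] FS.plen_def f_def by simp
qed

text \<open>The counterpart from below: superadditivity of \<open>curve_length\<close> takes the
  place of the triangle inequality.\<close>

lemma rlen_le_curve_length_delta:
  assumes \<gamma>: "smooth_curve_in X a b \<gamma>"
  shows "ereal (FS.rlen a b \<gamma>) \<le> curve_length (delta ip k) a b \<gamma>"
proof -
  note c1 = smooth_c1_curve[OF \<gamma>]
  define f where "f = (\<lambda>t. dens (\<gamma> t) * cmod (vector_derivative \<gamma> (at t within {a..b})))"
  have ab: "a < b" using \<gamma> by (simp add: smooth_curve_in_def)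
  have \<gamma>X: "\<gamma> t \<in> X" if "t \<in> {a..b}" for t
    using c1 that unfolding c1_curve_def by blast
  have fi: "f integrable_on {s..t}" if "a \<le> s" "t \<le> b" for s t
    unfolding f_def using that
    by (intro integrable_continuous_real continuous_on_subset[OF FS.integrand_continuous[OF c1]]) auto
  have "ereal (integral {a..b} f - e * (b - a)) \<le> curve_length (delta ip k) a b \<gamma>" if e: "0 < e" for e
  proof -
    have "a \<le> a \<and> b \<le> b \<longrightarrow> ereal (integral {a..b} f - e * (b - a)) \<le> curve_length (delta ip k) a b \<gamma>"
    proof (induction rule: Bolzano[OF less_imp_le[OF ab], where P = "\<lambda>s t. a \<le> s \<and> t \<le> b \<longrightarrow>
        ereal (integral {s..t} f - e * (t - s)) \<le> curve_length (delta ip k) s t \<gamma>"])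
      case (1 s u t)
      show ?case
      proof
        assume st: "a \<le> s \<and> t \<le> b"
        have "integral {s..t} f = integral {s..u} f + integral {u..t} f"
          using Henstock_Kurzweil_Integration.integral_combine[OF 1(3,4) fi] st by simp
        hence "ereal (integral {s..t} f - e * (t - s)) =
            ereal (integral {s..u} f - e * (u - s)) + ereal (integral {u..t} f - e * (t - u))"
          by (simp add: algebra_simps)
        also have "\<dots> \<le> curve_length (delta ip k) s u \<gamma> + curve_length (delta ip k) u t \<gamma>"
          using 1 st by (intro add_mono) auto
        also have "\<dots> \<le> curve_length (delta ip k) s t \<gamma>"
          using st 1 by (intro curve_length_superadditive delta_nonneg \<gamma>X) auto
        finally show "ereal (integral {s..t} f - e * (t - s)) \<le> curve_length (delta ip k) s t \<gamma>" .
      qed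
    next
      case (2 x)
      hence "x \<in> {a..b}" by simp
      from local_curve[OF c1 this e] obtain d where d: "0 < d" "\<And>s t. a \<le> s \<Longrightarrow> s \<le> x \<Longrightarrow> x \<le> t \<Longrightarrow> t \<le> b \<Longrightarrow> t - s < d \<Longrightarrow>
          angle (\<gamma> s) (\<gamma> t) \<le> integral {s..t} f + e * (t - s) \<and>
          integral {s..t} f - e * (t - s) \<le> delta ip k (\<gamma> s) (\<gamma> t)"
        unfolding f_def by blast
      show ?case
      proof (intro exI[of _ d] conjI d(1) allI impI)
        fix s t assume st: "s \<le> x \<and> x \<le> t \<and> t - s < d" "a \<le> s \<and> t \<le> b"
        show "ereal (integral {s..t} f - e * (t - s)) \<le> curve_length (delta ip k) s t \<gamma>"
        proof (cases "s = t")
          case True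
          thus ?thesis
            using curve_length_nonneg[of s t "delta ip k" \<gamma>] delta_nonneg \<gamma>X st by (simp add: zero_ereal_def)
        next
          case False
          have "ereal (integral {s..t} f - e * (t - s)) \<le> ereal (delta ip k (\<gamma> s) (\<gamma> t))"
            using d(2) st by simp
          also have "\<dots> \<le> curve_length (delta ip k) s t \<gamma>"
            using False st by (intro curve_length_ge_dist) simp
          finally show ?thesis .
        qed
      qed
    qed
    thus ?thesis by simp
  qed
  from ereal_le_if_real_le[OF this] show ?thesis
    using ab unfolding FS.rlen_eq[OF \<gamma>] FS.plen_def f_def by simp
qed

lemma angle_le_rdist:
  assumes "p \<in> X" "q \<in> X"
  shows "angle p q \<le> FS.rdist p q"
proof (rule field_le_epsilon)
  fix e :: real assume "0 < e"
  then obtain a b \<gamma> where "smooth_curve_in X a b \<gamma>" "\<gamma> a = p" "\<gamma> b = q" "FS.rlen a b \<gamma> < FS.rdist p q + e"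
    using FS.rdist_lessE[OF assms, of "FS.rdist p q + e"] by auto
  thus "angle p q \<le> FS.rdist p q + e"
    using angle_le_rlen by fastforce
qed

lemma distances_chain:
  assumes "p \<in> X" "q \<in> X"
  shows "delta ip k p q \<le> delta_hat ip k p q" "delta_hat ip k p q \<le> FS.rdist p q" "delta ip k p q \<le> FS.rdist p q"
  using delta_le_delta_hat[OF assms] delta_hat_le_angle[OF assms] angle_le_rdist[OF assms] by auto

text \<open>A squeeze: the smallest of the three lengths is at least \<open>rlen\<close> and the
  largest at most \<open>rlen\<close>.\<close>

lemma smooth_curve_lengths:
  assumes \<gamma>: "smooth_curve_in X a b \<gamma>"
  shows "curve_length (delta ip k) a b \<gamma> = ereal (FS.rlen a b \<gamma>)"
    "curve_length (delta_hat ip k) a b \<gamma> = ereal (FS.rlen a b \<gamma>)"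
    "curve_length FS.rdist a b \<gamma> = ereal (FS.rlen a b \<gamma>)"
proof -
  have \<gamma>X: "\<gamma> t \<in> X" if "t \<in> {a..b}" for t
    using \<gamma> that unfolding smooth_curve_in_def by blast
  have "curve_length (delta ip k) a b \<gamma> \<le> curve_length (delta_hat ip k) a b \<gamma>"
    "curve_length (delta_hat ip k) a b \<gamma> \<le> curve_length FS.rdist a b \<gamma>"
    by (intro curve_length_mono distances_chain \<gamma>X; assumption)+
  thus "curve_length (delta ip k) a b \<gamma> = ereal (FS.rlen a b \<gamma>)"
    "curve_length (delta_hat ip k) a b \<gamma> = ereal (FS.rlen a b \<gamma>)"
    "curve_length FS.rdist a b \<gamma> = ereal (FS.rlen a b \<gamma>)"
    using rlen_le_curve_length_delta[OF \<gamma>] FS.curve_length_rdist_le[OF \<gamma>] by auto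
qed

lemma rlen_BS:
  assumes \<gamma>: "smooth_curve_in X a b \<gamma>"
  shows "BS.rlen a b \<gamma> = 2 * FS.rlen a b \<gamma>"
  unfolding BS.rlen_eq[OF \<gamma>] BS.plen_def FS.rlen_eq[OF \<gamma>] FS.plen_def by (simp add: mult.assoc)

lemma rdist_BS:
  assumes "x \<in> X" "y \<in> X"
  shows "BS.rdist x y = 2 * FS.rdist x y"
proof (rule antisym)
  show "BS.rdist x y \<le> 2 * FS.rdist x y"
  proof (rule field_le_epsilon)
    fix e :: real assume e: "0 < e"
    obtain a b \<gamma> where "smooth_curve_in X a b \<gamma>" "\<gamma> a = x" "\<gamma> b = y" "FS.rlen a b \<gamma> < FS.rdist x y + e / 2"
      using FS.rdist_lessE[OF assms, of "FS.rdist x y + e / 2"] e by auto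
    thus "BS.rdist x y \<le> 2 * FS.rdist x y + e"
      using BS.rdist_le[of a b \<gamma>] rlen_BS[of a b \<gamma>] by simp
  qed
  show "2 * FS.rdist x y \<le> BS.rdist x y"
  proof (rule field_le_epsilon)
    fix e :: real assume e: "0 < e"
    obtain a b \<gamma> where "smooth_curve_in X a b \<gamma>" "\<gamma> a = x" "\<gamma> b = y" "BS.rlen a b \<gamma> < BS.rdist x y + e"
      using BS.rdist_lessE[OF assms, of "BS.rdist x y + e"] e by auto
    thus "2 * FS.rdist x y \<le> BS.rdist x y + e"
      using FS.rdist_le[of a b \<gamma>] rlen_BS[of a b \<gamma>] by simp
  qed
qed

section \<open>Continuous curves\<close>

text \<open>Equality in Cauchy-Schwarz makes w a multiple of u, so the two columns of this
  determinant are proportional.\<close>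

lemma gram_zero_wronskian:
  assumes "u \<in> H" "w \<in> H" "f \<in> H" "g \<in> H" and u: "u \<noteq> (\<lambda>z. 0)" and gram: "gram ip u w = 0"
  shows "ip f u * ip g w - ip f w * ip g u = 0"
proof -
  define K where "K = complex_of_real ((nrm u)\<^sup>2)"
  have K: "K \<noteq> 0" using nrm_eq_0[OF assms(1)] u by (simp add: K_def)
  have 0: "ip v (pcomp u w) = 0" if "v \<in> H" for v
  proof -
    have "cmod (ip v (pcomp u w)) \<le> nrm v * nrm (pcomp u w)"
      by (rule cauchy_schwarz[OF pcomp_mem[OF assms(1,2)] that])
    thus ?thesis using nrm_pcomp[OF assms(1,2)] gram by simp
  qed
  have "K * ip v w = cnj (ip w u) * ip v u" if v: "v \<in> H" for v
  proof -
    have "ip v (pcomp u w) = cnj K * ip v w - cnj (ip w u) * ip v u"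
      unfolding pcomp_def ip_diff_right[OF scale_mem[OF assms(2)] scale_mem[OF assms(1)] v]
        ip_scale_right[OF assms(2) v] ip_scale_right[OF assms(1) v] K_def ..
    thus ?thesis using 0[OF v] by (simp add: K_def)
  qed
  hence w: "ip v w = cnj (ip w u) * ip v u / K" if "v \<in> H" for v
    using that K by (simp add: field_simps)
  show ?thesis
    unfolding w[OF assms(3)] w[OF assms(4)] by simp
qed

text \<open>Where the density vanishes, so does the Wronskian of any two members of \<open>H\<close>.\<close>

lemma dens_zeros_isolated:
  assumes z1: "z1 \<in> X" "dens z1 \<noteq> 0" and z: "z \<in> X"
  obtains r where "0 < r" "ball z r \<subseteq> X" "\<And>w. w \<in> ball z r - {z} \<Longrightarrow> 0 < dens w"
proof -
  note m = kernel_mem[OF z1(1)] kd_mem[OF z1(1)]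
  \<comment> \<open>The Wronskian f g' - f' g of f = \<open>k z1\<close> and g =
    \<open>kd z1\<close>. This pair makes its value at z1 the Gram determinant there, which is not
    0.\<close>
  define W where "W w = ip (k z1) (k w) * ip (kd z1) (kd w) - ip (k z1) (kd w) * ip (kd z1) (k w)" for w
  have hol: "W holomorphic_on X"
    unfolding W_def by (intro holomorphic_intros ip_kernel_holomorphic ip_kd_holomorphic m)
  have "W z1 = of_real ((gram ip (k z1) (kd z1))\<^sup>2)"
  proof -
    have "W z1 = of_real ((nrm (k z1))\<^sup>2) * of_real ((nrm (kd z1))\<^sup>2) - cnj (ip (kd z1) (k z1)) * ip (kd z1) (k z1)"
      using ip_cnj[OF m(2,1)] by (simp add: W_def ip_self m)
    also have "\<dots> = of_real ((gram ip (k z1) (kd z1))\<^sup>2)"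
      unfolding gram_sq[OF m] using complex_norm_square[of "ip (kd z1) (k z1)"] by (simp add: mult.commute)
    finally show ?thesis .
  qed
  hence W1: "W z1 \<noteq> 0"
    using z1(2) by (simp add: dens_def)
  have pos: "0 < dens w" if w: "w \<in> X" "W w \<noteq> 0" for w
  proof -
    have "gram ip (k w) (kd w) \<noteq> 0"
      using gram_zero_wronskian[OF kernel_mem[OF w(1)] kd_mem[OF w(1)] m kernel_nonzero[OF w(1)]] w(2)
      by (auto simp: W_def)
    hence "dens w \<noteq> 0"
      using nrm_kernel_pos[OF w(1)] by (simp add: dens_def)
    thus ?thesis using dens_nonneg[OF w(1)] by simp
  qed
  show ?thesis
  proof (cases "W z = 0")
    case True
    obtain r where r: "0 < r" "ball z r \<subseteq> X" "\<And>w. w \<in> ball z r - {z} \<Longrightarrow> W w \<noteq> 0"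
      using isolated_zeros[OF hol open_X connected_X z True z1(1) W1] by blast
    show ?thesis
      by (rule that[OF r(1,2)], rule pos) (use r(2,3) in auto)
  next
    case False
    have "open (X \<inter> W -` (- {0}))"
      by (intro continuous_open_preimage holomorphic_on_imp_continuous_on hol open_X) auto
    then obtain r where "0 < r" "ball z r \<subseteq> X \<inter> W -` (- {0})"
      using z False unfolding open_contains_ball by blast
    thus ?thesis using that[of r] pos by blast
  qed
qed

text \<open>On a curve of infinite Euclidean length, errors proportional to |q - p| add up to
  infinity, and none proportional to the parameter is available. Where the density is positive such
  errors are absorbed into a factor 1 - e, which bisection preserves.\<close>

lemma rdist_le_curve_length_nondegenerate:
  assumes ab: "a \<le> b" and \<gamma>: "continuous_on {a..b} \<gamma>" "\<gamma> ` {a..b} \<subseteq> X"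
    and pos: "\<And>t. t \<in> {a..b} \<Longrightarrow> 0 < dens (\<gamma> t)"
  shows "ereal (FS.rdist (\<gamma> a) (\<gamma> b)) \<le> curve_length (delta ip k) a b \<gamma>"
proof -
  have \<gamma>X: "\<gamma> t \<in> X" if "t \<in> {a..b}" for t
    using \<gamma>(2) that by blast
  have len0: "0 \<le> curve_length (delta ip k) s t \<gamma>" if "a \<le> s" "s \<le> t" "t \<le> b" for s t
    using that by (intro curve_length_nonneg delta_nonneg \<gamma>X) auto
  have "ereal (FS.rdist (\<gamma> a) (\<gamma> b) - e * FS.rdist (\<gamma> a) (\<gamma> b)) \<le> curve_length (delta ip k) a b \<gamma>" if e: "0 < e" for e
  proof -
    have "a \<le> a \<and> b \<le> b \<longrightarrow> ereal ((1 - e) * FS.rdist (\<gamma> a) (\<gamma> b)) \<le> curve_length (delta ip k) a b \<gamma>"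
    proof (cases "e < 1")
      case e1: True
      show ?thesis
      proof (induction rule: Bolzano[OF ab, where P = "\<lambda>s t. a \<le> s \<and> t \<le> b \<longrightarrow>
          ereal ((1 - e) * FS.rdist (\<gamma> s) (\<gamma> t)) \<le> curve_length (delta ip k) s t \<gamma>"])
        case (1 s u t)
        show ?case
        proof
          assume st: "a \<le> s \<and> t \<le> b"
          have "(1 - e) * FS.rdist (\<gamma> s) (\<gamma> t) \<le> (1 - e) * (FS.rdist (\<gamma> s) (\<gamma> u) + FS.rdist (\<gamma> u) (\<gamma> t))"
            using st 1 e1 by (intro mult_left_mono FS.rdist_triangle \<gamma>X) auto
          hence "ereal ((1 - e) * FS.rdist (\<gamma> s) (\<gamma> t)) \<le>
              ereal ((1 - e) * FS.rdist (\<gamma> s) (\<gamma> u)) + ereal ((1 - e) * FS.rdist (\<gamma> u) (\<gamma> t))"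
            by (simp add: distrib_left)
          also have "\<dots> \<le> curve_length (delta ip k) s u \<gamma> + curve_length (delta ip k) u t \<gamma>"
            using 1 st by (intro add_mono) auto
          also have "\<dots> \<le> curve_length (delta ip k) s t \<gamma>"
            using st 1 by (intro curve_length_superadditive delta_nonneg \<gamma>X) auto
          finally show "ereal ((1 - e) * FS.rdist (\<gamma> s) (\<gamma> t)) \<le> curve_length (delta ip k) s t \<gamma>" .
        qed
      next
        case (2 x)
        hence x: "x \<in> {a..b}" by simp
        define D where "D = dens (\<gamma> x)"
        have D: "0 < D" using pos[OF x] by (simp add: D_def)
        \<comment> \<open>Since e D = 2 e', the product (1 - e)(D + e') equals D - e' - e e'; thus
          the upper bound for the restricted distance, shrunk by 1 - e, falls below the lower bound
          for \<delta>.\<close>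
        define e' where "e' = e * D / 2"
        have e': "0 < e'" using e D by (simp add: e'_def)
        obtain r where r: "0 < r" "ball (\<gamma> x) r \<subseteq> X"
          "\<And>p q. p \<in> ball (\<gamma> x) r \<Longrightarrow> q \<in> ball (\<gamma> x) r \<Longrightarrow> \<bar>delta ip k p q - D * cmod (q - p)\<bar> \<le> e' * cmod (q - p)"
          using local_distances[OF \<gamma>X[OF x] e'] unfolding D_def by metis
        obtain r' where r': "0 < r'" "\<And>w. w \<in> X \<Longrightarrow> dist w (\<gamma> x) < r' \<Longrightarrow> dist (dens w) D < e'"
          using dens_continuous \<gamma>X[OF x] e' unfolding continuous_on_iff D_def by metis
        define \<rho> where "\<rho> = min r r'"
        have \<rho>: "0 < \<rho>" "ball (\<gamma> x) \<rho> \<subseteq> X"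
          using r(1,2) r'(1) by (auto simp: \<rho>_def)
        have dens_le: "dens w \<le> D + e'" if "w \<in> ball (\<gamma> x) \<rho>" for w
        proof -
          have "dist w (\<gamma> x) < r'" using that by (simp add: \<rho>_def dist_commute)
          hence "dist (dens w) D < e'" using r'(2)[OF subsetD[OF \<rho>(2) that]] by simp
          thus ?thesis unfolding dist_real_def by linarith
        qed
        have pq: "(1 - e) * FS.rdist p q \<le> delta ip k p q" if "p \<in> ball (\<gamma> x) \<rho>" "q \<in> ball (\<gamma> x) \<rho>" for p q
        proof -
          have "(1 - e) * FS.rdist p q \<le> (1 - e) * ((D + e') * cmod (q - p))"
            using e1 by (intro mult_left_mono FS.rdist_le_segment[OF \<rho>(2) dens_le that]) auto
          also have "\<dots> = ((1 - e) * (D + e')) * cmod (q - p)"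
            by simp
          also have "\<dots> \<le> (D - e') * cmod (q - p)"
          proof (rule mult_right_mono)
            have "(1 - e) * (D + e') = D - e' - e * e'"
            proof -
              have "e * D = 2 * e'" by (simp add: e'_def)
              moreover have "(1 - e) * (D + e') = D + e' - e * D - e * e'" by (simp add: algebra_simps)
              ultimately show ?thesis by linarith
            qed
            thus "(1 - e) * (D + e') \<le> D - e'" using e e' by simp
          qed simp
          also have "\<dots> \<le> delta ip k p q"
            using r(3)[of p q] that unfolding \<rho>_def left_diff_distrib abs_le_iff by auto
          finally show ?thesis .
        qed
        obtain d where d: "0 < d" "\<And>t. t \<in> {a..b} \<Longrightarrow> dist t x < d \<Longrightarrow> dist (\<gamma> t) (\<gamma> x) < \<rho>"
          using \<gamma>(1) x \<rho>(1) unfolding continuous_on_iff by metis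
        show ?case
        proof (intro exI[of _ d] conjI d(1) allI impI)
          fix s t assume st: "s \<le> x \<and> x \<le> t \<and> t - s < d" "a \<le> s \<and> t \<le> b"
          show "ereal ((1 - e) * FS.rdist (\<gamma> s) (\<gamma> t)) \<le> curve_length (delta ip k) s t \<gamma>"
          proof (cases "s = t")
            case True
            thus ?thesis
              using len0[of s t] FS.rdist_self[OF \<gamma>X, of s] st by (simp add: zero_ereal_def)
          next
            case False
            have "\<gamma> s \<in> ball (\<gamma> x) \<rho>" "\<gamma> t \<in> ball (\<gamma> x) \<rho>"
              using d(2)[of s] d(2)[of t] st by (auto simp: dist_commute dist_real_def)
            hence "ereal ((1 - e) * FS.rdist (\<gamma> s) (\<gamma> t)) \<le> ereal (delta ip k (\<gamma> s) (\<gamma> t))"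
              using pq by simp
            also have "\<dots> \<le> curve_length (delta ip k) s t \<gamma>"
              using False st by (intro curve_length_ge_dist) simp
            finally show ?thesis .
          qed
        qed
      qed
    next
      \<comment> \<open>For e >= 1 the left side is not positive.\<close>
      case False
      hence "(1 - e) * FS.rdist (\<gamma> a) (\<gamma> b) \<le> 0"
        using ab by (intro mult_nonpos_nonneg FS.rdist_nonneg \<gamma>X) auto
      hence "ereal ((1 - e) * FS.rdist (\<gamma> a) (\<gamma> b)) \<le> 0"
        by (simp add: zero_ereal_def)
      also note len0[OF order_refl ab order_refl]
      finally show ?thesis by simp
    qed
    thus ?thesis by (simp add: left_diff_distrib)
  qed
  from ereal_le_if_real_le[OF this] show ?thesis
    using ab \<gamma>X by (auto intro: FS.rdist_nonneg)
qed

text \<open>Near a zero \<open>z\<close> of the density \<open>\<delta>\<close> need not dominate any multiple of the Fubini-Study distance. A curve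
  that meets \<open>z\<close> is therefore cut just before its first and just after its last visit to \<open>z\<close>.\<close>

lemma rdist_le_curve_length:
  assumes ab: "a \<le> b" and \<gamma>: "continuous_on {a..b} \<gamma>" "\<gamma> ` {a..b} \<subseteq> X"
  shows "ereal (FS.rdist (\<gamma> a) (\<gamma> b)) \<le> curve_length (delta ip k) a b \<gamma>"
proof -
  have \<gamma>X: "\<gamma> t \<in> X" if "t \<in> {a..b}" for t
    using \<gamma>(2) that by blast
  have len0: "0 \<le> curve_length (delta ip k) s t \<gamma>" if "a \<le> s" "s \<le> t" "t \<le> b" for s t
    using that by (intro curve_length_nonneg delta_nonneg \<gamma>X) auto
  show ?thesis
  proof (cases "\<exists>z1\<in>X. dens z1 \<noteq> 0")
    \<comment> \<open>The density vanishes identically, so every smooth curve has length 0.\<close>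
    case False
    obtain c d \<eta> where \<eta>: "smooth_curve_in X c d \<eta>" "\<eta> c = \<gamma> a" "\<eta> d = \<gamma> b"
      using FS.smooth_curve_exists[OF \<gamma>X \<gamma>X, of a b] ab by auto
    have "dens (\<eta> t) = 0" if "t \<in> {c..d}" for t
      using False \<eta>(1) that unfolding smooth_curve_in_def by blast
    hence "FS.rlen c d \<eta> = integral {c..d} (\<lambda>t. 0)"
      unfolding FS.rlen_eq[OF \<eta>(1)] FS.plen_def
      by (intro Henstock_Kurzweil_Integration.integral_cong) simp
    hence "FS.rdist (\<gamma> a) (\<gamma> b) \<le> 0"
      using FS.rdist_le[OF \<eta>(1)] \<eta>(2,3) by simp
    thus ?thesis
      using len0[OF order_refl ab order_refl] by (metis ereal_less_eq(3) order_trans zero_ereal_def)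
  next
    case True
    then obtain z1 where z1: "z1 \<in> X" "dens z1 \<noteq> 0" by blast
    have "a \<le> a \<and> b \<le> b \<longrightarrow> ?thesis"
    proof (induction rule: Bolzano[OF ab, where P = "\<lambda>s t. a \<le> s \<and> t \<le> b \<longrightarrow>
          ereal (FS.rdist (\<gamma> s) (\<gamma> t)) \<le> curve_length (delta ip k) s t \<gamma>"])
      case (1 s u t)
      show ?case
      proof
        assume st: "a \<le> s \<and> t \<le> b"
        have "FS.rdist (\<gamma> s) (\<gamma> t) \<le> FS.rdist (\<gamma> s) (\<gamma> u) + FS.rdist (\<gamma> u) (\<gamma> t)"
          using st 1 by (intro FS.rdist_triangle \<gamma>X) auto
        hence "ereal (FS.rdist (\<gamma> s) (\<gamma> t)) \<le> ereal (FS.rdist (\<gamma> s) (\<gamma> u)) + ereal (FS.rdist (\<gamma> u) (\<gamma> t))"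
          by simp
        also have "\<dots> \<le> curve_length (delta ip k) s u \<gamma> + curve_length (delta ip k) u t \<gamma>"
          using 1 st by (intro add_mono) auto
        also have "\<dots> \<le> curve_length (delta ip k) s t \<gamma>"
          using st 1 by (intro curve_length_superadditive delta_nonneg \<gamma>X) auto
        finally show "ereal (FS.rdist (\<gamma> s) (\<gamma> t)) \<le> curve_length (delta ip k) s t \<gamma>" .
      qed
    next
      case (2 x)
      hence x: "x \<in> {a..b}" by simp
      let ?z = "\<gamma> x"
      obtain r where r: "0 < r" "ball ?z r \<subseteq> X" "\<And>w. w \<in> ball ?z r - {?z} \<Longrightarrow> 0 < dens w"
        using dens_zeros_isolated[OF z1 \<gamma>X[OF x]] by blast
      obtain \<rho> M where \<rho>: "0 < \<rho>" "ball ?z \<rho> \<subseteq> X" "\<And>p q. p \<in> ball ?z \<rho> \<Longrightarrow> q \<in> ball ?z \<rho> \<Longrightarrow> FS.rdist p q \<le> M * cmod (q - p)"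
        using FS.rdist_locally_lipschitz[OF \<gamma>X[OF x]] by blast
      obtain d where d: "0 < d" "\<And>t. t \<in> {a..b} \<Longrightarrow> dist t x < d \<Longrightarrow> dist (\<gamma> t) ?z < r"
        using \<gamma>(1) x r(1) unfolding continuous_on_iff by metis
      show ?case
      proof (intro exI[of _ d] conjI d(1) allI impI)
        fix s t assume st: "s \<le> x \<and> x \<le> t \<and> t - s < d" "a \<le> s \<and> t \<le> b"
        have sub: "{s..t} \<subseteq> {a..b}" using st by auto
        have pos: "0 < dens (\<gamma> u)" if "u \<in> {s..t}" "\<gamma> u \<noteq> ?z" for u
          using d(2)[of u] r(3)[of "\<gamma> u"] that st by (auto simp: dist_commute dist_real_def)
        \<comment> \<open>The times of the visits to z; compactness provides a first and a last
          one.\<close>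
        define S where "S = {u \<in> {s..t}. \<gamma> u = ?z}"
        have xS: "x \<in> S" using st by (simp add: S_def)
        have "compact S"
          unfolding S_def compact_eq_bounded_closed
        proof
          show "bounded {u \<in> {s..t}. \<gamma> u = ?z}"
            by (rule bounded_subset[OF bounded_closed_interval[of s t]]) auto
          show "closed {u \<in> {s..t}. \<gamma> u = ?z}"
            by (rule continuous_closed_preimage_constant[OF continuous_on_subset[OF \<gamma>(1) sub] closed_atLeastAtMost])
        qed
        then obtain u0 u1 where u: "u0 \<in> S" "\<And>u. u \<in> S \<Longrightarrow> u0 \<le> u" "u1 \<in> S" "\<And>u. u \<in> S \<Longrightarrow> u \<le> u1"
          using compact_attains_inf[of S] compact_attains_sup[of S] xS by (metis empty_iff)
        have ux: "s \<le> u0" "u0 \<le> x" "x \<le> u1" "u1 \<le> t"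
          using u xS by (auto simp: S_def)
        \<comment> \<open>The piece ends strictly before the first visit, since the density may be 0
          at z; u = s is the case in which nothing remains before it.\<close>
        have before: "ereal (FS.rdist (\<gamma> s) (\<gamma> u)) \<le> curve_length (delta ip k) s u \<gamma>" if "s \<le> u" "u < u0 \<or> u = s" for u
        proof (cases "u = s")
          case True
          thus ?thesis using len0[of s s] FS.rdist_self[OF \<gamma>X, of s] st by (simp add: zero_ereal_def)
        next
          case False
          hence "u < u0" using that by simp
          show ?thesis
          proof (intro rdist_le_curve_length_nondegenerate)
            have sub': "{s..u} \<subseteq> {s..t}" using \<open>u < u0\<close> ux by auto
            show "s \<le> u" using that by simp
            show "continuous_on {s..u} \<gamma>" "\<gamma> ` {s..u} \<subseteq> X"
              using sub sub' \<gamma> by (auto intro: continuous_on_subset)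
            show "0 < dens (\<gamma> w)" if w: "w \<in> {s..u}" for w
            proof (rule pos)
              show "w \<in> {s..t}" using w sub' by blast
              hence "\<gamma> w \<noteq> ?z" if "w \<notin> S" using that by (simp add: S_def)
              moreover have "w \<notin> S" using u(2)[of w] \<open>u < u0\<close> w by auto
              ultimately show "\<gamma> w \<noteq> ?z" by blast
            qed
          qed
        qed
        have after: "ereal (FS.rdist (\<gamma> v) (\<gamma> t)) \<le> curve_length (delta ip k) v t \<gamma>" if "v \<le> t" "u1 < v \<or> v = t" for v
        proof (cases "v = t")
          case True
          thus ?thesis using len0[of t t] FS.rdist_self[OF \<gamma>X, of t] st by (simp add: zero_ereal_def)
        next
          case False
          hence "u1 < v" using that by simp
          show ?thesis
          proof (intro rdist_le_curve_length_nondegenerate)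
            have sub': "{v..t} \<subseteq> {s..t}" using \<open>u1 < v\<close> ux by auto
            show "v \<le> t" using that by simp
            show "continuous_on {v..t} \<gamma>" "\<gamma> ` {v..t} \<subseteq> X"
              using sub sub' \<gamma> by (auto intro: continuous_on_subset)
            show "0 < dens (\<gamma> w)" if w: "w \<in> {v..t}" for w
            proof (rule pos)
              show "w \<in> {s..t}" using w sub' by blast
              hence "\<gamma> w \<noteq> ?z" if "w \<notin> S" using that by (simp add: S_def)
              moreover have "w \<notin> S" using u(4)[of w] \<open>u1 < v\<close> w by auto
              ultimately show "\<gamma> w \<noteq> ?z" by blast
            qed
          qed
        qed
        have "ereal (FS.rdist (\<gamma> s) (\<gamma> t) - e * (2 * \<bar>M\<bar>)) \<le> curve_length (delta ip k) s t \<gamma>" if e: "0 < e" for e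
        proof -
          have e': "0 < min e \<rho>" using e \<rho>(1) by simp
          have near: "\<exists>d>0. \<forall>t\<in>{a..b}. dist t w < d \<longrightarrow> dist (\<gamma> t) ?z < min e \<rho>" if "w \<in> S" for w
          proof -
            have "w \<in> {a..b}" "\<gamma> w = ?z" using that sub by (auto simp: S_def)
            thus ?thesis using \<gamma>(1) e' unfolding continuous_on_iff by metis
          qed
          obtain d0 where d0: "d0 > 0" "\<And>t. t \<in> {a..b} \<Longrightarrow> dist t u0 < d0 \<Longrightarrow> dist (\<gamma> t) ?z < min e \<rho>"
            using near[OF u(1)] by blast
          obtain d1 where d1: "d1 > 0" "\<And>t. t \<in> {a..b} \<Longrightarrow> dist t u1 < d1 \<Longrightarrow> dist (\<gamma> t) ?z < min e \<rho>"
            using near[OF u(3)] by blast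
          \<comment> \<open>Cut points close to the first and the last visit, clipped to the
            interval; a clipped cut point leaves an empty outer piece.\<close>
          define p where "p = max s (u0 - d0 / 2)"
          define q where "q = min t (u1 + d1 / 2)"
          have pq: "s \<le> p" "p < u0 \<or> p = s" "p \<le> q" "q \<le> t" "u1 < q \<or> q = t"
            using d0(1) d1(1) ux by (auto simp: p_def q_def)
          have nz: "dist (\<gamma> p) ?z < min e \<rho>" "dist (\<gamma> q) ?z < min e \<rho>"
            using d0 d1 ux st by (auto intro!: d0(2) d1(2) simp: p_def q_def dist_real_def)
          have "FS.rdist (\<gamma> p) (\<gamma> q) \<le> M * cmod (\<gamma> q - \<gamma> p)"
            using nz by (intro \<rho>(3)) (auto simp: dist_commute)
          also have "\<dots> \<le> \<bar>M\<bar> * (2 * e)"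
          proof (rule mult_mono)
            show "cmod (\<gamma> q - \<gamma> p) \<le> 2 * e"
              using nz dist_triangle2[of "\<gamma> q" "\<gamma> p" ?z] unfolding dist_norm by linarith
          qed auto
          finally have mid: "FS.rdist (\<gamma> p) (\<gamma> q) \<le> e * (2 * \<bar>M\<bar>)" by (simp add: mult_ac)
          have X4: "\<gamma> s \<in> X" "\<gamma> p \<in> X" "\<gamma> q \<in> X" "\<gamma> t \<in> X"
            using pq st by (auto intro!: \<gamma>X)
          have "FS.rdist (\<gamma> s) (\<gamma> t) \<le> FS.rdist (\<gamma> s) (\<gamma> p) + (FS.rdist (\<gamma> p) (\<gamma> q) + FS.rdist (\<gamma> q) (\<gamma> t))"
            using FS.rdist_triangle[OF X4(1,2,4)] FS.rdist_triangle[OF X4(2,3,4)] by simp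
          hence "FS.rdist (\<gamma> s) (\<gamma> t) - e * (2 * \<bar>M\<bar>) \<le> FS.rdist (\<gamma> s) (\<gamma> p) + FS.rdist (\<gamma> q) (\<gamma> t)"
            using mid by simp
          hence "ereal (FS.rdist (\<gamma> s) (\<gamma> t) - e * (2 * \<bar>M\<bar>)) \<le>
              ereal (FS.rdist (\<gamma> s) (\<gamma> p)) + ereal (FS.rdist (\<gamma> q) (\<gamma> t))"
            by simp
          also have "\<dots> \<le> curve_length (delta ip k) s p \<gamma> + curve_length (delta ip k) q t \<gamma>"
            using before after pq by (intro add_mono) auto
          \<comment> \<open>The loops between p and q only add to the \<delta>-length, whereas in
            the restricted distance they cost at most 2 |M| e.\<close>
          also have "\<dots> \<le> curve_length (delta ip k) s q \<gamma> + curve_length (delta ip k) q t \<gamma>"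
            using pq st by (intro add_mono order_refl curve_length_subinterval delta_nonneg \<gamma>X) auto
          also have "\<dots> \<le> curve_length (delta ip k) s t \<gamma>"
            using pq X4 by (intro curve_length_superadditive delta_nonneg) auto
          finally show ?thesis .
        qed
        from ereal_le_if_real_le[OF this]
        show "ereal (FS.rdist (\<gamma> s) (\<gamma> t)) \<le> curve_length (delta ip k) s t \<gamma>" by simp
      qed
    qed
    thus ?thesis by simp
  qed
qed

text \<open>Continuous curves are estimated for the smallest distance \<delta> only, and the upper
  bound by smooth curves for the largest only; monotonicity gives the rest.\<close>

lemma inner_distances:
  assumes "x \<in> X" "y \<in> X"
  shows "inner_distance X (delta ip k) x y = ereal (FS.rdist x y)"
    "inner_distance X (delta_hat ip k) x y = ereal (FS.rdist x y)"
    "inner_distance X FS.rdist x y = ereal (FS.rdist x y)"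
proof -
  have lower: "ereal (FS.rdist x y) \<le> inner_distance X (delta ip k) x y"
    unfolding inner_distance_def
  proof (rule Inf_greatest)
    fix l assume "l \<in> {curve_length (delta ip k) a b \<gamma> |a b \<gamma>. curve_in X a b \<gamma> \<and> \<gamma> a = x \<and> \<gamma> b = y}"
    then obtain a b \<gamma> where "l = curve_length (delta ip k) a b \<gamma>" "curve_in X a b \<gamma>" "\<gamma> a = x" "\<gamma> b = y"
      by blast
    thus "ereal (FS.rdist x y) \<le> l"
      using rdist_le_curve_length[of a b \<gamma>] by (auto simp: curve_in_def)
  qed
  have mono: "inner_distance X (delta ip k) x y \<le> inner_distance X (delta_hat ip k) x y"
    "inner_distance X (delta_hat ip k) x y \<le> inner_distance X FS.rdist x y"
    by (intro inner_distance_mono distances_chain; assumption)+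
  have upper: "inner_distance X FS.rdist x y \<le> ereal (FS.rdist x y)"
  proof (rule ereal_le_epsilon2)
    fix e :: real assume "0 < e"
    then obtain a b \<gamma> where \<gamma>: "smooth_curve_in X a b \<gamma>" "\<gamma> a = x" "\<gamma> b = y" "FS.rlen a b \<gamma> < FS.rdist x y + e"
      using FS.rdist_lessE[OF assms, of "FS.rdist x y + e"] by auto
    have "inner_distance X FS.rdist x y \<le> curve_length FS.rdist a b \<gamma>"
      unfolding inner_distance_def using smooth_curve_in_curve_in[OF \<gamma>(1)] \<gamma>(2,3) by (intro Inf_lower) blast
    also have "\<dots> \<le> ereal (FS.rdist x y) + ereal e"
      unfolding smooth_curve_lengths[OF \<gamma>(1)] using \<gamma>(4) by simp
    finally show "inner_distance X FS.rdist x y \<le> ereal (FS.rdist x y) + ereal e" .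
  qed
  show "inner_distance X (delta ip k) x y = ereal (FS.rdist x y)"
    "inner_distance X (delta_hat ip k) x y = ereal (FS.rdist x y)"
    "inner_distance X FS.rdist x y = ereal (FS.rdist x y)"
    using lower mono upper by auto
qed

section \<open>Strict inequality\<close>

text \<open>Take g in H that is not a multiple of \<open>k x\<close> and remove its component along
  \<open>k x\<close>; by reproduction the remainder vanishes at x. It is not 0, and a point where it
  differs from 0 lies in X because functions in H vanish off X.\<close>

lemma exists_vanishing:
  assumes dim: "\<not> one_dimensional H" and x: "x \<in> X"
  obtains f w where "f \<in> H" "f x = 0" "w \<in> X" "f w \<noteq> 0"
proof -
  have kx: "k x x \<noteq> 0"
    using nrm_kernel_pos[OF x] Re_kernel_diagonal[OF x] by auto
  have "H \<noteq> {\<lambda>z. c * k x z |c. True}"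
    using dim kernel_nonzero[OF x] unfolding one_dimensional_def by blast
  moreover have "{\<lambda>z. c * k x z |c. True} \<subseteq> H"
    using scale_mem[OF kernel_mem[OF x]] by blast
  ultimately obtain g where g: "g \<in> H" "\<And>c. g \<noteq> (\<lambda>z. c * k x z)"
    by blast
  define f where "f = (\<lambda>z. g z - g x / k x x * k x z)"
  have f: "f \<in> H"
    unfolding f_def by (intro diff_mem scale_mem g kernel_mem x)
  obtain w where w: "g w \<noteq> g x / k x x * k x w"
    using g(2)[of "g x / k x x"] by blast
  hence fw: "f w \<noteq> 0" by (simp add: f_def)
  hence "w \<in> X" using vanish_off[OF f] by blast
  thus ?thesis using that[OF f _ _ fw] kx by (simp add: f_def)
qed

text \<open>A function in \<open>H\<close> that vanishes at \<open>x\<close> but on no point of a small circle around \<open>x\<close> bounds the distance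
  from \<open>x\<close> to that circle from below.\<close>

lemma rdist_pos:
  assumes dim: "\<not> one_dimensional H" and xy: "x \<in> X" "y \<in> X" "x \<noteq> y"
  shows "0 < FS.rdist x y"
proof -
  obtain f w where f: "f \<in> H" "f x = 0" "w \<in> X" "f w \<noteq> 0"
    using exists_vanishing[OF dim xy(1)] by blast
  have hol: "f holomorphic_on X" by (rule holomorphic_mem[OF f(1)])
  obtain r1 where r1: "0 < r1" "ball x r1 \<subseteq> X" "\<And>z. z \<in> ball x r1 - {x} \<Longrightarrow> f z \<noteq> 0"
    using isolated_zeros[OF hol open_X connected_X xy(1) f(2) f(3) f(4)] by blast
  obtain r2 M where r2: "0 < r2" "cball x r2 \<subseteq> X" "0 \<le> M" "\<And>z. z \<in> cball x r2 \<Longrightarrow> nrm (k z) \<le> M"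
    using weakly_holomorphic_locally_bounded[OF kernel_mem ip_kernel_holomorphic xy(1)] by blast
  \<comment> \<open>Small enough that the circle avoids the other zeros of f and the kernels are
    bounded on it, and at most \<open>dist x y\<close> so that every curve from x to y meets the
    circle.\<close>
  define r where "r = min (min (r1 / 2) r2) (dist x y)"
  have r: "0 < r" "r < r1" "r \<le> r2" "r \<le> dist x y"
    using r1(1) r2(1) xy(3) by (auto simp: r_def min_def)
  have sph: "z \<in> X" "f z \<noteq> 0" "nrm (k z) \<le> M" if "z \<in> sphere x r" for z
  proof -
    have "z \<in> ball x r1 - {x}" using that r by auto
    thus "z \<in> X" "f z \<noteq> 0" using r1 by blast+
    show "nrm (k z) \<le> M" using r2(4) that r by simp
  qed
  have "continuous_on (sphere x r) f"
    using holomorphic_on_imp_continuous_on[OF hol] sph(1) by (blast intro: continuous_on_subset)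
  hence "\<exists>z0\<in>sphere x r. \<forall>z\<in>sphere x r. cmod (f z0) \<le> cmod (f z)"
    using r(1) by (intro continuous_attains_inf compact_sphere continuous_on_norm) auto
  then obtain z0 where z0: "z0 \<in> sphere x r" "\<And>z. z \<in> sphere x r \<Longrightarrow> cmod (f z0) \<le> cmod (f z)"
    by blast
  have nf: "0 < nrm f"
    using nrm_nonneg[OF f(1)] nrm_eq_0[OF f(1)] f(4) by (metis less_eq_real_def)
  have M: "0 < M"
    using sph(3)[OF z0(1)] nrm_kernel_pos[OF sph(1)[OF z0(1)]] by linarith
  define m where "m = cmod (f z0) / (nrm f * M)"
  have m: "0 < m"
    using sph(2)[OF z0(1)] nf M by (simp add: m_def)
  \<comment> \<open>As f is orthogonal to \<open>k x\<close>, pairing it with the orthogonal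
    component of \<open>k z\<close> recovers the value of f at z; Cauchy-Schwarz then bounds
    \<open>gram\<close> from below.\<close>
  have delta_ge: "m \<le> delta ip k x z" if z: "z \<in> sphere x r" for z
  proof -
    note mem = kernel_mem[OF xy(1)] kernel_mem[OF sph(1)[OF z]]
    have K: "0 < nrm (k x)" by (rule nrm_kernel_pos[OF xy(1)])
    have "ip (k x) f = 0"
      using ip_cnj[OF f(1) mem(1)] reproducing[OF f(1) xy(1)] f(2) by simp
    hence "ip (pcomp (k x) (k z)) f = of_real ((nrm (k x))\<^sup>2) * cnj (f z)"
      using ip_pcomp[OF mem f(1)] ip_cnj[OF f(1) mem(2)] reproducing[OF f(1) sph(1)[OF z]] by simp
    hence "(nrm (k x))\<^sup>2 * cmod (f z) = cmod (ip (pcomp (k x) (k z)) f)"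
      by (simp add: norm_mult norm_power)
    also have "\<dots> \<le> nrm (k x) * gram ip (k x) (k z) * nrm f"
      using cauchy_schwarz[OF f(1) pcomp_mem[OF mem]] nrm_pcomp[OF mem] by simp
    finally have "nrm (k x) * cmod (f z) \<le> gram ip (k x) (k z) * nrm f"
      using K by (simp add: power2_eq_square mult.assoc)
    hence "cmod (f z) / nrm f \<le> gram ip (k x) (k z) / nrm (k x)"
      using K nf by (simp add: field_simps)
    have "m \<le> cmod (f z) / nrm f / nrm (k z)"
      unfolding m_def divide_divide_eq_left
      using z0(2)[OF z] sph(3)[OF z] nrm_kernel_pos[OF sph(1)[OF z]] nf
      by (intro frac_le mult_left_mono mult_pos_pos) auto
    also have "\<dots> \<le> gram ip (k x) (k z) / nrm (k x) / nrm (k z)"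
      using nrm_kernel_pos[OF sph(1)[OF z]] \<open>cmod (f z) / nrm f \<le> gram ip (k x) (k z) / nrm (k x)\<close>
      by (intro divide_right_mono) auto
    also have "\<dots> = delta ip k x z"
      by (simp add: delta_gram xy(1) sph(1)[OF z])
    finally show ?thesis .
  qed
  have "m \<le> FS.rdist x y"
  proof (rule field_le_epsilon)
    fix e :: real assume "0 < e"
    then obtain a b \<gamma> where \<gamma>: "smooth_curve_in X a b \<gamma>" "\<gamma> a = x" "\<gamma> b = y" "FS.rlen a b \<gamma> < FS.rdist x y + e"
      using FS.rdist_lessE[OF xy(1,2), of "FS.rdist x y + e"] by auto
    have ab: "a < b" "\<And>t. t \<in> {a..b} \<Longrightarrow> \<gamma> t \<in> X"
      using \<gamma>(1) by (auto simp: smooth_curve_in_def)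
    have "continuous_on {a..b} (\<lambda>t. dist x (\<gamma> t))"
      by (intro continuous_intros c1_curve_continuous[OF smooth_c1_curve[OF \<gamma>(1)]])
    \<comment> \<open>The curve starts at the centre and ends at distance at least r, so it crosses
      the circle.\<close>
    then obtain t where t: "a \<le> t" "t \<le> b" "dist x (\<gamma> t) = r"
      using IVT'[of "\<lambda>t. dist x (\<gamma> t)" a r b] \<gamma>(2,3) r ab by auto
    have "a \<noteq> t" using t(3) \<gamma>(2) r(1) by auto
    have "ereal m \<le> ereal (delta ip k (\<gamma> a) (\<gamma> t))"
      using delta_ge[of "\<gamma> t"] t(3) \<gamma>(2) by simp
    also have "\<dots> \<le> curve_length (delta ip k) a t \<gamma>"
      using t \<open>a \<noteq> t\<close> by (intro curve_length_ge_dist) simp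
    also have "\<dots> \<le> curve_length (delta ip k) a b \<gamma>"
      using t ab by (intro curve_length_subinterval delta_nonneg) auto
    also have "\<dots> = ereal (FS.rlen a b \<gamma>)"
      by (rule smooth_curve_lengths[OF \<gamma>(1)])
    finally show "m \<le> FS.rdist x y + e"
      using \<gamma>(4) by simp
  qed
  thus ?thesis using m by simp
qed

text \<open>Distinct points may have the same line; then \<delta>-hat is 0 and strictness rests on
  \<open>rdist_pos\<close>. Otherwise the chord is shorter than the arc.\<close>

lemma delta_hat_less_rdist:
  assumes dim: "\<not> one_dimensional H" and xy: "x \<in> X" "y \<in> X" "x \<noteq> y"
  shows "delta_hat ip k x y < FS.rdist x y"
proof (cases "angle x y = 0")
  case True
  thus ?thesis
    using rdist_pos[OF assms] by (simp add: delta_hat_eq[OF xy(1,2)])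
next
  case False
  hence "0 < angle x y"
    using angle_bounds(1)[OF xy(1,2)] by simp
  thus ?thesis
    using delta_hat_less_angle[OF xy(1,2)] angle_le_rdist[OF xy(1,2)] by linarith
qed

end

theorem proposition9:
  fixes X :: "complex set"
    and H :: "(complex \<Rightarrow> complex) set"
    and ip :: "(complex \<Rightarrow> complex) \<Rightarrow> (complex \<Rightarrow> complex) \<Rightarrow> complex"
    and k :: "complex \<Rightarrow> complex \<Rightarrow> complex"
  assumes "open X" and "connected X" and "X \<noteq> {}"
    and "reproducing_kernel_hilbert_space X H ip k"
    and "\<forall>f\<in>H. f holomorphic_on X"
    and "\<forall>x\<in>X. \<forall>y\<in>X. x \<noteq> y \<longrightarrow> (\<exists>f\<in>H. \<exists>g\<in>H. f x \<noteq> 0 \<and> g x \<noteq> g y)"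
  shows
    "(\<forall>a b \<gamma>. smooth_curve_in X a b \<gamma> \<longrightarrow>
        curve_length (delta ip k) a b \<gamma> = curve_length (delta_hat ip k) a b \<gamma> \<and>
        curve_length (delta_hat ip k) a b \<gamma> = curve_length (delta_check X H ip k) a b \<gamma> \<and>
        curve_length (delta_check X H ip k) a b \<gamma> = ereal (1/2 * length_BS k a b \<gamma>)) \<and>
     (\<forall>x\<in>X. \<forall>y\<in>X.
        inner_distance X (delta ip k) x y = inner_distance X (delta_hat ip k) x y \<and>
        inner_distance X (delta_hat ip k) x y = inner_distance X (delta_check X H ip k) x y \<and>
        inner_distance X (delta_check X H ip k) x y = ereal (delta_check X H ip k x y) \<and>
        delta_check X H ip k x y = 1/2 * delta_BS X k x y) \<and>
     (\<not> one_dimensional H \<longrightarrow>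
        (\<forall>x\<in>X. \<forall>y\<in>X. x \<noteq> y \<longrightarrow>
           ereal (delta_hat ip k x y) < inner_distance X (delta_hat ip k) x y)) \<and>
     (\<not> one_dimensional H \<longrightarrow>
        (\<forall>x\<in>X. \<forall>y\<in>X. x \<noteq> y \<longrightarrow>
           ereal (delta ip k x y) < inner_distance X (delta ip k) x y))"
proof -
  interpret R: reproducing_kernel_hilbert_space X H ip k by fact
  have kernel_nonzero: "k x \<noteq> (\<lambda>z. 0)" if x: "x \<in> X" for x
  proof
    assume k0: "k x = (\<lambda>z. 0)"
    \<comment> \<open>Nondegeneracy speaks of pairs of distinct points, so a second point is
      required; a nonempty open set has one.\<close>
    have "\<not> finite X"
      using \<open>open X\<close> \<open>X \<noteq> {}\<close> finite_imp_not_open by blast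
    then obtain y where "y \<in> X" "x \<noteq> y"
      using finite_subset[of X "{x}"] by blast
    then obtain f where f: "f \<in> H" "f x \<noteq> 0"
      using assms(6) x by blast
    show False
      using R.reproducing[OF f(1) x] R.ip_scale_right[OF R.zero_mem f(1), of 0] f(2) k0 by simp
  qed
  interpret holomorphic_rkhs X H ip k
    using assms(1,2,5) kernel_nonzero by unfold_locales auto
  have dc: "delta_check X H ip k = FS.rdist" and dB: "delta_BS X k = BS.rdist" and lB: "length_BS k = BS.rlen"
    by (auto simp: delta_check_def delta_BS_def length_BS_def fun_eq_iff)
  show ?thesis
    unfolding dc dB lB
  proof (intro conjI allI ballI impI)
    fix x y assume "\<not> one_dimensional H" "x \<in> X" "y \<in> X" "x \<noteq> y"
    thus "ereal (delta_hat ip k x y) < inner_distance X (delta_hat ip k) x y"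
      "ereal (delta ip k x y) < inner_distance X (delta ip k) x y"
      using delta_hat_less_rdist[of x y] delta_le_delta_hat[of x y] by (simp_all add: inner_distances)
  qed (simp_all add: smooth_curve_lengths rlen_BS inner_distances rdist_BS)
qed

end
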